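(* The space $\operatorname{Diff}^+(\mathbb{T}^2)$ admits a Kähler structure $(\operatorname{Diff}^+(\mathbb{T}^2),G,I)$, where $G$ is a scalar product compatible with the complex structure $I$; explicitly, for $u,v\in T_f\operatorname{Diff}^+(\mathbb{T}^2)$, $G(u,v)=\int_{\mathbb{T}^2}g(u,v)\,\sigma$ and $(Iu)_x=I_{f(x)}u_x$. Let $\Omega(u,v)=G(Iu,v)=\int_{\mathbb{T}^2}\sigma(u,v)\,\sigma$ be the associated Kähler form. Then $\Omega$ is invariant under the action of $\operatorname{Ham}(\mathbb{T}^2,\sigma)$ by precomposition. Moreover, the action of $\operatorname{Ham}(\mathbb{T}^2,\sigma)$ is Hamiltonian with respect to $\Omega$, and the associated moment map is $$\mu:\operatorname{Diff}^+(\mathbb{T}^2)\to\mathcal{C}^\infty_0(\mathbb{T}^2),\qquad \mu(f)=-\frac{f^*\sigma}{\sigma}+1 .$$ Its zero locus is exactly the group $\operatorname{Symp}(\mathbb{T}^2,\sigma)$ of symplectomorphisms.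
   Context: $\mathbb{T}^2=\mathbb{C}/\Lambda$ for a lattice $\Lambda\subset\mathbb{C}$ acting by translation, with the flat metric $g=|dz|^2$, the complex structure $I$ (multiplication by $i$ on each tangent space) and the Kähler form $\sigma=\frac{i}{2}dz\wedge d\bar z=g(I\cdot,\cdot)$. $\operatorname{Diff}^+(\mathbb{T}^2)=\{f\in\operatorname{Diff}(\mathbb{T}^2): f^*[\sigma]=[\sigma]\}$, where $[\sigma]$ is the de Rham class of $\sigma$ (these are the orientation preserving diffeomorphisms). Diffeomorphisms are smooth. The tangent space $T_f\operatorname{Diff}^+(\mathbb{T}^2)$ is $\Gamma(f^*T\mathbb{T}^2)$, the space of maps $u:\mathbb{T}^2\to T\mathbb{T}^2$ lying over $f$; each such $u$ is uniquely of the form $f_*X:=df\circ X$ with $X$ a vector field on $\mathbb{T}^2$. The Kähler structure is meant in the weak infinite-dimensional sense (nondegeneracy of $G$ and $\Omega$ is weak nondegeneracy, and $d\Omega=0$). $\operatorname{Symp}(\mathbb{T}^2,\sigma)=\{\varphi: \varphi^*\sigma=\sigma\}$; $\operatorname{Ham}(\mathbb{T}^2,\sigma)$ is its subgroup of Hamiltonian diffeomorphisms, acting on $\operatorname{Diff}^+(\mathbb{T}^2)$ by $f\mapsto f\circ\varphi$. Its Lie algebra is identified with $\mathcal{C}^\infty_0(\mathbb{T}^2)$, the smooth functions $h$ with $\int_{\mathbb{T}^2} h\,\sigma=0$, via $h\mapsto X_h$, $\iota_{X_h}\sigma=-dh$. The infinitesimal action of $h$ at $f$ is $f_*X_h$.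 Convention: the action is Hamiltonian with moment map $\mu$ if for all $f$, $h\in\mathcal{C}^\infty_0(\mathbb{T}^2)$ and $f_*Y\in T_f\operatorname{Diff}^+(\mathbb{T}^2)$ one has $\Omega(f_*X_h,f_*Y)=-\int_{\mathbb{T}^2}D_f\mu(f_*Y)\,h\,\sigma$, and $\mu(f\circ\varphi)=\mu(f)\circ\varphi$ for all $\varphi\in\operatorname{Ham}(\mathbb{T}^2,\sigma)$. The quotient $\frac{f^*\sigma}{\sigma}$ is the function $H_f$ with $f^*\sigma=H_f\,\sigma$. *)

theory Defs
  imports "HOL-Analysis.Analysis"
begin

section \<open>Smooth functions between Euclidean spaces\<close>

text \<open>For \<open>vs = [v1, ..., vk]\<close> this is the iterated directional derivative of \<open>F\<close>,
  first along \<open>v1\<close>, last along \<open>vk\<close>.\<close>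

fun iter_deriv :: "'a::real_normed_vector list \<Rightarrow> ('a \<Rightarrow> 'b::real_normed_vector) \<Rightarrow> 'a \<Rightarrow> 'b" where
  "iter_deriv [] F = F"
| "iter_deriv (v # vs) F = iter_deriv vs (\<lambda>x. frechet_derivative F (at x) v)"

text \<open>\<open>C\<^sup>\<infinity>\<close> on an open set \<open>S\<close>.  (All iterated directional derivatives are then
  Frechet differentiable, hence continuous.)\<close>

definition smooth_on :: "'a::real_normed_vector set \<Rightarrow> ('a \<Rightarrow> 'b::real_normed_vector) \<Rightarrow> bool" where
  "smooth_on S F \<longleftrightarrow> (\<forall>vs. \<forall>x\<in>S. iter_deriv vs F differentiable (at x))"


section \<open>The torus and its calculus\<close>

definition lattice_basis :: "complex set \<Rightarrow> complex \<Rightarrow> complex \<Rightarrow> bool" where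
  "lattice_basis \<Lambda> a b \<longleftrightarrow> a \<noteq> b \<and> independent {a, b} \<and>
     \<Lambda> = {of_int m * a + of_int n * b | m n. True}"

definition is_lattice :: "complex set \<Rightarrow> bool" where
  "is_lattice \<Lambda> \<longleftrightarrow> (\<exists>a b. lattice_basis \<Lambda> a b)"

text \<open>The torus is the set of cosets of \<open>\<Lambda>\<close>.  Maps defined on it are taken
  \<open>extensional\<close>, so that equality of maps is equality of HOL functions.\<close>

definition proj :: "complex set \<Rightarrow> complex \<Rightarrow> complex set" where
  "proj \<Lambda> z = {w. w - z \<in> \<Lambda>}"

definition torus :: "complex set \<Rightarrow> complex set set" where
  "torus \<Lambda> = range (proj \<Lambda>)"

definition rep :: "complex set \<Rightarrow> complex" where
  "rep p = (SOME z. z \<in> p)"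

text \<open>The area form \<open>\<sigma> = dx \<and> dy\<close> induces the image of Lebesgue measure on a
  fundamental parallelogram; for functions on the torus the integral does not depend on the
  basis chosen.\<close>

definition fund_domain :: "complex set \<Rightarrow> complex set" where
  "fund_domain \<Lambda> = (let (a, b) = (SOME (a, b). lattice_basis \<Lambda> a b)
     in {s *\<^sub>R a + t *\<^sub>R b | s t. 0 \<le> s \<and> s < 1 \<and> 0 \<le> t \<and> t < 1})"

definition torus_integral :: "complex set \<Rightarrow> (complex set \<Rightarrow> real) \<Rightarrow> real" where
  "torus_integral \<Lambda> h = (LINT z:fund_domain \<Lambda>|lborel. h (proj \<Lambda> z))"

text \<open>Differentiability and smoothness of torus-valued maps are those of local lifts to
  \<open>\<complex>\<close>, the local inverses of the projection being the charts of the torus.\<close>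

definition has_torus_derivative ::
    "complex set \<Rightarrow> ('a::real_normed_vector \<Rightarrow> complex set) \<Rightarrow> ('a \<Rightarrow> complex) \<Rightarrow> 'a \<Rightarrow> bool" where
  "has_torus_derivative \<Lambda> \<gamma> D z \<longleftrightarrow>
     (\<exists>F. (F has_derivative D) (at z) \<and> (\<forall>\<^sub>F y in nhds z. \<gamma> y = proj \<Lambda> (F y)))"

definition torus_derivative ::
    "complex set \<Rightarrow> ('a::real_normed_vector \<Rightarrow> complex set) \<Rightarrow> 'a \<Rightarrow> 'a \<Rightarrow> complex" where
  "torus_derivative \<Lambda> \<gamma> z = (THE D. has_torus_derivative \<Lambda> \<gamma> D z)"

definition smooth_into_torus ::
    "complex set \<Rightarrow> 'a::real_normed_vector set \<Rightarrow> ('a \<Rightarrow> complex set) \<Rightarrow> bool" where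
  "smooth_into_torus \<Lambda> S \<gamma> \<longleftrightarrow>
     (\<forall>z\<in>S. \<exists>U F. open U \<and> z \<in> U \<and> smooth_on U F \<and> (\<forall>y\<in>U \<inter> S. \<gamma> y = proj \<Lambda> (F y)))"

text \<open>\<open>C\<^sup>\<infinity>(T\<^sup>2, V)\<close>, and the functions of mean zero.\<close>

definition cinf :: "complex set \<Rightarrow> (complex set \<Rightarrow> 'b::real_normed_vector) set" where
  "cinf \<Lambda> = {h \<in> extensional (torus \<Lambda>). smooth_on UNIV (\<lambda>z. h (proj \<Lambda> z))}"

definition cinf0 :: "complex set \<Rightarrow> (complex set \<Rightarrow> real) set" where
  "cinf0 \<Lambda> = {h \<in> cinf \<Lambda>. torus_integral \<Lambda> h = 0}"

definition fun_diff :: "complex set \<Rightarrow> (complex set \<Rightarrow> real) \<Rightarrow> complex set \<Rightarrow> complex \<Rightarrow> real" where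
  "fun_diff \<Lambda> h p a = frechet_derivative (\<lambda>z. h (proj \<Lambda> z)) (at (rep p)) a"

text \<open>The tangent bundle, in its trivialisation by translations: \<open>(p, a)\<close> is the tangent
  vector at \<open>p\<close> which is the image of \<open>a\<close> under the differential of the projection at any
  point of the coset \<open>p\<close>.\<close>

type_synonym tangent = "complex set \<times> complex"

definition tangent_map ::
    "complex set \<Rightarrow> (complex set \<Rightarrow> complex set) \<Rightarrow> tangent \<Rightarrow> tangent" where
  "tangent_map \<Lambda> f v =
     (f (fst v), torus_derivative \<Lambda> (\<lambda>z. f (proj \<Lambda> z)) (rep (fst v)) (snd v))"

text \<open>The metric \<open>|dz|\<^sup>2\<close>, the complex structure and the Kaehler form of the torus; they are
  only meant for vectors with the same base point.\<close>

definition flat_metric :: "tangent \<Rightarrow> tangent \<Rightarrow> real" where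
  "flat_metric v w = snd v \<bullet> snd w"

definition cstruct :: "tangent \<Rightarrow> tangent" where
  "cstruct v = (fst v, \<i> * snd v)"

definition sigma :: "tangent \<Rightarrow> tangent \<Rightarrow> real" where
  "sigma v w = flat_metric (cstruct v) w"

definition pullback_sigma ::
    "complex set \<Rightarrow> (complex set \<Rightarrow> complex set) \<Rightarrow> tangent \<Rightarrow> tangent \<Rightarrow> real" where
  "pullback_sigma \<Lambda> f v w = sigma (tangent_map \<Lambda> f v) (tangent_map \<Lambda> f w)"

text \<open>The function \<open>H\<close> with \<open>f\<^sup>*\<sigma> = H \<sigma>\<close>.\<close>

definition sigma_quotient :: "complex set \<Rightarrow> (complex set \<Rightarrow> complex set) \<Rightarrow> complex set \<Rightarrow> real" where
  "sigma_quotient \<Lambda> f p =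
     (THE H. \<forall>a b. pullback_sigma \<Lambda> f (p, a) (p, b) = H * sigma (p, a) (p, b))"

definition smooth_one_form :: "complex set \<Rightarrow> (tangent \<Rightarrow> real) \<Rightarrow> bool" where
  "smooth_one_form \<Lambda> \<alpha> \<longleftrightarrow> (\<forall>p\<in>torus \<Lambda>. linear (\<lambda>a. \<alpha> (p, a))) \<and>
     (\<forall>a. smooth_on UNIV (\<lambda>z. \<alpha> (proj \<Lambda> z, a)))"

text \<open>The formula for \<open>d\<alpha>\<close> on the translation invariant vector fields \<open>a\<close>, \<open>b\<close>,
  which commute.\<close>

definition ext_deriv_one_form ::
    "complex set \<Rightarrow> (tangent \<Rightarrow> real) \<Rightarrow> complex set \<Rightarrow> complex \<Rightarrow> complex \<Rightarrow> real" where
  "ext_deriv_one_form \<Lambda> \<alpha> p a b =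
     fun_diff \<Lambda> (\<lambda>q. \<alpha> (q, b)) p a - fun_diff \<Lambda> (\<lambda>q. \<alpha> (q, a)) p b"


section \<open>Groups of diffeomorphisms\<close>

definition diffeos :: "complex set \<Rightarrow> (complex set \<Rightarrow> complex set) set" where
  "diffeos \<Lambda> = {f \<in> extensional (torus \<Lambda>). bij_betw f (torus \<Lambda>) (torus \<Lambda>) \<and>
     smooth_into_torus \<Lambda> UNIV (\<lambda>z. f (proj \<Lambda> z)) \<and>
     smooth_into_torus \<Lambda> UNIV (\<lambda>z. inv_into (torus \<Lambda>) f (proj \<Lambda> z))}"

text \<open>\<open>[f\<^sup>*\<sigma>] = [\<sigma>]\<close> in de Rham cohomology.\<close>

definition diffeos_plus :: "complex set \<Rightarrow> (complex set \<Rightarrow> complex set) set" where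
  "diffeos_plus \<Lambda> = {f \<in> diffeos \<Lambda>. \<exists>\<alpha>. smooth_one_form \<Lambda> \<alpha> \<and>
     (\<forall>p\<in>torus \<Lambda>. \<forall>a b. pullback_sigma \<Lambda> f (p, a) (p, b) - sigma (p, a) (p, b)
        = ext_deriv_one_form \<Lambda> \<alpha> p a b)}"

definition symp :: "complex set \<Rightarrow> (complex set \<Rightarrow> complex set) set" where
  "symp \<Lambda> = {f \<in> diffeos \<Lambda>. \<forall>p\<in>torus \<Lambda>. \<forall>a b.
     pullback_sigma \<Lambda> f (p, a) (p, b) = sigma (p, a) (p, b)}"

text \<open>The tangent space at \<open>f\<close>: smooth sections of \<open>f\<^sup>*T(T\<^sup>2)\<close>.\<close>

type_synonym torus_section = "complex set \<Rightarrow> tangent"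

definition sections :: "complex set \<Rightarrow> (complex set \<Rightarrow> complex set) \<Rightarrow> torus_section set" where
  "sections \<Lambda> f = {u \<in> extensional (torus \<Lambda>). (\<forall>p\<in>torus \<Lambda>. fst (u p) = f p) \<and>
     smooth_on UNIV (\<lambda>z. snd (u (proj \<Lambda> z)))}"

definition sec_zero :: "complex set \<Rightarrow> (complex set \<Rightarrow> complex set) \<Rightarrow> torus_section" where
  "sec_zero \<Lambda> f = (\<lambda>p\<in>torus \<Lambda>. (f p, 0))"

definition sec_add :: "complex set \<Rightarrow> torus_section \<Rightarrow> torus_section \<Rightarrow> torus_section" where
  "sec_add \<Lambda> u v = (\<lambda>p\<in>torus \<Lambda>. (fst (u p), snd (u p) + snd (v p)))"

definition sec_scale :: "complex set \<Rightarrow> real \<Rightarrow> torus_section \<Rightarrow> torus_section" where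
  "sec_scale \<Lambda> r u = (\<lambda>p\<in>torus \<Lambda>. (fst (u p), r *\<^sub>R snd (u p)))"

definition vector_fields :: "complex set \<Rightarrow> torus_section set" where
  "vector_fields \<Lambda> = sections \<Lambda> (\<lambda>p\<in>torus \<Lambda>. p)"

definition pushforward ::
    "complex set \<Rightarrow> (complex set \<Rightarrow> complex set) \<Rightarrow> torus_section \<Rightarrow> torus_section" where
  "pushforward \<Lambda> f X = (\<lambda>p\<in>torus \<Lambda>. tangent_map \<Lambda> f (X p))"

definition ham_field :: "complex set \<Rightarrow> (complex set \<Rightarrow> real) \<Rightarrow> torus_section" where
  "ham_field \<Lambda> h =
     (\<lambda>p\<in>torus \<Lambda>. (p, THE a. \<forall>b. sigma (p, a) (p, b) = - fun_diff \<Lambda> h p b))"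

definition velocity ::
    "complex set \<Rightarrow> (real \<Rightarrow> complex set \<Rightarrow> complex set) \<Rightarrow> real \<Rightarrow> torus_section" where
  "velocity \<Lambda> c t = (\<lambda>p\<in>torus \<Lambda>. (c t p, torus_derivative \<Lambda> (\<lambda>s. c s p) t 1))"

text \<open>Smooth curves in function spaces are jointly smooth maps.\<close>

definition smooth_curve_cinf ::
    "complex set \<Rightarrow> real set \<Rightarrow> (real \<Rightarrow> complex set \<Rightarrow> 'b::real_normed_vector) \<Rightarrow> bool" where
  "smooth_curve_cinf \<Lambda> S w \<longleftrightarrow> (\<forall>t\<in>S. w t \<in> cinf \<Lambda>) \<and>
     smooth_on (S \<times> UNIV) (\<lambda>(t, z). w t (proj \<Lambda> z))"

definition smooth_curve_diffeos ::
    "complex set \<Rightarrow> real set \<Rightarrow> (real \<Rightarrow> complex set \<Rightarrow> complex set) \<Rightarrow> bool" where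
  "smooth_curve_diffeos \<Lambda> S c \<longleftrightarrow> (\<forall>t\<in>S. c t \<in> diffeos \<Lambda>) \<and>
     smooth_into_torus \<Lambda> (S \<times> UNIV) (\<lambda>(t, z). c t (proj \<Lambda> z))"

text \<open>Time-one maps of Hamiltonian isotopies.  Isotopies are parametrised by all of \<open>\<real>\<close>;
  one given on the unit interval can be reparametrised by a smooth step function.\<close>

definition ham :: "complex set \<Rightarrow> (complex set \<Rightarrow> complex set) set" where
  "ham \<Lambda> = {\<phi>. \<exists>\<Phi> H. smooth_curve_diffeos \<Lambda> UNIV \<Phi> \<and>
     smooth_curve_cinf \<Lambda> UNIV H \<and> (\<forall>t. H t \<in> cinf0 \<Lambda>) \<and>
     \<Phi> 0 = (\<lambda>p\<in>torus \<Lambda>. p) \<and> \<Phi> 1 = \<phi> \<and>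
     (\<forall>t. velocity \<Lambda> \<Phi> t = compose (torus \<Lambda>) (ham_field \<Lambda> (H t)) (\<Phi> t))}"


section \<open>\<open>Diff\<^sup>+\<close> as an infinite-dimensional manifold\<close>

text \<open>Smoothness of maps and tensors is tested along smooth curves; on Frechet manifolds this
  agrees with the usual notion of smoothness.\<close>

definition smooth_curve ::
    "complex set \<Rightarrow> real set \<Rightarrow> (real \<Rightarrow> complex set \<Rightarrow> complex set) \<Rightarrow> bool" where
  "smooth_curve \<Lambda> S c \<longleftrightarrow> smooth_curve_diffeos \<Lambda> S c \<and> (\<forall>t\<in>S. c t \<in> diffeos_plus \<Lambda>)"

definition curve_through ::
    "complex set \<Rightarrow> (complex set \<Rightarrow> complex set) \<Rightarrow> torus_section \<Rightarrow> real set
      \<Rightarrow> (real \<Rightarrow> complex set \<Rightarrow> complex set) \<Rightarrow> bool" where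
  "curve_through \<Lambda> f u S c \<longleftrightarrow>
     open S \<and> 0 \<in> S \<and> smooth_curve \<Lambda> S c \<and> c 0 = f \<and> velocity \<Lambda> c 0 = u"

definition smooth_tangent_curve ::
    "complex set \<Rightarrow> real set \<Rightarrow> (real \<Rightarrow> complex set \<Rightarrow> complex set)
      \<Rightarrow> (real \<Rightarrow> torus_section) \<Rightarrow> bool" where
  "smooth_tangent_curve \<Lambda> S c U \<longleftrightarrow> smooth_curve \<Lambda> S c \<and> (\<forall>t\<in>S. U t \<in> sections \<Lambda> (c t)) \<and>
     smooth_on (S \<times> UNIV) (\<lambda>(t, z). snd (U t (proj \<Lambda> z)))"

text \<open>Open sets of the model space \<open>C\<^sup>\<infinity>(T\<^sup>2, \<complex>)\<close>, for the Frechet topology of uniform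
  convergence of all derivatives.\<close>

definition frechet_open :: "complex set \<Rightarrow> (complex set \<Rightarrow> complex) set \<Rightarrow> bool" where
  "frechet_open \<Lambda> V \<longleftrightarrow> V \<subseteq> cinf \<Lambda> \<and>
     (\<forall>w\<in>V. \<exists>k. \<exists>e>0. \<forall>w'\<in>cinf \<Lambda>.
        (\<forall>vs. length vs \<le> k \<and> set vs \<subseteq> Basis \<longrightarrow>
           (\<forall>z. norm (iter_deriv vs (\<lambda>y. w' (proj \<Lambda> y) - w (proj \<Lambda> y)) z) < e))
        \<longrightarrow> w' \<in> V)"

text \<open>\<open>\<psi>\<close> is a diffeomorphism of \<open>V\<close> onto a subset of \<open>Diff\<^sup>+\<close> that is open for the
  final topology of the smooth curves.\<close>

definition is_chart ::
    "complex set \<Rightarrow> (complex set \<Rightarrow> complex) set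
      \<Rightarrow> ((complex set \<Rightarrow> complex) \<Rightarrow> complex set \<Rightarrow> complex set) \<Rightarrow> bool" where
  "is_chart \<Lambda> V \<psi> \<longleftrightarrow> frechet_open \<Lambda> V \<and> inj_on \<psi> V \<and> \<psi> ` V \<subseteq> diffeos_plus \<Lambda> \<and>
     (\<forall>S w. open S \<and> (\<forall>t\<in>S. w t \<in> V) \<longrightarrow>
        (smooth_curve_cinf \<Lambda> S w \<longleftrightarrow> smooth_curve \<Lambda> S (\<lambda>t. \<psi> (w t)))) \<and>
     (\<forall>S c. open S \<and> smooth_curve \<Lambda> S c \<longrightarrow> open {t \<in> S. c t \<in> \<psi> ` V})"

text \<open>The map \<open>w \<mapsto> f + w\<close>, i.e. the exponential map of the flat metric along \<open>f\<close>.\<close>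

definition flat_chart ::
    "complex set \<Rightarrow> (complex set \<Rightarrow> complex set) \<Rightarrow> (complex set \<Rightarrow> complex)
      \<Rightarrow> complex set \<Rightarrow> complex set" where
  "flat_chart \<Lambda> f w = (\<lambda>p\<in>torus \<Lambda>. (+) (w p) ` f p)"

definition flat_atlas :: "complex set \<Rightarrow> bool" where
  "flat_atlas \<Lambda> \<longleftrightarrow> (\<forall>f\<in>diffeos_plus \<Lambda>. \<exists>V. is_chart \<Lambda> V (flat_chart \<Lambda> f) \<and>
     (\<lambda>p\<in>torus \<Lambda>. 0) \<in> V \<and> flat_chart \<Lambda> f (\<lambda>p\<in>torus \<Lambda>. 0) = f)"

definition chart_diff ::
    "complex set \<Rightarrow> ((complex set \<Rightarrow> complex) \<Rightarrow> complex set \<Rightarrow> complex set)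
      \<Rightarrow> (complex set \<Rightarrow> complex) \<Rightarrow> (complex set \<Rightarrow> complex) \<Rightarrow> torus_section" where
  "chart_diff \<Lambda> \<psi> w v = velocity \<Lambda> (\<lambda>t. \<psi> (\<lambda>p\<in>torus \<Lambda>. w p + t *\<^sub>R v p)) 0"


section \<open>Weak Kaehler structures on \<open>Diff\<^sup>+\<close>\<close>

text \<open>A tensor is given on all tangent spaces at once, since a section over \<open>f\<close>
  determines \<open>f\<close>.\<close>

definition smooth_bilinear_form ::
    "complex set \<Rightarrow> (torus_section \<Rightarrow> torus_section \<Rightarrow> real) \<Rightarrow> bool" where
  "smooth_bilinear_form \<Lambda> B \<longleftrightarrow>
     (\<forall>f\<in>diffeos_plus \<Lambda>. \<forall>u\<in>sections \<Lambda> f. \<forall>v\<in>sections \<Lambda> f. \<forall>w\<in>sections \<Lambda> f. \<forall>r.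
        B (sec_add \<Lambda> u v) w = B u w + B v w \<and> B w (sec_add \<Lambda> u v) = B w u + B w v \<and>
        B (sec_scale \<Lambda> r u) w = r * B u w \<and> B w (sec_scale \<Lambda> r u) = r * B w u) \<and>
     (\<forall>S c U V. open S \<and> smooth_tangent_curve \<Lambda> S c U \<and> smooth_tangent_curve \<Lambda> S c V \<longrightarrow>
        smooth_on S (\<lambda>t. B (U t) (V t)))"

definition weakly_nondegenerate ::
    "complex set \<Rightarrow> (torus_section \<Rightarrow> torus_section \<Rightarrow> real) \<Rightarrow> bool" where
  "weakly_nondegenerate \<Lambda> B \<longleftrightarrow> (\<forall>f\<in>diffeos_plus \<Lambda>. \<forall>u\<in>sections \<Lambda> f.
     (\<forall>v\<in>sections \<Lambda> f. B u v = 0) \<longrightarrow> u = sec_zero \<Lambda> f)"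

definition weak_riemannian_metric ::
    "complex set \<Rightarrow> (torus_section \<Rightarrow> torus_section \<Rightarrow> real) \<Rightarrow> bool" where
  "weak_riemannian_metric \<Lambda> G \<longleftrightarrow> smooth_bilinear_form \<Lambda> G \<and> weakly_nondegenerate \<Lambda> G \<and>
     (\<forall>f\<in>diffeos_plus \<Lambda>. \<forall>u\<in>sections \<Lambda> f.
        (\<forall>v\<in>sections \<Lambda> f. G u v = G v u) \<and> (u \<noteq> sec_zero \<Lambda> f \<longrightarrow> G u u > 0))"

definition almost_complex_structure ::
    "complex set \<Rightarrow> (torus_section \<Rightarrow> torus_section) \<Rightarrow> bool" where
  "almost_complex_structure \<Lambda> J \<longleftrightarrow>
     (\<forall>f\<in>diffeos_plus \<Lambda>. \<forall>u\<in>sections \<Lambda> f.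
        J u \<in> sections \<Lambda> f \<and> J (J u) = sec_scale \<Lambda> (-1) u \<and>
        (\<forall>v\<in>sections \<Lambda> f. J (sec_add \<Lambda> u v) = sec_add \<Lambda> (J u) (J v)) \<and>
        (\<forall>r. J (sec_scale \<Lambda> r u) = sec_scale \<Lambda> r (J u))) \<and>
     (\<forall>S c U. open S \<and> smooth_tangent_curve \<Lambda> S c U \<longrightarrow>
        smooth_tangent_curve \<Lambda> S c (\<lambda>t. J (U t)))"

text \<open>Integrability in the strong sense: there are charts, modelled on the complex Frechet
  space \<open>C\<^sup>\<infinity>(T\<^sup>2, \<complex>)\<close>, with complex linear differentials.\<close>

definition integrable_structure ::
    "complex set \<Rightarrow> (torus_section \<Rightarrow> torus_section) \<Rightarrow> bool" where
  "integrable_structure \<Lambda> J \<longleftrightarrow>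
     (\<forall>f\<in>diffeos_plus \<Lambda>. \<exists>V \<psi>. is_chart \<Lambda> V \<psi> \<and> f \<in> \<psi> ` V \<and>
        (\<forall>w\<in>V. \<forall>v\<in>cinf \<Lambda>.
           chart_diff \<Lambda> \<psi> w (\<lambda>p\<in>torus \<Lambda>. \<i> * v p) = J (chart_diff \<Lambda> \<psi> w v)))"

text \<open>The exterior derivative at \<open>f\<close>, computed in the flat chart centred at \<open>f\<close>.  In that
  chart a tangent vector \<open>v\<close> at \<open>f\<close> extends to a constant vector field, whose value at
  \<open>f'\<close> is \<open>transport f' v\<close>; constant fields commute.\<close>

definition transport ::
    "complex set \<Rightarrow> (complex set \<Rightarrow> complex set) \<Rightarrow> torus_section \<Rightarrow> torus_section" where
  "transport \<Lambda> f' v = (\<lambda>p\<in>torus \<Lambda>. (f' p, snd (v p)))"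

definition form_dir_deriv ::
    "complex set \<Rightarrow> (torus_section \<Rightarrow> torus_section \<Rightarrow> real) \<Rightarrow> (complex set \<Rightarrow> complex set)
      \<Rightarrow> torus_section \<Rightarrow> torus_section \<Rightarrow> torus_section \<Rightarrow> real" where
  "form_dir_deriv \<Lambda> B f u v w =
     deriv (\<lambda>t. let f' = flat_chart \<Lambda> f (\<lambda>p\<in>torus \<Lambda>. t *\<^sub>R snd (u p))
                in B (transport \<Lambda> f' v) (transport \<Lambda> f' w)) 0"

definition ext_deriv_two_form ::
    "complex set \<Rightarrow> (torus_section \<Rightarrow> torus_section \<Rightarrow> real) \<Rightarrow> (complex set \<Rightarrow> complex set)
      \<Rightarrow> torus_section \<Rightarrow> torus_section \<Rightarrow> torus_section \<Rightarrow> real" where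
  "ext_deriv_two_form \<Lambda> B f u v w =
     form_dir_deriv \<Lambda> B f u v w - form_dir_deriv \<Lambda> B f v u w + form_dir_deriv \<Lambda> B f w u v"

definition weak_symplectic_form ::
    "complex set \<Rightarrow> (torus_section \<Rightarrow> torus_section \<Rightarrow> real) \<Rightarrow> bool" where
  "weak_symplectic_form \<Lambda> B \<longleftrightarrow> smooth_bilinear_form \<Lambda> B \<and> weakly_nondegenerate \<Lambda> B \<and>
     (\<forall>f\<in>diffeos_plus \<Lambda>. \<forall>u\<in>sections \<Lambda> f. \<forall>v\<in>sections \<Lambda> f. B u v = - B v u) \<and>
     (\<forall>f\<in>diffeos_plus \<Lambda>. \<forall>u\<in>sections \<Lambda> f. \<forall>v\<in>sections \<Lambda> f. \<forall>w\<in>sections \<Lambda> f.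
        ext_deriv_two_form \<Lambda> B f u v w = 0)"

definition weak_kaehler_structure ::
    "complex set \<Rightarrow> (torus_section \<Rightarrow> torus_section \<Rightarrow> real)
      \<Rightarrow> (torus_section \<Rightarrow> torus_section) \<Rightarrow> bool" where
  "weak_kaehler_structure \<Lambda> G J \<longleftrightarrow>
     weak_riemannian_metric \<Lambda> G \<and> almost_complex_structure \<Lambda> J \<and> integrable_structure \<Lambda> J \<and>
     (\<forall>f\<in>diffeos_plus \<Lambda>. \<forall>u\<in>sections \<Lambda> f. \<forall>v\<in>sections \<Lambda> f. G (J u) (J v) = G u v) \<and>
     weak_symplectic_form \<Lambda> (\<lambda>u v. G (J u) v)"

definition metric_diff :: "complex set \<Rightarrow> torus_section \<Rightarrow> torus_section \<Rightarrow> real" where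
  "metric_diff \<Lambda> u v = torus_integral \<Lambda> (\<lambda>p. flat_metric (u p) (v p))"

definition cstruct_diff :: "complex set \<Rightarrow> torus_section \<Rightarrow> torus_section" where
  "cstruct_diff \<Lambda> u = (\<lambda>p\<in>torus \<Lambda>. cstruct (u p))"

definition omega_diff :: "complex set \<Rightarrow> torus_section \<Rightarrow> torus_section \<Rightarrow> real" where
  "omega_diff \<Lambda> u v = metric_diff \<Lambda> (cstruct_diff \<Lambda> u) v"


section \<open>The action of the Hamiltonian group\<close>

text \<open>The group acts smoothly by precomposition, the differential of \<open>f \<mapsto> f \<circ> \<phi>\<close>
  being \<open>u \<mapsto> u \<circ> \<phi>\<close>.\<close>

definition acts_by_precomposition :: "complex set \<Rightarrow> bool" where
  "acts_by_precomposition \<Lambda> \<longleftrightarrow> (\<forall>\<phi>\<in>ham \<Lambda>. \<forall>f\<in>diffeos_plus \<Lambda>.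
     compose (torus \<Lambda>) f \<phi> \<in> diffeos_plus \<Lambda> \<and>
     (\<forall>u\<in>sections \<Lambda> f. compose (torus \<Lambda>) u \<phi> \<in> sections \<Lambda> (compose (torus \<Lambda>) f \<phi>) \<and>
        (\<forall>S c. curve_through \<Lambda> f u S c \<longrightarrow>
           curve_through \<Lambda> (compose (torus \<Lambda>) f \<phi>) (compose (torus \<Lambda>) u \<phi>) S
             (\<lambda>t. compose (torus \<Lambda>) (c t) \<phi>))))"

definition ham_invariant :: "complex set \<Rightarrow> (torus_section \<Rightarrow> torus_section \<Rightarrow> real) \<Rightarrow> bool" where
  "ham_invariant \<Lambda> B \<longleftrightarrow>
     (\<forall>\<phi>\<in>ham \<Lambda>. \<forall>f\<in>diffeos_plus \<Lambda>. \<forall>u\<in>sections \<Lambda> f. \<forall>v\<in>sections \<Lambda> f.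
        B (compose (torus \<Lambda>) u \<phi>) (compose (torus \<Lambda>) v \<phi>) = B u v)"

text \<open>\<open>k = D\<^sub>f\<mu>(u)\<close>.\<close>

definition has_diff_derivative ::
    "complex set \<Rightarrow> ((complex set \<Rightarrow> complex set) \<Rightarrow> complex set \<Rightarrow> real)
      \<Rightarrow> (complex set \<Rightarrow> complex set) \<Rightarrow> torus_section \<Rightarrow> (complex set \<Rightarrow> real) \<Rightarrow> bool" where
  "has_diff_derivative \<Lambda> \<mu> f u k \<longleftrightarrow> (\<exists>S c. curve_through \<Lambda> f u S c) \<and>
     (\<forall>S c. curve_through \<Lambda> f u S c \<longrightarrow>
        (\<forall>p\<in>torus \<Lambda>. ((\<lambda>t. \<mu> (c t) p) has_real_derivative k p) (at 0)))"

definition is_moment_map ::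
    "complex set \<Rightarrow> (torus_section \<Rightarrow> torus_section \<Rightarrow> real)
      \<Rightarrow> ((complex set \<Rightarrow> complex set) \<Rightarrow> complex set \<Rightarrow> real) \<Rightarrow> bool" where
  "is_moment_map \<Lambda> B \<mu> \<longleftrightarrow>
     \<mu> ` diffeos_plus \<Lambda> \<subseteq> cinf0 \<Lambda> \<and>
     (\<forall>S c. open S \<and> smooth_curve \<Lambda> S c \<longrightarrow> smooth_curve_cinf \<Lambda> S (\<lambda>t. \<mu> (c t))) \<and>
     (\<forall>f\<in>diffeos_plus \<Lambda>. \<forall>Y\<in>vector_fields \<Lambda>. \<exists>k\<in>cinf0 \<Lambda>.
        has_diff_derivative \<Lambda> \<mu> f (pushforward \<Lambda> f Y) k \<and>
        (\<forall>h\<in>cinf0 \<Lambda>. B (pushforward \<Lambda> f (ham_field \<Lambda> h)) (pushforward \<Lambda> f Y)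
           = - torus_integral \<Lambda> (\<lambda>p. k p * h p))) \<and>
     (\<forall>f\<in>diffeos_plus \<Lambda>. \<forall>\<phi>\<in>ham \<Lambda>.
        \<mu> (compose (torus \<Lambda>) f \<phi>) = compose (torus \<Lambda>) (\<mu> f) \<phi>)"

definition mu_diff :: "complex set \<Rightarrow> (complex set \<Rightarrow> complex set) \<Rightarrow> complex set \<Rightarrow> real" where
  "mu_diff \<Lambda> f = (\<lambda>p\<in>torus \<Lambda>. - sigma_quotient \<Lambda> f p + 1)"

end

theory Submission
  imports Defs
begin

text \<open>The argument takes place on the universal cover \<open>\<complex>\<close>. A diffeomorphism \<open>f\<close> of the torus has a
lift \<open>F : \<complex> \<rightarrow> \<complex>\<close>, unique up to a lattice vector, and \<open>F (z + l) - F z\<close> is a lattice vector that depends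
on \<open>l\<close> only. The derivatives of \<open>F\<close> are therefore periodic, the quotient \<open>f\<^sup>*\<sigma> / \<sigma>\<close> is the Jacobian
determinant \<open>jac F\<close>, and the tangent vectors at \<open>f\<close> are the smooth periodic maps \<open>\<complex> \<rightarrow> \<complex>\<close>.

In the chart \<open>w \<mapsto> f + w\<close> the metric and \<open>\<Omega>\<close> are integrals of pointwise bilinear forms with constant
coefficients, and the complex structure is multiplication by \<open>\<i>\<close>. Integrability and \<open>d\<Omega> = 0\<close> are thus
visible, and weak nondegeneracy is the vanishing of a continuous nonnegative function with integral
zero. What has to be proved is that \<open>w \<mapsto> f + w\<close> is a chart: if \<open>G\<close> is the inverse of \<open>F\<close> and \<open>w\<close> is small
with its first derivatives, then \<open>F + w = (id + w \<circ> G) \<circ> F\<close> with a contraction \<open>w \<circ> G\<close>, so \<open>F + w\<close> is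
bijective, and its inverse is smooth by bootstrapping (\<open>lift_pair_perturb\<close>); the uniform estimates along
curves come from the compactness of a fundamental cell.

The condition on de Rham classes says that \<open>jac F - 1\<close> is an exact density, the divergence of a periodic
field. Exactness is stable under sums, under pullback and under \<open>F \<mapsto> F + w\<close>, always by an explicit
primitive. An exact density has integral zero over a cell, because the integral of a periodic function is
invariant under translations and may be differentiated along them.

Along a curve of lifts with velocity \<open>W\<close> the Jacobian changes by a divergence \<open>jac_variation F W\<close>.
Two facts about it carry the second half. For a Hamiltonian velocity \<open>W = X\<^sub>h \<circ> F\<close> it vanishes, as
\<open>X\<^sub>h\<close> is divergence free; so Hamiltonian diffeomorphisms preserve \<open>\<sigma>\<close>. They preserve integrals as well: the
derivative of the integral of \<open>g\<close> composed with the flow is the integral of the pullback of the exact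
density \<open>dg(X\<^sub>h)\<close> (\<open>ham_lift\<close>). This gives the invariance of \<open>\<Omega>\<close> and the equivariance of \<open>\<mu>\<close>. And
\<open>h \<cdot> jac_variation F W\<close> differs from \<open>\<sigma> (dF X\<^sub>h, W)\<close> by an exact density, which after integration is
the moment map identity.\<close>

section \<open>Smooth functions\<close>

text \<open>Directional derivatives as operators on functions, so that they can be iterated and interchanged.\<close>

definition dd :: "'a::real_normed_vector \<Rightarrow> ('a \<Rightarrow> 'b::real_normed_vector) \<Rightarrow> 'a \<Rightarrow> 'b" where
  "dd v F = (\<lambda>x. frechet_derivative F (at x) v)"

text \<open>Closure properties of smooth functions are proved for \<open>k\<close>-fold differentiability, by induction on \<open>k\<close>;
the finite levels are also what the bootstrapping for inverse maps climbs.\<close>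

fun smooth_upto :: "nat \<Rightarrow> 'a::real_normed_vector set \<Rightarrow> ('a \<Rightarrow> 'b::real_normed_vector) \<Rightarrow> bool" where
  "smooth_upto 0 S F = True"
| "smooth_upto (Suc k) S F = ((\<forall>x\<in>S. F differentiable at x) \<and> (\<forall>v. smooth_upto k S (dd v F)))"

lemma smooth_on_iff_step:
  "smooth_on S F \<longleftrightarrow> (\<forall>x\<in>S. F differentiable at x) \<and> (\<forall>v. smooth_on S (dd v F))"
proof
  assume "smooth_on S F"
  then show "(\<forall>x\<in>S. F differentiable at x) \<and> (\<forall>v. smooth_on S (dd v F))"
    unfolding smooth_on_def dd_def
    by (metis iter_deriv.simps(1) iter_deriv.simps(2))
next
  assume a: "(\<forall>x\<in>S. F differentiable at x) \<and> (\<forall>v. smooth_on S (dd v F))"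
  have "iter_deriv vs F differentiable at x" if "x \<in> S" for vs x
    using a that unfolding smooth_on_def dd_def by (cases vs) auto
  then show "smooth_on S F"
    unfolding smooth_on_def by blast
qed

lemma smooth_on_differentiable: "smooth_on S F \<Longrightarrow> x \<in> S \<Longrightarrow> F differentiable at x"
  using smooth_on_iff_step by blast

abbreviation "smooth \<equiv> smooth_on UNIV"

lemma smooth_differentiable: "smooth F \<Longrightarrow> F differentiable at x"
  by (rule smooth_on_differentiable[OF _ UNIV_I])

lemma smooth_on_dd: "smooth_on S F \<Longrightarrow> smooth_on S (dd v F)"
  using smooth_on_iff_step by blast

lemma smooth_on_smooth_upto: "smooth_on S F \<Longrightarrow> smooth_upto k S F"
  by (induction k arbitrary: F) (auto dest: smooth_on_differentiable smooth_on_dd)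

lemma smooth_on_eq_smooth_upto: "smooth_on S F \<longleftrightarrow> (\<forall>k. smooth_upto k S F)"
proof -
  have "iter_deriv vs F differentiable at x"
    if "smooth_upto (Suc (length vs)) S F" "x \<in> S" for vs x
    using that
  proof (induction vs arbitrary: F)
    case (Cons v vs)
    have "smooth_upto (Suc (length vs)) S (dd v F)"
      using Cons.prems(1) by (metis length_Cons smooth_upto.simps(2))
    from Cons.IH[OF this Cons.prems(2)] show ?case
      by (simp add: dd_def)
  qed simp
  then show ?thesis
    using smooth_on_smooth_upto smooth_on_def by metis
qed

lemma smooth_upto_Suc: "smooth_upto (Suc k) S F \<Longrightarrow> smooth_upto k S F"
  by (induction k arbitrary: F) auto

lemma dd_has_derivative: "F differentiable at x \<Longrightarrow> (F has_derivative (\<lambda>v. dd v F x)) (at x)"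
  unfolding dd_def using frechet_derivative_works by blast

lemma dd_eq: "(F has_derivative F') (at x) \<Longrightarrow> dd v F x = F' v"
  unfolding dd_def by (metis frechet_derivative_at)

lemma dd_cong:
  assumes "open S" "x \<in> S" "\<And>y. y \<in> S \<Longrightarrow> F y = G y"
  shows "dd v F x = dd v G x"
proof -
  have "(F has_derivative D) (at x) \<longleftrightarrow> (G has_derivative D) (at x)" for D
    by (rule iffI; erule has_derivative_transform_within_open[OF _ assms(1,2)])
      (simp_all add: assms(3))
  then show ?thesis
    unfolding dd_def frechet_derivative_def by simp
qed

lemma smooth_upto_cong:
  assumes "open S" "\<And>y. y \<in> S \<Longrightarrow> F y = G y"
  shows "smooth_upto k S F \<longleftrightarrow> smooth_upto k S G"
  using assms(2)
proof (induction k arbitrary: F G)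
  case (Suc k)
  have "F differentiable at x \<longleftrightarrow> G differentiable at x" if "x \<in> S" for x
    unfolding differentiable_def
    by (rule iff_exI; rule iffI; erule has_derivative_transform_within_open[OF _ assms(1) that])
      (simp_all add: Suc.prems)
  moreover have "smooth_upto k S (dd v F) \<longleftrightarrow> smooth_upto k S (dd v G)" for v
    by (rule Suc.IH) (use Suc.prems assms(1) in \<open>blast intro: dd_cong\<close>)
  ultimately show ?case by auto
qed simp

lemma smooth_on_cong:
  assumes "open S" "\<And>y. y \<in> S \<Longrightarrow> F y = G y"
  shows "smooth_on S F \<longleftrightarrow> smooth_on S G"
  using smooth_upto_cong[OF assms] by (simp add: smooth_on_eq_smooth_upto)

lemma smooth_on_subset: "smooth_on S F \<Longrightarrow> T \<subseteq> S \<Longrightarrow> smooth_on T F"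
  unfolding smooth_on_def by blast

lemma smooth_on_local:
  assumes "\<And>x. x \<in> S \<Longrightarrow> \<exists>U G. open U \<and> x \<in> U \<and> smooth_on U G \<and> (\<forall>y\<in>U. F y = G y)"
  shows "smooth_on S F"
proof -
  have "\<exists>U. x \<in> U \<and> smooth_on U F" if "x \<in> S" for x
    using assms[OF that] smooth_on_cong by metis
  then show ?thesis
    unfolding smooth_on_def by meson
qed

lemma smooth_on_continuous_on: "smooth_on S F \<Longrightarrow> continuous_on S F"
  by (meson continuous_at_imp_continuous_on differentiable_imp_continuous_within smooth_on_differentiable)

lemma smooth_upto_const: "smooth_upto k S (\<lambda>x. c)"
proof (induction k arbitrary: c)
  case (Suc k)
  have "dd v (\<lambda>x. c) = (\<lambda>x. 0)" for v :: 'a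
    by (simp add: dd_def)
  then show ?case using Suc by simp
qed simp

lemma smooth_on_const [simp]: "smooth_on S (\<lambda>x. c)"
  by (simp add: smooth_on_eq_smooth_upto smooth_upto_const)

lemma dd_bounded_linear: "bounded_linear L \<Longrightarrow> dd v L x = L v"
  by (simp add: dd_eq bounded_linear_imp_has_derivative)

lemma smooth_on_bounded_linear: "bounded_linear L \<Longrightarrow> smooth_on S L"
proof (subst smooth_on_iff_step, intro conjI ballI allI)
  assume L: "bounded_linear L"
  then show "L differentiable at x" for x
    by (simp add: bounded_linear_imp_differentiable)
  have "dd v L = (\<lambda>x. L v)" for v
    using dd_bounded_linear[OF L] by blast
  then show "smooth_on S (dd v L)" for v
    by simp
qed

lemma smooth_on_ident [simp]: "smooth_on S (\<lambda>x. x)"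
  by (rule smooth_on_bounded_linear) (rule bounded_linear_ident)

lemma dd_const [simp]: "dd v (\<lambda>x. c) x = 0"
  by (simp add: dd_def)

lemma dd_add:
  "F differentiable at x \<Longrightarrow> G differentiable at x \<Longrightarrow> dd v (\<lambda>y. F y + G y) x = dd v F x + dd v G x"
  by (rule dd_eq[OF has_derivative_add[OF dd_has_derivative dd_has_derivative]])

lemma dd_diff:
  "F differentiable at x \<Longrightarrow> G differentiable at x \<Longrightarrow> dd v (\<lambda>y. F y - G y) x = dd v F x - dd v G x"
  by (rule dd_eq[OF has_derivative_diff[OF dd_has_derivative dd_has_derivative]])

lemma dd_bilinear:
  assumes "bounded_bilinear B" "F differentiable at x" "G differentiable at x"
  shows "dd v (\<lambda>y. B (F y) (G y)) x = B (F x) (dd v G x) + B (dd v F x) (G x)"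
  by (rule dd_eq[OF bounded_bilinear.FDERIV[OF assms(1) dd_has_derivative dd_has_derivative]])
    (use assms in auto)

lemma dd_linear_compose:
  assumes "bounded_linear L" "F differentiable at x"
  shows "dd v (\<lambda>y. L (F y)) x = L (dd v F x)"
  by (rule dd_eq[OF bounded_linear.has_derivative[OF assms(1) dd_has_derivative[OF assms(2)]]])

lemma differentiable_bilinear:
  "bounded_bilinear B \<Longrightarrow> F differentiable at x \<Longrightarrow> G differentiable at x \<Longrightarrow>
    (\<lambda>y. B (F y) (G y)) differentiable at x"
  by (rule differentiableI[OF bounded_bilinear.FDERIV[OF _ dd_has_derivative dd_has_derivative]])

lemma smooth_upto_add:
  assumes "open S" "smooth_upto k S F" "smooth_upto k S G"
  shows "smooth_upto k S (\<lambda>x. F x + G x)"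
  using assms(2,3)
proof (induction k arbitrary: F G)
  case (Suc k)
  have "smooth_upto k S (dd v (\<lambda>x. F x + G x))" for v
    using Suc.IH[of "dd v F" "dd v G"] Suc.prems
    by (subst smooth_upto_cong[OF assms(1), of _ "\<lambda>x. dd v F x + dd v G x"]) (auto simp: dd_add)
  then show ?case using Suc.prems by auto
qed simp

lemma smooth_upto_bilinear:
  assumes "open S" "bounded_bilinear B" "smooth_upto k S F" "smooth_upto k S G"
  shows "smooth_upto k S (\<lambda>x. B (F x) (G x))"
  using assms(3,4)
proof (induction k arbitrary: F G)
  case (Suc k)
  have "smooth_upto k S (dd v (\<lambda>x. B (F x) (G x)))" for v
  proof (subst smooth_upto_cong[OF assms(1)])
    show "dd v (\<lambda>x. B (F x) (G x)) x = B (F x) (dd v G x) + B (dd v F x) (G x)" if "x \<in> S" for x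
      using Suc.prems that by (intro dd_bilinear assms) auto
    have "smooth_upto k S (dd v F)" "smooth_upto k S (dd v G)"
      using Suc.prems by auto
    with smooth_upto_Suc[OF Suc.prems(1)] smooth_upto_Suc[OF Suc.prems(2)]
    show "smooth_upto k S (\<lambda>x. B (F x) (dd v G x) + B (dd v F x) (G x))"
      by (intro smooth_upto_add assms Suc.IH)
  qed
  then show ?case using Suc.prems by (auto intro: differentiable_bilinear[OF assms(2)])
qed simp

lemma smooth_on_add:
  "open S \<Longrightarrow> smooth_on S F \<Longrightarrow> smooth_on S G \<Longrightarrow> smooth_on S (\<lambda>x. F x + G x)"
  by (simp add: smooth_on_eq_smooth_upto smooth_upto_add)

lemma smooth_on_bilinear:
  "open S \<Longrightarrow> bounded_bilinear B \<Longrightarrow> smooth_on S F \<Longrightarrow> smooth_on S G \<Longrightarrow> smooth_on S (\<lambda>x. B (F x) (G x))"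
  by (simp add: smooth_on_eq_smooth_upto smooth_upto_bilinear)

lemma smooth_upto_linear_compose:
  assumes "open S" "bounded_linear L" "smooth_upto k S F"
  shows "smooth_upto k S (\<lambda>x. L (F x))"
  using assms(3)
proof (induction k arbitrary: F)
  case (Suc k)
  have "smooth_upto k S (dd v (\<lambda>x. L (F x)))" for v
    using Suc.IH[of "dd v F"] Suc.prems
    by (subst smooth_upto_cong[OF assms(1), of _ "\<lambda>x. L (dd v F x)"])
      (auto simp: dd_linear_compose[OF assms(2)])
  moreover have "(\<lambda>x. L (F x)) differentiable at x" if "x \<in> S" for x
    using Suc.prems that bounded_linear.has_derivative[OF assms(2)]
    by (metis differentiable_def smooth_upto.simps(2))
  ultimately show ?case by auto
qed simp

lemma smooth_on_linear_compose:
  "open S \<Longrightarrow> bounded_linear L \<Longrightarrow> smooth_on S F \<Longrightarrow> smooth_on S (\<lambda>x. L (F x))"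
  by (simp add: smooth_on_eq_smooth_upto smooth_upto_linear_compose)

lemma smooth_on_minus: "open S \<Longrightarrow> smooth_on S F \<Longrightarrow> smooth_on S (\<lambda>x. - F x)"
  using smooth_on_linear_compose[OF _ bounded_linear_minus[OF bounded_linear_ident]] by blast

lemma smooth_on_diff:
  "open S \<Longrightarrow> smooth_on S F \<Longrightarrow> smooth_on S G \<Longrightarrow> smooth_on S (\<lambda>x. F x - G x)"
  using smooth_on_add[of S F "\<lambda>x. - G x"] smooth_on_minus[of S G] by simp

lemma smooth_on_mult:
  fixes F G :: "'a::real_normed_vector \<Rightarrow> 'b::real_normed_algebra"
  shows "open S \<Longrightarrow> smooth_on S F \<Longrightarrow> smooth_on S G \<Longrightarrow> smooth_on S (\<lambda>x. F x * G x)"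
  by (rule smooth_on_bilinear[OF _ bounded_bilinear_mult])

lemma smooth_on_scaleR:
  "open S \<Longrightarrow> smooth_on S F \<Longrightarrow> smooth_on S G \<Longrightarrow> smooth_on S (\<lambda>x. F x *\<^sub>R G x)"
  by (rule smooth_on_bilinear[OF _ bounded_bilinear_scaleR])

lemma smooth_on_inner:
  "open S \<Longrightarrow> smooth_on S F \<Longrightarrow> smooth_on S G \<Longrightarrow> smooth_on S (\<lambda>x. F x \<bullet> G x)"
  by (rule smooth_on_bilinear[OF _ bounded_bilinear_inner])

lemma smooth_on_Re: "open S \<Longrightarrow> smooth_on S F \<Longrightarrow> smooth_on S (\<lambda>x. Re (F x))"
  by (rule smooth_on_linear_compose[OF _ bounded_linear_Re])

lemma smooth_on_Im: "open S \<Longrightarrow> smooth_on S F \<Longrightarrow> smooth_on S (\<lambda>x. Im (F x))"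
  by (rule smooth_on_linear_compose[OF _ bounded_linear_Im])

lemma smooth_on_of_real:
  "open S \<Longrightarrow> smooth_on S F \<Longrightarrow> smooth_on S (\<lambda>x. complex_of_real (F x))"
  by (rule smooth_on_linear_compose[OF _ bounded_linear_of_real])

lemma smooth_on_fst: "open S \<Longrightarrow> smooth_on S F \<Longrightarrow> smooth_on S (\<lambda>x. fst (F x))"
  by (rule smooth_on_linear_compose[OF _ bounded_linear_fst])

lemma smooth_on_snd: "open S \<Longrightarrow> smooth_on S F \<Longrightarrow> smooth_on S (\<lambda>x. snd (F x))"
  by (rule smooth_on_linear_compose[OF _ bounded_linear_snd])

lemma dd_compose:
  assumes "F differentiable at x" "G differentiable at (F x)"
  shows "dd v (\<lambda>y. G (F y)) x = dd (dd v F x) G (F x)"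
  by (rule dd_eq[OF has_derivative_compose[OF dd_has_derivative[OF assms(1)] dd_has_derivative[OF assms(2)]]])

lemma linear_dd: "F differentiable at x \<Longrightarrow> linear (\<lambda>v. dd v F x)"
  unfolding dd_def by (rule linear_frechet_derivative)

lemma dd_expand_Basis:
  fixes G :: "'a::euclidean_space \<Rightarrow> 'b::real_normed_vector"
  assumes "G differentiable at x"
  shows "dd v G x = (\<Sum>b\<in>Basis. (v \<bullet> b) *\<^sub>R dd b G x)"
proof -
  interpret linear "\<lambda>v. dd v G x" by (rule linear_dd[OF assms])
  have "dd v G x = dd (\<Sum>b\<in>Basis. (v \<bullet> b) *\<^sub>R b) G x"
    by (simp add: euclidean_representation)
  then show ?thesis by (simp add: sum scale)
qed

lemma smooth_upto_sum:
  assumes "open S" "\<And>i. i \<in> I \<Longrightarrow> smooth_upto k S (F i)"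
  shows "smooth_upto k S (\<lambda>x. \<Sum>i\<in>I. F i x)"
  using assms(2) by (induction I rule: infinite_finite_induct)
    (auto intro: smooth_upto_const smooth_upto_add assms(1))

text \<open>The chain rule is expanded in a basis, since \<open>dd (dd v F x) G (F x)\<close> differentiates \<open>G\<close> in a direction
that varies with \<open>x\<close>; only the coefficients may depend on \<open>x\<close> for the induction hypothesis to apply.\<close>

lemma smooth_upto_compose:
  fixes F :: "'a::real_normed_vector \<Rightarrow> 'b::euclidean_space"
  assumes "open S" "F ` S \<subseteq> T" "smooth_upto k S F" "smooth_upto k T G"
  shows "smooth_upto k S (\<lambda>x. G (F x))"
  using assms(3,4)
proof (induction k arbitrary: G)
  case (Suc k)
  have "smooth_upto k S (dd v (\<lambda>x. G (F x)))" for v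
  proof (subst smooth_upto_cong[OF assms(1)])
    show "dd v (\<lambda>x. G (F x)) x = (\<Sum>b\<in>Basis. (dd v F x \<bullet> b) *\<^sub>R dd b G (F x))" if "x \<in> S" for x
    proof -
      have "F differentiable at x" "G differentiable at (F x)"
        using Suc.prems that assms(2) by auto
      then show ?thesis by (simp add: dd_compose dd_expand_Basis)
    qed
    have "smooth_upto k S (dd v F)" "smooth_upto k T (dd b G)" for b
      using Suc.prems by auto
    with smooth_upto_Suc[OF Suc.prems(1)]
    show "smooth_upto k S (\<lambda>x. \<Sum>b\<in>Basis. (dd v F x \<bullet> b) *\<^sub>R dd b G (F x))"
      by (intro smooth_upto_sum smooth_upto_bilinear[OF _ bounded_bilinear_scaleR]
          smooth_upto_bilinear[OF _ bounded_bilinear_inner] smooth_upto_const Suc.IH assms(1))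
  qed
  moreover have "(\<lambda>x. G (F x)) differentiable at x" if "x \<in> S" for x
    using Suc.prems that assms(2)
    by (metis differentiable_compose imageI smooth_upto.simps(2) subset_iff)
  ultimately show ?case by auto
qed simp

lemma smooth_on_compose:
  fixes F :: "'a::real_normed_vector \<Rightarrow> 'b::euclidean_space"
  shows "open S \<Longrightarrow> F ` S \<subseteq> T \<Longrightarrow> smooth_on S F \<Longrightarrow> smooth_on T G \<Longrightarrow> smooth_on S (\<lambda>x. G (F x))"
  by (simp add: smooth_on_eq_smooth_upto smooth_upto_compose)

lemma smooth_upto_inverse:
  fixes F :: "'a::real_normed_vector \<Rightarrow> real"
  assumes "open S" "\<And>x. x \<in> S \<Longrightarrow> F x \<noteq> 0" "smooth_upto k S F"
  shows "smooth_upto k S (\<lambda>x. inverse (F x))"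
  using assms(3)
proof (induction k)
  case (Suc k)
  have der: "((\<lambda>x. inverse (F x)) has_derivative (\<lambda>v. - (inverse (F x) * dd v F x * inverse (F x)))) (at x)"
    if "x \<in> S" for x
    using Suc.prems that assms(2) by (intro Deriv.has_derivative_inverse dd_has_derivative) auto
  have "smooth_upto k S (dd v (\<lambda>x. inverse (F x)))" for v
  proof (subst smooth_upto_cong[OF assms(1)])
    show "dd v (\<lambda>x. inverse (F x)) x = (- 1) * (inverse (F x) * dd v F x * inverse (F x))" if "x \<in> S" for x
      using dd_eq[OF der[OF that]] by simp
    have "smooth_upto k S (dd v F)" using Suc.prems by auto
    then show "smooth_upto k S (\<lambda>x. (- 1) * (inverse (F x) * dd v F x * inverse (F x)))"
      using Suc.IH[OF smooth_upto_Suc[OF Suc.prems]]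
      by (intro smooth_upto_bilinear[OF _ bounded_bilinear_mult] smooth_upto_const assms(1))
  qed
  moreover have "(\<lambda>x. inverse (F x)) differentiable at x" if "x \<in> S" for x
    by (rule differentiableI[OF der[OF that]])
  ultimately show ?case by simp
qed simp

lemma smooth_on_inverse:
  fixes F :: "'a::real_normed_vector \<Rightarrow> real"
  shows "open S \<Longrightarrow> (\<And>x. x \<in> S \<Longrightarrow> F x \<noteq> 0) \<Longrightarrow> smooth_on S F \<Longrightarrow> smooth_on S (\<lambda>x. inverse (F x))"
  by (simp add: smooth_on_eq_smooth_upto smooth_upto_inverse)

lemma smooth_on_Pair:
  "open S \<Longrightarrow> smooth_on S F \<Longrightarrow> smooth_on S G \<Longrightarrow> smooth_on S (\<lambda>x. (F x, G x))"
  using smooth_on_add[OF _ smooth_on_linear_compose[OF _ bounded_linear_Pair[OF bounded_linear_ident bounded_linear_zero]]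
      smooth_on_linear_compose[OF _ bounded_linear_Pair[OF bounded_linear_zero bounded_linear_ident]], of S F G]
  by simp

section \<open>Symmetry of second derivatives\<close>

lemma has_derivative_along_line:
  fixes f :: "'a::real_normed_vector \<Rightarrow> real"
  assumes "f differentiable at (y + s *\<^sub>R u)"
  shows "((\<lambda>r. f (y + r *\<^sub>R u)) has_real_derivative dd u f (y + s *\<^sub>R u)) (at s)"
proof -
  have "((\<lambda>r. f (y + r *\<^sub>R u)) has_derivative (\<lambda>h. dd (h *\<^sub>R u) f (y + s *\<^sub>R u))) (at s)"
    by (rule has_derivative_compose[where f = "\<lambda>r. y + r *\<^sub>R u" and g = f, OF _ dd_has_derivative[OF assms]])
      (auto intro!: derivative_eq_intros)
  moreover have "dd (h *\<^sub>R u) f (y + s *\<^sub>R u) = dd u f (y + s *\<^sub>R u) * h" for h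
    using linear_scale[OF linear_dd[OF assms]] by simp
  ultimately show ?thesis
    by (simp add: has_field_derivative_def)
qed

text \<open>The mean value theorem in direction \<open>u\<close> turns the second difference into a difference of values of
\<open>dd u f\<close>, and this is estimated by the differentiability of \<open>dd u f\<close> at \<open>x\<close>.  The quotient is symmetric
in \<open>u\<close> and \<open>v\<close>.\<close>

lemma second_difference_limit:
  fixes f :: "'a::real_normed_vector \<Rightarrow> real"
  assumes "open S" "x \<in> S" and diff: "\<And>y. y \<in> S \<Longrightarrow> f differentiable at y"
    and diff2: "dd u f differentiable at x"
  shows "((\<lambda>t. (f (x + t *\<^sub>R u + t *\<^sub>R v) - f (x + t *\<^sub>R u) - f (x + t *\<^sub>R v) + f x) / t\<^sup>2)
    \<longlongrightarrow> dd v (dd u f) x) (at_right 0)"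
proof (rule tendstoI)
  fix e :: real assume e: "e > 0"
  define M where "M = 2 * (norm u + norm v) + 1"
  have M: "M > 0" by (simp add: M_def add_nonneg_pos)
  define e' where "e' = e / (2 * M)"
  have e': "e' > 0" using e M by (simp add: e'_def)
  interpret L: linear "\<lambda>w. dd w (dd u f) x" by (rule linear_dd[OF diff2])
  obtain d1 where d1: "d1 > 0"
    "\<And>y. norm (y - x) < d1 \<Longrightarrow> norm (dd u f y - dd u f x - dd (y - x) (dd u f) x) \<le> e' * norm (y - x)"
    using dd_has_derivative[OF diff2] e' unfolding has_derivative_at_alt by metis
  obtain d2 where d2: "d2 > 0" "ball x d2 \<subseteq> S"
    using assms(1,2) openE by blast
  define d where "d = min d1 d2 / M"
  have d: "d > 0" using d1 d2 M by (simp add: d_def)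
  have bnd: "norm (s *\<^sub>R u + r *\<^sub>R v) \<le> t * (norm u + norm v)"
    if "0 \<le> s" "s \<le> t" "0 \<le> r" "r \<le> t" for s r t :: real
  proof -
    have "norm (s *\<^sub>R u + r *\<^sub>R v) \<le> s * norm u + r * norm v"
      using norm_triangle_ineq[of "s *\<^sub>R u" "r *\<^sub>R v"] that by simp
    also have "\<dots> \<le> t * norm u + t * norm v"
      using that by (intro add_mono mult_right_mono) auto
    finally show ?thesis by (simp add: algebra_simps)
  qed
  have small: "t * (norm u + norm v) < min d1 d2" if "0 < t" "t < d" for t
  proof -
    have "t * (norm u + norm v) \<le> t * M" using that by (simp add: M_def)
    also have "\<dots> < min d1 d2" using that M by (simp add: d_def field_simps)
    finally show ?thesis .
  qed
  have "dist ((f (x + t *\<^sub>R u + t *\<^sub>R v) - f (x + t *\<^sub>R u) - f (x + t *\<^sub>R v) + f x) / t\<^sup>2) (dd v (dd u f) x) < e"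
    if t: "0 < t" "t < d" for t
  proof -
    have inS: "x + r *\<^sub>R v + s *\<^sub>R u \<in> S" if "0 \<le> s" "s \<le> t" "0 \<le> r" "r \<le> t" for s r
    proof -
      have e: "x + r *\<^sub>R v + s *\<^sub>R u = x + (s *\<^sub>R u + r *\<^sub>R v)" by simp
      have "norm (s *\<^sub>R u + r *\<^sub>R v) < d2" using bnd[OF that] small[OF t] by linarith
      then have "x + (s *\<^sub>R u + r *\<^sub>R v) \<in> ball x d2"
        by (metis add_diff_cancel_left' dist_commute dist_norm mem_ball)
      then show ?thesis unfolding e using d2(2) by blast
    qed
    define \<phi> where "\<phi> s = f (x + t *\<^sub>R v + s *\<^sub>R u) - f (x + s *\<^sub>R u)" for s
    define \<phi>' where "\<phi>' s = dd u f (x + t *\<^sub>R v + s *\<^sub>R u) - dd u f (x + s *\<^sub>R u)" for s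
    have "(\<phi> has_real_derivative \<phi>' s) (at s)"
      if "0 \<le> s" "s \<le> t" for s
      unfolding \<phi>_def \<phi>'_def
      using inS[of s t] inS[of s 0] that t
      by (intro derivative_intros has_derivative_along_line diff) simp_all
    then obtain s where s: "0 < s" "s < t"
      "\<phi> t - \<phi> 0 = (t - 0) * \<phi>' s"
      using MVT2[OF t(1), of \<phi> \<phi>'] by blast
    define A where "A = dd u f (x + t *\<^sub>R v + s *\<^sub>R u) - dd u f x - dd (s *\<^sub>R u + t *\<^sub>R v) (dd u f) x"
    define B where "B = dd u f (x + s *\<^sub>R u) - dd u f x - dd (s *\<^sub>R u) (dd u f) x"
    have A: "\<bar>A\<bar> \<le> e' * (t * (norm u + norm v))"
    proof -
      have n: "norm (s *\<^sub>R u + t *\<^sub>R v) \<le> t * (norm u + norm v)" using bnd[of s t t] s by simp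
      have "norm A \<le> e' * norm (s *\<^sub>R u + t *\<^sub>R v)"
      proof -
        have e: "x + t *\<^sub>R v + s *\<^sub>R u - x = s *\<^sub>R u + t *\<^sub>R v" by simp
        have "norm (s *\<^sub>R u + t *\<^sub>R v) < d1" using n small[OF t] by linarith
        then show ?thesis
          using d1(2)[of "x + t *\<^sub>R v + s *\<^sub>R u"] unfolding A_def e by blast
      qed
      also have "\<dots> \<le> e' * (t * (norm u + norm v))" using n e' by simp
      finally show ?thesis by simp
    qed
    have B: "\<bar>B\<bar> \<le> e' * (t * (norm u + norm v))"
    proof -
      have n: "norm (s *\<^sub>R u) \<le> t * (norm u + norm v)" using bnd[of s t 0] s t by simp
      have "norm B \<le> e' * norm (s *\<^sub>R u)"
      proof -
        have e: "x + s *\<^sub>R u - x = s *\<^sub>R u" by simp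
        have "norm (s *\<^sub>R u) < d1" using n small[OF t] by linarith
        then show ?thesis
          using d1(2)[of "x + s *\<^sub>R u"] unfolding B_def e by blast
      qed
      also have "\<dots> \<le> e' * (t * (norm u + norm v))" using n e' by simp
      finally show ?thesis by simp
    qed
    have eq: "f (x + t *\<^sub>R u + t *\<^sub>R v) - f (x + t *\<^sub>R u) - f (x + t *\<^sub>R v) + f x = \<phi> t - \<phi> 0"
    proof -
      have e: "x + t *\<^sub>R u + t *\<^sub>R v = x + t *\<^sub>R v + t *\<^sub>R u" by simp
      show ?thesis unfolding \<phi>_def e by simp
    qed
    have "\<phi> t - \<phi> 0 = t * (A - B + t * dd v (dd u f) x)"
      unfolding s(3) \<phi>'_def A_def B_def by (simp add: L.add L.scale)
    then have "(\<phi> t - \<phi> 0) / t\<^sup>2 - dd v (dd u f) x = (A - B) / t"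
      using t by (simp only:) (simp add: power2_eq_square field_simps)
    then have "\<bar>(\<phi> t - \<phi> 0) / t\<^sup>2 - dd v (dd u f) x\<bar> = \<bar>A - B\<bar> / t"
      using t by simp
    also have "\<dots> \<le> (2 * (e' * (t * (norm u + norm v)))) / t"
      using A B t by (intro divide_right_mono) auto
    also have "\<dots> = e' * (2 * (norm u + norm v))" using t by simp
    also have "\<dots> < e' * (2 * M)" using e' by (simp add: M_def add_nonneg_pos)
    also have "\<dots> = e" using M by (simp add: e'_def)
    finally show ?thesis unfolding eq dist_real_def .
  qed
  then show "\<forall>\<^sub>F t in at_right 0. dist ((f (x + t *\<^sub>R u + t *\<^sub>R v) - f (x + t *\<^sub>R u) - f (x + t *\<^sub>R v) + f x) / t\<^sup>2)
      (dd v (dd u f) x) < e"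
    unfolding eventually_at_right_field using d by blast
qed

text \<open>Schwarz's theorem: both mixed derivatives are limits of the same second difference quotient. Testing
against vectors \<open>c\<close> reduces it to real functions.\<close>

lemma dd_commute:
  fixes F :: "'a::real_normed_vector \<Rightarrow> 'b::real_inner"
  assumes "open S" "smooth_on S F" "x \<in> S"
  shows "dd u (dd v F) x = dd v (dd u F) x"
proof -
  have "dd u (dd v F) x \<bullet> c = dd v (dd u F) x \<bullet> c" for c
  proof -
    define f where "f y = F y \<bullet> c" for y
    have sf: "smooth_on S f"
      unfolding f_def by (rule smooth_on_inner[OF assms(1,2)]) simp
    have 1: "dd w f y = dd w F y \<bullet> c" if "y \<in> S" for w y
      unfolding f_def
      using dd_linear_compose[OF bounded_linear_inner_left] smooth_on_differentiable[OF assms(2) that] by blast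
    have 2: "dd w (dd w' f) x = dd w (dd w' F) x \<bullet> c" for w w'
    proof -
      have "dd w (dd w' f) x = dd w (\<lambda>y. dd w' F y \<bullet> c) x"
        by (rule dd_cong[OF assms(1,3)]) (rule 1)
      also have "\<dots> = dd w (dd w' F) x \<bullet> c"
        using dd_linear_compose[OF bounded_linear_inner_left]
          smooth_on_differentiable[OF smooth_on_dd[OF assms(2)] assms(3)] by blast
      finally show ?thesis .
    qed
    have lim: "((\<lambda>t. (f (x + t *\<^sub>R w + t *\<^sub>R w') - f (x + t *\<^sub>R w) - f (x + t *\<^sub>R w') + f x) / t\<^sup>2)
      \<longlongrightarrow> dd w' (dd w f) x) (at_right 0)" for w w'
      using smooth_on_differentiable[OF sf] smooth_on_differentiable[OF smooth_on_dd[OF sf]] assms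
      by (intro second_difference_limit[of S]) auto
    have eq: "(\<lambda>t. (f (x + t *\<^sub>R v + t *\<^sub>R u) - f (x + t *\<^sub>R v) - f (x + t *\<^sub>R u) + f x) / t\<^sup>2)
      = (\<lambda>t. (f (x + t *\<^sub>R u + t *\<^sub>R v) - f (x + t *\<^sub>R u) - f (x + t *\<^sub>R v) + f x) / t\<^sup>2)"
    proof
      fix t :: real
      have e: "x + t *\<^sub>R v + t *\<^sub>R u = x + t *\<^sub>R u + t *\<^sub>R v"
        by simp
      show "(f (x + t *\<^sub>R v + t *\<^sub>R u) - f (x + t *\<^sub>R v) - f (x + t *\<^sub>R u) + f x) / t\<^sup>2
        = (f (x + t *\<^sub>R u + t *\<^sub>R v) - f (x + t *\<^sub>R u) - f (x + t *\<^sub>R v) + f x) / t\<^sup>2"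
        unfolding e by simp
    qed
    have "dd u (dd v f) x = dd v (dd u f) x"
      by (rule tendsto_unique[OF trivial_limit_at_right_real lim[of v u, unfolded eq] lim[of u v]])
    then show ?thesis by (simp add: 2)
  qed
  then show ?thesis
    using vector_eq_rdot by blast
qed

section \<open>Oriented area in the plane\<close>

text \<open>The form \<open>\<sigma>\<close> in the trivialisation of the tangent bundle by translations.\<close>

definition wedge :: "complex \<Rightarrow> complex \<Rightarrow> real" where
  "wedge u v = (\<i> * u) \<bullet> v"

lemma wedge_eq: "wedge u v = Re u * Im v - Im u * Re v"
  by (simp add: wedge_def inner_complex_def)

lemma bounded_bilinear_wedge: "bounded_bilinear wedge"
  unfolding wedge_def[abs_def]
  by (rule bounded_bilinear.comp1[OF bounded_bilinear_inner bounded_linear_mult_right])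

lemma smooth_on_wedge:
  "open S \<Longrightarrow> smooth_on S F \<Longrightarrow> smooth_on S G \<Longrightarrow> smooth_on S (\<lambda>x. wedge (F x) (G x))"
  by (rule smooth_on_bilinear[OF _ bounded_bilinear_wedge])

lemmas smooth_intros = smooth_on_add smooth_on_diff smooth_on_minus smooth_on_mult smooth_on_scaleR smooth_on_inner
  smooth_on_Re smooth_on_Im smooth_on_of_real smooth_on_const smooth_on_dd smooth_on_wedge open_UNIV

lemma abs_wedge_le: "\<bar>wedge u v\<bar> \<le> norm u * norm v"
  using Cauchy_Schwarz_ineq2[of "\<i> * u" v] by (simp add: wedge_def norm_mult)

text \<open>Cramer's rule, which yields both the coordinates with respect to the lattice basis and the inverse of an
invertible differential.\<close>

lemma wedge_cramer:
  assumes "wedge p q \<noteq> 0"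
  shows "(wedge z q / wedge p q) *\<^sub>R p + (wedge p z / wedge p q) *\<^sub>R q = z"
proof -
  have "wedge z q *\<^sub>R p + wedge p z *\<^sub>R q = wedge p q *\<^sub>R z"
    by (simp add: wedge_eq complex_eq_iff algebra_simps)
  then have "(1 / wedge p q) *\<^sub>R (wedge z q *\<^sub>R p + wedge p z *\<^sub>R q) = z"
    using assms by simp
  then show ?thesis
    by (simp add: scaleR_add_right)
qed

text \<open>The vectors \<open>p\<close> and \<open>\<i> * p\<close> are orthogonal and of equal length.\<close>

lemma inner_wedge_decomposition: "(p \<bullet> p) *\<^sub>R q = (q \<bullet> p) *\<^sub>R p + wedge p q *\<^sub>R (\<i> * p)"
  by (simp add: wedge_eq inner_complex_def complex_eq_iff algebra_simps)

section \<open>The lattice and the torus\<close>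

lemma dd_translate:
  assumes "F differentiable at (z + c)"
  shows "dd v (\<lambda>y. F (y + c)) z = dd v F (z + c)"
proof -
  have "((\<lambda>y. F (y + c)) has_derivative (\<lambda>v. dd v F (z + c))) (at z)"
    by (rule has_derivative_compose[where f="\<lambda>y. y + c" and g=F, OF _ dd_has_derivative[OF assms]])
      (auto intro!: derivative_eq_intros)
  then show ?thesis by (rule dd_eq)
qed

lemma smooth_into_torusE:
  assumes "smooth_into_torus \<Lambda> S \<gamma>" "x \<in> S"
  obtains U F where "open U" "x \<in> U" "smooth_on U F" "\<And>y. y \<in> U \<inter> S \<Longrightarrow> \<gamma> y = proj \<Lambda> (F y)"
proof -
  have "\<exists>U F. open U \<and> x \<in> U \<and> smooth_on U F \<and> (\<forall>y\<in>U \<inter> S. \<gamma> y = proj \<Lambda> (F y))"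
    using assms unfolding smooth_into_torus_def by (rule bspec)
  then show ?thesis using that by (elim exE conjE) simp
qed

text \<open>The basis is tied to the choice made in \<open>fund_domain\<close>, so that the domain of integration has a
description in coordinates.\<close>

locale lattice =
  fixes \<Lambda> :: "complex set" and a b :: complex
  assumes basis: "lattice_basis \<Lambda> a b"
    and chosen: "(SOME (a, b). lattice_basis \<Lambda> a b) = (a, b)"
begin

abbreviation "\<pi> \<equiv> proj \<Lambda>"

definition periodic :: "(complex \<Rightarrow> 'b) \<Rightarrow> bool" where
  "periodic g \<longleftrightarrow> (\<forall>z. \<forall>l\<in>\<Lambda>. g (z + l) = g z)"

definition is_lift :: "(complex set \<Rightarrow> complex set) \<Rightarrow> (complex \<Rightarrow> complex) \<Rightarrow> bool" where
  "is_lift f F \<longleftrightarrow> (\<forall>z. f (\<pi> z) = \<pi> (F z))"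

text \<open>The maps that descend to the torus. No linear part is singled out: continuity makes
\<open>F (z + l) - F z\<close> independent of \<open>z\<close>.\<close>

definition equivariant :: "(complex \<Rightarrow> complex) \<Rightarrow> bool" where
  "equivariant F \<longleftrightarrow> (\<forall>z. \<forall>l\<in>\<Lambda>. F (z + l) - F z \<in> \<Lambda>)"

text \<open>A diffeomorphism of the torus seen from \<open>\<complex>\<close>: a lift and the inverse lift.\<close>

definition lift_pair :: "(complex \<Rightarrow> complex) \<Rightarrow> (complex \<Rightarrow> complex) \<Rightarrow> bool" where
  "lift_pair F G \<longleftrightarrow> smooth F \<and> smooth G \<and>
     (\<forall>z. G (F z) = z) \<and> (\<forall>z. F (G z) = z) \<and> equivariant F \<and> equivariant G"

definition descend :: "(complex \<Rightarrow> 'b) \<Rightarrow> complex set \<Rightarrow> 'b" where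
  "descend g = (\<lambda>p\<in>torus \<Lambda>. g (rep p))"

definition "area = wedge a b"
definition "coord1 z = wedge z b / area"
definition "coord2 z = wedge a z / area"

lemma area_nonzero: "area \<noteq> 0"
proof
  assume 0: "area = 0"
  have ind: "a \<noteq> b" "independent {a, b}" using basis by (auto simp: lattice_basis_def)
  have "b \<notin> span {a}" using ind by (auto simp: dependent_def insert_Diff_if)
  moreover have "a \<noteq> 0" using ind(2) dependent_zero by blast
  have "(a \<bullet> a) *\<^sub>R b = (b \<bullet> a) *\<^sub>R a"
    using inner_wedge_decomposition[of a b] 0 by (simp add: area_def)
  then have "b = ((b \<bullet> a) / (a \<bullet> a)) *\<^sub>R a"
    using \<open>a \<noteq> 0\<close> by (metis divide_inverse inner_eq_zero_iff mult.commute scaleR_scaleR left_inverse scaleR_one)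
  then have "b \<in> span {a}"
    by (metis span_base span_scale singletonI)
  ultimately show False by blast
qed

lemma coords: "coord1 z *\<^sub>R a + coord2 z *\<^sub>R b = z"
  using wedge_cramer[of a b z] area_nonzero unfolding coord1_def coord2_def area_def by blast

lemma coords_unique: "coord1 (x *\<^sub>R a + y *\<^sub>R b) = x" "coord2 (x *\<^sub>R a + y *\<^sub>R b) = y"
proof -
  have "wedge (x *\<^sub>R a + y *\<^sub>R b) b = x * area" "wedge a (x *\<^sub>R a + y *\<^sub>R b) = y * area"
    by (simp_all add: area_def wedge_eq algebra_simps)
  then show "coord1 (x *\<^sub>R a + y *\<^sub>R b) = x" "coord2 (x *\<^sub>R a + y *\<^sub>R b) = y"
    using area_nonzero by (simp_all add: coord1_def coord2_def)
qed

lemma coords_add: "coord1 (z + w) = coord1 z + coord1 w" "coord2 (z + w) = coord2 z + coord2 w"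
  and coords_diff: "coord1 (z - w) = coord1 z - coord1 w" "coord2 (z - w) = coord2 z - coord2 w"
  by (simp_all add: coord1_def coord2_def wedge_eq algebra_simps add_divide_distrib diff_divide_distrib)

lemma continuous_coords: "continuous_on S coord1" "continuous_on S coord2"
  unfolding coord1_def[abs_def] coord2_def[abs_def] wedge_eq by (intro continuous_intros, simp add: area_nonzero)+

lemma lattice_eq: "\<Lambda> = {of_int m * a + of_int n * b | m n. True}"
  using basis by (auto simp: lattice_basis_def)

lemma mem_lattice_iff: "z \<in> \<Lambda> \<longleftrightarrow> coord1 z \<in> \<int> \<and> coord2 z \<in> \<int>"
proof
  assume "z \<in> \<Lambda>"
  then obtain m n where "z = of_int m * a + of_int n * b" using lattice_eq by auto
  then have "z = of_int m *\<^sub>R a + of_int n *\<^sub>R b" by (simp add: scaleR_conv_of_real)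
  then show "coord1 z \<in> \<int> \<and> coord2 z \<in> \<int>" by (simp add: coords_unique)
next
  assume "coord1 z \<in> \<int> \<and> coord2 z \<in> \<int>"
  then obtain m n where "coord1 z = of_int m" "coord2 z = of_int n" by (auto elim!: Ints_cases)
  then have "z = of_int m * a + of_int n * b"
    using coords[of z] by (simp add: scaleR_conv_of_real)
  then show "z \<in> \<Lambda>" using lattice_eq by auto
qed

lemma lattice_0 [simp]: "0 \<in> \<Lambda>"
  by (simp add: mem_lattice_iff coord1_def coord2_def wedge_eq)

lemma lattice_add: "z \<in> \<Lambda> \<Longrightarrow> w \<in> \<Lambda> \<Longrightarrow> z + w \<in> \<Lambda>"
  and lattice_diff: "z \<in> \<Lambda> \<Longrightarrow> w \<in> \<Lambda> \<Longrightarrow> z - w \<in> \<Lambda>"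
  by (auto simp: mem_lattice_iff coords_add coords_diff)

lemma lattice_minus: "z \<in> \<Lambda> \<Longrightarrow> - z \<in> \<Lambda>"
  using lattice_diff[of 0 z] by simp

lemma mem_proj: "w \<in> \<pi> z \<longleftrightarrow> w - z \<in> \<Lambda>"
  by (simp add: proj_def)

lemma proj_eq_iff: "\<pi> z = \<pi> w \<longleftrightarrow> z - w \<in> \<Lambda>"
proof
  assume "\<pi> z = \<pi> w"
  then show "z - w \<in> \<Lambda>" using mem_proj[of z z] mem_proj[of z w] by simp
next
  assume *: "z - w \<in> \<Lambda>"
  have "x - z \<in> \<Lambda> \<longleftrightarrow> x - w \<in> \<Lambda>" for x
    using lattice_add[OF _ *, of "x - z"] lattice_diff[OF _ *, of "x - w"] by auto
  then show "\<pi> z = \<pi> w" by (simp add: proj_def)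
qed

lemma proj_in_torus [simp]: "\<pi> z \<in> torus \<Lambda>"
  by (simp add: torus_def)

lemma rep_proj: "rep (\<pi> z) - z \<in> \<Lambda>"
proof -
  have "z \<in> \<pi> z" by (simp add: mem_proj)
  then have "rep (\<pi> z) \<in> \<pi> z" unfolding rep_def by (rule someI)
  then show ?thesis by (simp add: mem_proj)
qed

lemma torus_cases: assumes "p \<in> torus \<Lambda>" obtains z where "p = \<pi> z"
  using assms by (auto simp: torus_def)

lemma proj_translate: "l \<in> \<Lambda> \<Longrightarrow> \<pi> (z + l) = \<pi> z"
  by (simp add: proj_eq_iff)

lemma periodic_proj: "periodic (\<lambda>z. h (\<pi> z))"
  by (simp add: periodic_def proj_translate)

lemma periodicD: "periodic g \<Longrightarrow> w - z \<in> \<Lambda> \<Longrightarrow> g w = g z"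
  by (metis add_diff_cancel_left' diff_add_cancel periodic_def add.commute)

lemma descend_proj: "periodic g \<Longrightarrow> descend g (\<pi> z) = g z"
  by (simp add: descend_def periodicD rep_proj)

lemma descend_extensional [simp]: "descend g \<in> extensional (torus \<Lambda>)"
  by (simp add: descend_def)

lemma torus_ext:
  assumes "f \<in> extensional (torus \<Lambda>)" "g \<in> extensional (torus \<Lambda>)" "\<And>z. f (\<pi> z) = g (\<pi> z)"
  shows "f = g"
  using assms by (intro extensionalityI[of f "torus \<Lambda>" g]) (auto elim: torus_cases)

lemma descend_in_cinf: "periodic g \<Longrightarrow> smooth g \<Longrightarrow> descend g \<in> cinf \<Lambda>"
  by (simp add: cinf_def descend_proj)

lemma lattice_separated: "\<exists>\<rho>>0. \<forall>l\<in>\<Lambda>. norm l < \<rho> \<longrightarrow> l = 0"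
proof -
  define \<rho> where "\<rho> = \<bar>area\<bar> / (norm a + norm b + 1)"
  have pos: "norm a + norm b + 1 > 0" by (simp add: add_nonneg_pos)
  then have "\<rho> > 0" using area_nonzero by (simp add: \<rho>_def)
  moreover have "l = 0" if l: "l \<in> \<Lambda>" "norm l < \<rho>" for l
  proof -
    have *: "norm l * (norm a + norm b + 1) < \<bar>area\<bar>"
      using l(2) pos by (simp add: \<rho>_def pos_less_divide_eq)
    have "\<bar>wedge l b\<bar> \<le> norm l * norm b" "\<bar>wedge a l\<bar> \<le> norm l * norm a"
      using abs_wedge_le[of l b] abs_wedge_le[of a l] by (simp_all add: mult.commute)
    moreover have "norm l * norm b \<le> norm l * (norm a + norm b + 1)"
      "norm l * norm a \<le> norm l * (norm a + norm b + 1)"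
      by (intro mult_left_mono; simp)+
    ultimately have "\<bar>wedge l b\<bar> < \<bar>area\<bar>" "\<bar>wedge a l\<bar> < \<bar>area\<bar>" using * by linarith+
    then have "\<bar>coord1 l\<bar> < 1" "\<bar>coord2 l\<bar> < 1"
      using area_nonzero by (simp_all add: coord1_def coord2_def)
    moreover obtain m n where mn: "coord1 l = of_int m" "coord2 l = of_int n"
      using l(1) mem_lattice_iff by (auto elim!: Ints_cases)
    ultimately have "m = 0" "n = 0" by auto
    then show "l = 0" using coords[of l] mn by simp
  qed
  ultimately show ?thesis by blast
qed

text \<open>The source of all uniqueness statements for lifts: two lifts of the same map differ by a continuous
function with values in the lattice.\<close>

lemma lattice_valued_constant:
  fixes g :: "'a::topological_space \<Rightarrow> complex"
  assumes "connected S" "continuous_on S g" "\<And>x. x \<in> S \<Longrightarrow> g x \<in> \<Lambda>" "x \<in> S" "y \<in> S"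
  shows "g x = g y"
proof -
  obtain \<rho> where \<rho>: "\<rho> > 0" "\<And>l. l \<in> \<Lambda> \<Longrightarrow> norm l < \<rho> \<Longrightarrow> l = 0"
    using lattice_separated by blast
  have "g constant_on S"
  proof (rule continuous_discrete_range_constant[OF assms(1,2)])
    fix x assume x: "x \<in> S"
    have "\<rho> \<le> norm (g y - g x)" if "y \<in> S" "g y \<noteq> g x" for y
      using \<rho>(2)[OF lattice_diff[OF assms(3)[OF that(1)] assms(3)[OF x]]] that by force
    then show "\<exists>e>0. \<forall>y. y \<in> S \<and> g y \<noteq> g x \<longrightarrow> e \<le> norm (g y - g x)"
      using \<rho>(1) by blast
  qed
  then show ?thesis using assms(4,5) by (auto simp: constant_on_def)
qed

section \<open>Lifts of torus-valued maps\<close>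

text \<open>Two local lifts differ near \<open>z\<close> by a constant. Being differentiable at \<open>z\<close> they are continuous at
that point, and the separation of the lattice turns this into equality up to a constant on a neighbourhood.\<close>

lemma torus_derivative_eq:
  fixes \<gamma> :: "'a::real_normed_vector \<Rightarrow> complex set"
  assumes D: "(F has_derivative D) (at z)" and F: "\<forall>\<^sub>F y in nhds z. \<gamma> y = \<pi> (F y)"
  shows "torus_derivative \<Lambda> \<gamma> z = D"
  unfolding torus_derivative_def
proof (rule the_equality)
  show "has_torus_derivative \<Lambda> \<gamma> D z"
    using assms by (auto simp: has_torus_derivative_def)
  fix D' assume "has_torus_derivative \<Lambda> \<gamma> D' z"
  then obtain F' where D': "(F' has_derivative D') (at z)" and F': "\<forall>\<^sub>F y in nhds z. \<gamma> y = \<pi> (F' y)"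
    by (auto simp: has_torus_derivative_def)
  obtain \<rho> where \<rho>: "\<rho> > 0" "\<And>l. l \<in> \<Lambda> \<Longrightarrow> norm l < \<rho> \<Longrightarrow> l = 0"
    using lattice_separated by blast
  define g where "g y = F y - F' y" for y
  have "isCont g z" unfolding g_def
    using D D' by (intro continuous_intros) (auto intro: has_derivative_continuous)
  then have "(g \<longlongrightarrow> g z) (nhds z)"
    unfolding isCont_def by (simp only: tendsto_at_iff_tendsto_nhds)
  then have "\<forall>\<^sub>F y in nhds z. dist (g y) (g z) < \<rho>"
    using \<rho>(1) by (rule tendstoD)
  moreover have mem: "\<forall>\<^sub>F y in nhds z. g y \<in> \<Lambda>"
    using F F' by eventually_elim (metis g_def proj_eq_iff)
  ultimately have ev: "\<forall>\<^sub>F y in nhds z. F y = F' y + g z"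
  proof eventually_elim
    case (elim y)
    have "g y - g z = 0"
      using \<rho>(2)[of "g y - g z"] elim lattice_diff eventually_nhds_x_imp_x[OF mem] by (simp add: dist_norm)
    then show ?case by (simp add: g_def algebra_simps)
  qed
  have "((\<lambda>y. F' y + g z) has_derivative D') (at z)"
    using D' by (auto intro!: derivative_eq_intros)
  moreover have "\<forall>\<^sub>F y in at z. F' y + g z = F y"
    using ev unfolding eventually_at_filter by eventually_elim simp
  moreover have "F' z + g z = F z" by (simp add: g_def)
  ultimately have "(F has_derivative D') (at z)"
    by (rule has_derivative_transform_eventually) simp
  then show "D' = D" using D has_derivative_unique by blast
qed

lemma torus_derivative_smooth_lift:
  fixes \<gamma> :: "'a::real_normed_vector \<Rightarrow> complex set"
  assumes "open U" "z \<in> U" "smooth_on U F" "\<And>y. y \<in> U \<Longrightarrow> \<gamma> y = \<pi> (F y)"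
  shows "torus_derivative \<Lambda> \<gamma> z v = dd v F z"
proof -
  have "torus_derivative \<Lambda> \<gamma> z = (\<lambda>v. dd v F z)"
  proof (rule torus_derivative_eq)
    show "(F has_derivative (\<lambda>v. dd v F z)) (at z)"
      by (rule dd_has_derivative[OF smooth_on_differentiable[OF assms(3,2)]])
    show "\<forall>\<^sub>F y in nhds z. \<gamma> y = \<pi> (F y)"
      unfolding eventually_nhds using assms(1,2,4) by blast
  qed
  then show ?thesis by simp
qed

text \<open>Locally, a continuous lift is a smooth lift plus a constant.\<close>

lemma smooth_of_continuous_lift:
  fixes \<gamma> :: "'a::real_normed_vector \<Rightarrow> complex set"
  assumes "open S" "smooth_into_torus \<Lambda> S \<gamma>" "continuous_on S F" "\<And>y. y \<in> S \<Longrightarrow> \<gamma> y = \<pi> (F y)"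
  shows "smooth_on S F"
proof (rule smooth_on_local)
  fix x assume x: "x \<in> S"
  obtain U H where U: "open U" "x \<in> U" "smooth_on U H" "\<And>y. y \<in> U \<inter> S \<Longrightarrow> \<gamma> y = \<pi> (H y)"
    by (rule smooth_into_torusE[OF assms(2) x]) blast
  obtain r where r: "r > 0" "ball x r \<subseteq> U \<inter> S"
    using openE[OF open_Int[OF U(1) assms(1)], of x] U x by blast
  define c where "c = F x - H x"
  have "F y - H y = F x - H x" if "y \<in> ball x r" for y
  proof (rule lattice_valued_constant[where S="ball x r" and g="\<lambda>y. F y - H y"])
    show "continuous_on (ball x r) (\<lambda>y. F y - H y)"
      using continuous_on_subset[OF assms(3)] continuous_on_subset[OF smooth_on_continuous_on[OF U(3)]] r
      by (intro continuous_intros) auto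
    show "F y - H y \<in> \<Lambda>" if "y \<in> ball x r" for y
    proof -
      have "y \<in> U \<inter> S" using that r(2) by blast
      then show ?thesis using U(4) assms(4) proj_eq_iff by (metis IntD2)
    qed
  qed (use that r in auto)
  then have "\<forall>y\<in>ball x r. F y = H y + c" by (auto simp: c_def algebra_simps)
  moreover have "smooth_on (ball x r) (\<lambda>y. H y + c)"
    using smooth_on_subset[OF U(3)] r by (intro smooth_on_add) auto
  ultimately show "\<exists>U G. open U \<and> x \<in> U \<and> smooth_on U G \<and> (\<forall>y\<in>U. F y = G y)"
    using r(1) by (intro exI[of _ "ball x r"] exI[of _ "\<lambda>y. H y + c"]) auto
qed

lemma exp_coord_eq: 
  assumes "x \<in> \<int>" shows "exp (2 * of_real pi * \<i> * of_real (r + x)) = exp (2 * of_real pi * \<i> * of_real r)"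
proof -
  obtain n where "x = of_int n" using assms by (auto elim: Ints_cases)
  then have "2 * of_real pi * \<i> * of_real (r + x) = 2 * of_real pi * \<i> * of_real r + (of_int (2 * n) * pi) * \<i>"
    by (simp add: algebra_simps)
  then show ?thesis by (subst exp_eq) blast
qed

text \<open>A coordinate \<open>s\<close> on \<open>\<complex>\<close> that is integral on the lattice defines the nonvanishing function
\<open>exp (2 * pi * \<i> * s)\<close> on the torus. Along \<open>\<gamma>\<close> it has a continuous logarithm, as the domain is contractible, and
this is a continuous choice of \<open>s\<close> along \<open>\<gamma>\<close>.\<close>

lemma log_of_coord:
  fixes \<gamma> :: "'a::real_normed_vector \<Rightarrow> complex set"
  assumes "open S" "convex S" "smooth_into_torus \<Lambda> S \<gamma>"
    and s: "\<And>z w. s (z + w) = s z + (s w :: real)" "continuous_on UNIV s" "\<And>l. l \<in> \<Lambda> \<Longrightarrow> s l \<in> \<int>"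
  obtains x where "continuous_on S x" "\<And>y z. y \<in> S \<Longrightarrow> \<gamma> y = \<pi> z \<Longrightarrow> x y - s z \<in> \<int>"
proof -
  \<comment> \<open>The character of the torus that belongs to \<open>s\<close>.\<close>
  define E where "E z = exp (2 * of_real pi * \<i> * of_real (s z))" for z
  have E: "E w = E z" if "w - z \<in> \<Lambda>" for w z
  proof -
    have "s w = s z + s (w - z)" by (metis s(1) add.commute diff_add_cancel)
    then show ?thesis unfolding E_def using exp_coord_eq[OF s(3)[OF that], of "s z"] by simp
  qed
  have Econt: "continuous_on UNIV E"
    unfolding E_def by (intro continuous_intros s(2))
  define e where "e y = E (rep (\<gamma> y))" for y
  have e: "e y = E z" if "\<gamma> y = \<pi> z" for y z
    unfolding e_def that by (rule E) (rule rep_proj)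
  have "continuous_on S e"
    unfolding continuous_on_eq_continuous_at[OF assms(1)]
  proof
    fix y assume y: "y \<in> S"
    obtain U H where U: "open U" "y \<in> U" "smooth_on U H" "\<And>y. y \<in> U \<inter> S \<Longrightarrow> \<gamma> y = \<pi> (H y)"
      by (rule smooth_into_torusE[OF assms(3) y]) blast
    have "continuous_on U (\<lambda>y. E (H y))"
      by (rule continuous_on_compose2[OF Econt smooth_on_continuous_on[OF U(3)]]) auto
    then have "continuous_on (U \<inter> S) (\<lambda>y. E (H y))"
      by (rule continuous_on_subset) auto
    then have "continuous_on (U \<inter> S) e"
      by (rule continuous_on_eq) (metis e U(4))
    then show "isCont e y"
      using continuous_on_eq_continuous_at[OF open_Int[OF U(1) assms(1)]] U(2) y by blast
  qed
  moreover have "e y \<noteq> 0" for y by (simp add: e_def E_def)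
  ultimately obtain g where g: "continuous_on S g" "\<And>y. y \<in> S \<Longrightarrow> e y = exp (g y)"
    using continuous_logarithm_on_contractible[OF _ convex_imp_contractible[OF assms(2)]] by metis
  show ?thesis
  proof
    show "continuous_on S (\<lambda>y. Im (g y) / (2 * pi))"
      using g(1) by (intro continuous_intros) auto
    fix y z assume "y \<in> S" "\<gamma> y = \<pi> z"
    then have "exp (g y) = exp (2 * of_real pi * \<i> * of_real (s z))"
      using e g(2) by (metis E_def)
    then obtain n :: int where "g y = 2 * of_real pi * \<i> * of_real (s z) + (of_int (2 * n) * pi) * \<i>"
      unfolding exp_eq by blast
    then have "Im (g y) = 2 * pi * s z + 2 * n * pi" by simp
    then have "Im (g y) / (2 * pi) - s z = of_int n"
      by (simp add: field_simps)
    then show "Im (g y) / (2 * pi) - s z \<in> \<int>" by simp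
  qed
qed

lemma smooth_lift_exists:
  fixes \<gamma> :: "'a::real_normed_vector \<Rightarrow> complex set"
  assumes "open S" "convex S" "smooth_into_torus \<Lambda> S \<gamma>"
  obtains F where "smooth_on S F" "\<And>y. y \<in> S \<Longrightarrow> \<gamma> y = \<pi> (F y)"
proof -
  obtain x1 where x1: "continuous_on S x1" "\<And>y z. y \<in> S \<Longrightarrow> \<gamma> y = \<pi> z \<Longrightarrow> x1 y - coord1 z \<in> \<int>"
    using log_of_coord[OF assms, of coord1] coords_add continuous_coords mem_lattice_iff by metis
  obtain x2 where x2: "continuous_on S x2" "\<And>y z. y \<in> S \<Longrightarrow> \<gamma> y = \<pi> z \<Longrightarrow> x2 y - coord2 z \<in> \<int>"
    using log_of_coord[OF assms, of coord2] coords_add continuous_coords mem_lattice_iff by metis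
  define F where "F y = x1 y *\<^sub>R a + x2 y *\<^sub>R b" for y
  have F: "\<gamma> y = \<pi> (F y)" if y: "y \<in> S" for y
  proof -
    obtain z where z: "\<gamma> y = \<pi> z"
      by (rule smooth_into_torusE[OF assms(3) y]) (use y in blast)
    have "F y - z \<in> \<Lambda>"
      using x1(2)[OF y z] x2(2)[OF y z] by (simp add: mem_lattice_iff coords_diff F_def coords_unique)
    then show ?thesis using z by (metis proj_eq_iff)
  qed
  moreover have "continuous_on S F"
    unfolding F_def by (intro continuous_intros x1 x2)
  ultimately show ?thesis
    using smooth_of_continuous_lift[OF assms(1,3)] that by blast
qed

section \<open>Lifts of diffeomorphisms\<close>

lemma equivariant_monodromy:
  assumes "continuous_on UNIV F" "equivariant F" "l \<in> \<Lambda>"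
  shows "F (z + l) - F z = F (w + l) - F w"
proof (rule lattice_valued_constant[where S=UNIV and g="\<lambda>z. F (z + l) - F z"])
  show "continuous_on UNIV (\<lambda>z. F (z + l) - F z)"
    by (intro continuous_intros continuous_on_compose2[OF assms(1)]) (auto intro: continuous_intros assms(1))
qed (use assms in \<open>auto simp: equivariant_def convex_connected\<close>)

lemma is_lift_equivariant: "is_lift f F \<Longrightarrow> equivariant F"
  unfolding is_lift_def equivariant_def by (metis proj_translate proj_eq_iff)

text \<open>A lift commutes with a lattice translation up to a constant, which differentiation removes.\<close>

lemma dd_lift_periodic:
  assumes "smooth F" "equivariant F"
  shows "periodic (dd v F)"
  unfolding periodic_def
proof (intro allI ballI)
  fix z l assume l: "l \<in> \<Lambda>"
  have eq: "(\<lambda>y. F (y + l)) = (\<lambda>y. F y + (F l - F 0))"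
    using equivariant_monodromy[OF smooth_on_continuous_on[OF assms(1)] assms(2) l, of _ 0] by (auto simp: algebra_simps fun_eq_iff)
  have "dd v F (z + l) = dd v (\<lambda>y. F (y + l)) z"
    using smooth_on_differentiable[OF assms(1)] by (simp add: dd_translate)
  also have "\<dots> = dd v F z"
    unfolding eq using smooth_on_differentiable[OF assms(1)] by (subst dd_add) auto
  finally show "dd v F (z + l) = dd v F z" .
qed

lemma dd_periodic:
  fixes g :: "complex \<Rightarrow> 'b::real_normed_vector"
  assumes "smooth g" "periodic g"
  shows "periodic (dd v g)"
  unfolding periodic_def
proof (intro allI ballI)
  fix z l assume l: "l \<in> \<Lambda>"
  have eq: "(\<lambda>y. g (y + l)) = g" using assms(2) l by (auto simp: periodic_def)
  have "dd v g (z + l) = dd v (\<lambda>y. g (y + l)) z"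
    using smooth_on_differentiable[OF assms(1)] by (simp add: dd_translate)
  then show "dd v g (z + l) = dd v g z" unfolding eq .
qed

lemma is_lift_exists:
  assumes "smooth_into_torus \<Lambda> UNIV (\<lambda>z. f (\<pi> z))"
  obtains F where "smooth F" "is_lift f F"
proof (rule smooth_lift_exists[OF open_UNIV convex_UNIV assms])
  fix F assume "smooth F" "\<And>z. z \<in> UNIV \<Longrightarrow> f (\<pi> z) = \<pi> (F z)"
  then show thesis by (intro that[of F]) (simp_all add: is_lift_def)
qed

lemma is_lift_translate: "is_lift f F \<Longrightarrow> c \<in> \<Lambda> \<Longrightarrow> is_lift f (\<lambda>z. F z + c)"
  unfolding is_lift_def by (simp add: proj_translate)

text \<open>A lift of the inverse is inverse to \<open>F\<close> up to lattice vectors, and these do not depend on the point. One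
translation makes it a left inverse; that it is then a right inverse has to be checked at one point only,
which may be taken in the image of \<open>F\<close>.\<close>

lemma lift_pair_of_diffeo:
  assumes f: "f \<in> diffeos \<Lambda>" and F: "smooth F" "is_lift f F"
  obtains G where "lift_pair F G"
proof -
  define g where "g = inv_into (torus \<Lambda>) f"
  have bij: "bij_betw f (torus \<Lambda>) (torus \<Lambda>)" using f by (simp add: diffeos_def)
  have gf: "g (f p) = p" if "p \<in> torus \<Lambda>" for p
    using bij that by (simp add: g_def bij_betw_inv_into_left)
  have fg: "f (g p) = p" if "p \<in> torus \<Lambda>" for p
    using bij that by (simp add: g_def bij_betw_inv_into_right)
  obtain G0 where G0: "smooth G0" "is_lift g G0"
  proof (rule is_lift_exists)
    show "smooth_into_torus \<Lambda> UNIV (\<lambda>z. g (\<pi> z))"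
      using f by (simp add: diffeos_def g_def)
  qed
  have GF: "G0 (F z) - z \<in> \<Lambda>" for z
    using gf[of "\<pi> z"] F(2) G0(2) by (simp add: is_lift_def proj_eq_iff)
  have FG: "F (G0 z) - z \<in> \<Lambda>" for z
  proof -
    have "g (\<pi> z) = \<pi> (G0 z)" using G0(2) by (simp add: is_lift_def)
    then show ?thesis using fg[of "\<pi> z"] F(2) by (simp add: is_lift_def proj_eq_iff)
  qed
  \<comment> \<open>The deviation of \<open>G0 \<circ> F\<close> from the identity, which is the same lattice vector at every point.\<close>
  define c where "c = G0 (F 0)"
  have c: "c \<in> \<Lambda>" using GF[of 0] by (simp add: c_def)
  have cont: "continuous_on UNIV F" "continuous_on UNIV G0"
    using F G0 smooth_on_continuous_on by auto
  have const: "G0 (F z) - z = c" for z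
  proof -
    have "G0 (F z) - z = G0 (F 0) - 0"
    proof (rule lattice_valued_constant[where S=UNIV and g="\<lambda>z. G0 (F z) - z"])
      show "continuous_on UNIV (\<lambda>z. G0 (F z) - z)"
        by (intro continuous_intros continuous_on_compose2[OF cont(2) cont(1)]) simp
    qed (simp_all add: GF convex_connected)
    then show ?thesis by (simp add: c_def)
  qed
  define G where "G z = G0 z + (- c)" for z
  have G: "smooth G" "is_lift g G"
    unfolding G_def[abs_def]
    by (rule smooth_on_add[OF open_UNIV G0(1) smooth_on_const])
      (rule is_lift_translate[OF G0(2) lattice_minus[OF c]])
  have 1: "G (F z) = z" for z using const[of z] by (simp add: G_def algebra_simps)
  have 2: "F (G z) = z" for z
  proof -
    have FG': "F (G z) - z \<in> \<Lambda>" for z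
    proof -
      have "F (G z) - F (G0 z) \<in> \<Lambda>"
        using is_lift_equivariant[OF F(2)] lattice_minus[OF c] unfolding equivariant_def G_def by blast
      then show ?thesis using FG[of z] lattice_add by fastforce
    qed
    have "F (G z) - z = F (G (F 0)) - F 0"
    proof (rule lattice_valued_constant[where S=UNIV and g="\<lambda>z. F (G z) - z"])
      show "continuous_on UNIV (\<lambda>z. F (G z) - z)"
        by (intro continuous_intros continuous_on_compose2[OF cont(1) smooth_on_continuous_on[OF G(1)]]) simp
    qed (simp_all add: FG' convex_connected)
    then show ?thesis by (simp add: 1)
  qed
  show ?thesis
    by (rule that[of G]) (simp add: lift_pair_def F(1) G(1) 1 2 is_lift_equivariant[OF F(2)] is_lift_equivariant[OF G(2)])
qed

lemma diffeo_lift: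
  assumes "f \<in> diffeos \<Lambda>"
  obtains F G where "lift_pair F G" "is_lift f F"
proof -
  have "smooth_into_torus \<Lambda> UNIV (\<lambda>z. f (\<pi> z))" using assms by (simp add: diffeos_def)
  then obtain F where F: "smooth F" "is_lift f F" by (rule is_lift_exists)
  then obtain G where "lift_pair F G" by (rule lift_pair_of_diffeo[OF assms])
  then show thesis using F that by simp
qed

text \<open>Injectivity on the torus uses that the inverse lift maps congruent points to congruent points.\<close>

lemma diffeo_of_lift_pair:
  assumes FG: "lift_pair F G" and f: "f \<in> extensional (torus \<Lambda>)" "is_lift f F"
  shows "f \<in> diffeos \<Lambda>"
proof -
  have FG': "smooth F" "smooth G" "\<And>z. G (F z) = z" "\<And>z. F (G z) = z"
    "equivariant F" "equivariant G"
    using FG by (auto simp: lift_pair_def)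
  have f': "f (\<pi> z) = \<pi> (F z)" for z using f by (simp add: is_lift_def)
  have inj: "inj_on f (torus \<Lambda>)"
  proof (rule inj_onI)
    fix p q assume pq: "p \<in> torus \<Lambda>" "q \<in> torus \<Lambda>" "f p = f q"
    then obtain z w where zw: "p = \<pi> z" "q = \<pi> w" by (auto elim!: torus_cases)
    then have "F z - F w \<in> \<Lambda>" using pq by (simp add: f' proj_eq_iff)
    then have "G (F w + (F z - F w)) - G (F w) \<in> \<Lambda>" using FG'(6) unfolding equivariant_def by blast
    then show "p = q" using zw FG' by (simp add: proj_eq_iff)
  qed
  have bij: "bij_betw f (torus \<Lambda>) (torus \<Lambda>)"
  proof (rule bij_betw_imageI[OF inj])
    have "\<pi> z \<in> f ` torus \<Lambda>" for z
      by (rule image_eqI[where x="\<pi> (G z)"]) (simp_all add: f' FG')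
    then show "f ` torus \<Lambda> = torus \<Lambda>" by (auto elim!: torus_cases simp: f')
  qed
  have "inv_into (torus \<Lambda>) f (\<pi> z) = \<pi> (G z)" for z
    by (rule inv_into_f_eq[OF inj]) (simp_all add: f' FG')
  then show ?thesis
    unfolding diffeos_def smooth_into_torus_def using f(1) bij f' FG'(1,2) by fastforce
qed

lemma tangent_map_lift:
  assumes "smooth F" "is_lift f F"
  shows "tangent_map \<Lambda> f (\<pi> z, v) = (\<pi> (F z), dd v F z)"
proof -
  have "torus_derivative \<Lambda> (\<lambda>z. f (\<pi> z)) w v = dd v F w" for w
    using assms by (intro torus_derivative_smooth_lift[of UNIV]) (auto simp: is_lift_def)
  moreover have "dd v F (rep (\<pi> z)) = dd v F z"
    using periodicD[OF dd_lift_periodic[OF assms(1) is_lift_equivariant[OF assms(2)]] rep_proj] .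
  ultimately show ?thesis
    using assms(2) by (simp add: tangent_map_def is_lift_def)
qed

lemma fun_diff_proj:
  assumes "smooth (\<lambda>z. h (\<pi> z))"
  shows "fun_diff \<Lambda> h (\<pi> z) v = dd v (\<lambda>z. h (\<pi> z)) z"
  using periodicD[OF dd_periodic[OF assms periodic_proj] rep_proj]
  by (simp add: fun_diff_def dd_def)

end

section \<open>Jacobians and exact densities\<close>

definition jac :: "(complex \<Rightarrow> complex) \<Rightarrow> complex \<Rightarrow> real" where
  "jac F z = wedge (dd 1 F z) (dd \<i> F z)"

lemma sigma_eq_wedge: "sigma v w = wedge (snd v) (snd w)"
  by (simp add: sigma_def flat_metric_def cstruct_def wedge_def)

lemma dd_expand:
  fixes F :: "complex \<Rightarrow> 'b::real_normed_vector"
  assumes "F differentiable at z"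
  shows "dd v F z = Re v *\<^sub>R dd 1 F z + Im v *\<^sub>R dd \<i> F z"
proof -
  interpret L: linear "\<lambda>v. dd v F z" by (rule linear_dd[OF assms])
  have "v = Re v *\<^sub>R 1 + Im v *\<^sub>R \<i>" by (simp add: complex_eq_iff)
  then have "dd v F z = dd (Re v *\<^sub>R 1 + Im v *\<^sub>R \<i>) F z" by simp
  then show ?thesis by (simp only: L.add L.scale)
qed

lemma wedge_dd:
  assumes "F differentiable at z"
  shows "wedge (dd u F z) (dd v F z) = jac F z * wedge u v"
  unfolding dd_expand[OF assms, of u] dd_expand[OF assms, of v] jac_def
  by (simp add: wedge_eq algebra_simps)

lemma smooth_on_jac: "smooth F \<Longrightarrow> smooth (jac F)"
  unfolding jac_def[abs_def] by (intro smooth_intros)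

lemma jac_compose:
  assumes "F differentiable at (\<Phi> z)" "\<Phi> differentiable at z"
  shows "jac (\<lambda>z. F (\<Phi> z)) z = jac F (\<Phi> z) * jac \<Phi> z"
  unfolding jac_def[of "\<lambda>z. F (\<Phi> z)"] dd_compose[OF assms(2,1)] wedge_dd[OF assms(1)]
  by (simp add: jac_def)

context lattice
begin

text \<open>The form \<open>h dx \<and> dy\<close> is the differential of \<open>A dx + B dy\<close>, with coefficients that descend to the torus.\<close>

definition exact_density :: "(complex \<Rightarrow> real) \<Rightarrow> bool" where
  "exact_density h \<longleftrightarrow> (\<exists>A B. smooth A \<and> periodic A \<and> smooth B \<and> periodic B \<and>
     (\<forall>z. h z = dd 1 B z - dd \<i> A z))"

lemma pullback_sigma_lift:
  assumes "smooth F" "is_lift f F"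
  shows "pullback_sigma \<Lambda> f (\<pi> z, u) (\<pi> z, v) = jac F z * wedge u v"
  unfolding pullback_sigma_def tangent_map_lift[OF assms] sigma_eq_wedge
  by (simp add: wedge_dd smooth_on_differentiable[OF assms(1)])

lemma sigma_quotient_lift:
  assumes "smooth F" "is_lift f F"
  shows "sigma_quotient \<Lambda> f (\<pi> z) = jac F z"
  unfolding sigma_quotient_def pullback_sigma_lift[OF assms] sigma_eq_wedge
proof (rule the_equality)
  fix H assume "\<forall>u v. jac F z * wedge u v = H * wedge (snd (\<pi> z, u)) (snd (\<pi> z, v))"
  from this[rule_format, of 1 \<i>] show "H = jac F z" by (simp add: wedge_eq)
qed simp

lemma symp_iff:
  assumes "f \<in> diffeos \<Lambda>" "smooth F" "is_lift f F"
  shows "f \<in> symp \<Lambda> \<longleftrightarrow> (\<forall>z. jac F z = 1)"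
proof
  assume "f \<in> symp \<Lambda>"
  then have "pullback_sigma \<Lambda> f (\<pi> z, 1) (\<pi> z, \<i>) = sigma (\<pi> z, 1) (\<pi> z, \<i>)" for z
    by (simp add: symp_def)
  then show "\<forall>z. jac F z = 1"
    by (simp add: pullback_sigma_lift[OF assms(2,3)] sigma_eq_wedge wedge_eq)
next
  assume 1: "\<forall>z. jac F z = 1"
  have "pullback_sigma \<Lambda> f (p, u) (p, v) = sigma (p, u) (p, v)" if "p \<in> torus \<Lambda>" for p u v
    using that 1 by (auto elim!: torus_cases simp: pullback_sigma_lift[OF assms(2,3)] sigma_eq_wedge)
  then show "f \<in> symp \<Lambda>" using assms(1) by (simp add: symp_def)
qed

text \<open>In the trivialisation by translations a one-form on the torus is a pair of periodic functions, its values
on \<open>1\<close> and \<open>\<i>\<close>.\<close>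

lemma diffeos_plus_iff:
  assumes f: "f \<in> diffeos \<Lambda>" and F: "smooth F" "is_lift f F"
  shows "f \<in> diffeos_plus \<Lambda> \<longleftrightarrow> exact_density (\<lambda>z. jac F z - 1)"
proof
  assume "f \<in> diffeos_plus \<Lambda>"
  then obtain \<alpha> where \<alpha>: "smooth_one_form \<Lambda> \<alpha>" and eq: "\<And>p u v. p \<in> torus \<Lambda> \<Longrightarrow>
      pullback_sigma \<Lambda> f (p, u) (p, v) - sigma (p, u) (p, v) = ext_deriv_one_form \<Lambda> \<alpha> p u v"
    by (auto simp: diffeos_plus_def)
  define A B where "A z = \<alpha> (\<pi> z, 1)" and "B z = \<alpha> (\<pi> z, \<i>)" for z
  have sm: "smooth A" "smooth B"
    using \<alpha> by (simp_all add: smooth_one_form_def A_def[abs_def] B_def[abs_def])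
  have "jac F z - 1 = dd 1 B z - dd \<i> A z" for z
    using eq[of "\<pi> z" 1 \<i>] sm
    by (simp add: pullback_sigma_lift[OF F] sigma_eq_wedge wedge_eq ext_deriv_one_form_def
        fun_diff_proj A_def[abs_def] B_def[abs_def])
  moreover have "periodic A" "periodic B"
    by (simp_all add: periodic_def A_def B_def proj_translate)
  ultimately show "exact_density (\<lambda>z. jac F z - 1)"
    unfolding exact_density_def using sm by blast
next
  assume "exact_density (\<lambda>z. jac F z - 1)"
  then obtain A B where AB: "smooth A" "periodic A" "smooth B" "periodic B"
    "\<And>z. jac F z - 1 = dd 1 B z - dd \<i> A z"
    unfolding exact_density_def by blast
  define \<alpha> where "\<alpha> v = Re (snd v) * A (rep (fst v)) + Im (snd v) * B (rep (fst v))" for v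
  have \<alpha>: "\<alpha> (\<pi> z, v) = Re v * A z + Im v * B z" for z v
    using periodicD[OF AB(2) rep_proj] periodicD[OF AB(4) rep_proj] by (simp add: \<alpha>_def)
  have sm: "smooth (\<lambda>z. Re v * A z + Im v * B z)" for v
    by (intro smooth_intros AB)
  have "linear (\<lambda>v. \<alpha> (p, v))" for p
    by (rule linearI) (simp_all add: \<alpha>_def algebra_simps)
  then have "smooth_one_form \<Lambda> \<alpha>"
    by (simp add: smooth_one_form_def \<alpha> sm)
  moreover have "pullback_sigma \<Lambda> f (p, u) (p, v) - sigma (p, u) (p, v) = ext_deriv_one_form \<Lambda> \<alpha> p u v"
    if "p \<in> torus \<Lambda>" for p u v
  proof -
    obtain z where z: "p = \<pi> z" using torus_cases \<open>p \<in> torus \<Lambda>\<close> .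
    have diff: "A differentiable at z" "B differentiable at z"
      by (rule smooth_differentiable, rule AB)+
    have d: "dd u (\<lambda>z. c * A z + d * B z) z = c * dd u A z + d * dd u B z" for c d u
      by (rule dd_eq) (auto intro!: derivative_eq_intros dd_has_derivative diff)
    have fd: "fun_diff \<Lambda> (\<lambda>q. \<alpha> (q, v)) p u = dd u (\<lambda>z. Re v * A z + Im v * B z) z" for u v
      unfolding z by (subst fun_diff_proj) (simp_all add: \<alpha> sm)
    have "ext_deriv_one_form \<Lambda> \<alpha> p u v = wedge u v * (dd 1 B z - dd \<i> A z)"
      unfolding ext_deriv_one_form_def fd d dd_expand[OF diff(1), of u] dd_expand[OF diff(1), of v]
        dd_expand[OF diff(2), of u] dd_expand[OF diff(2), of v]
      by (simp add: wedge_eq algebra_simps)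
    then show ?thesis
      unfolding AB(5)[symmetric] z pullback_sigma_lift[OF F] sigma_eq_wedge by (simp add: algebra_simps)
  qed
  ultimately show "f \<in> diffeos_plus \<Lambda>" using f by (auto simp: diffeos_plus_def)
qed

lemma exact_density_0: "exact_density (\<lambda>z. 0)"
  unfolding exact_density_def by (intro exI[of _ "\<lambda>z. 0"]) (auto simp: periodic_def)

lemma symp_subset: "symp \<Lambda> \<subseteq> diffeos_plus \<Lambda>"
proof
  fix f assume f: "f \<in> symp \<Lambda>"
  then have fd: "f \<in> diffeos \<Lambda>" by (simp add: symp_def)
  obtain F G where FG: "lift_pair F G" "is_lift f F" by (rule diffeo_lift[OF fd])
  then have F: "smooth F" by (simp add: lift_pair_def)
  have "\<forall>z. jac F z = 1" using f symp_iff[OF fd F FG(2)] by simp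
  then show "f \<in> diffeos_plus \<Lambda>"
    unfolding diffeos_plus_iff[OF fd F FG(2)] using exact_density_0 by simp
qed

lemma exact_density_add:
  assumes "exact_density h" "exact_density k"
  shows "exact_density (\<lambda>z. h z + k z)"
proof -
  obtain A B where AB: "smooth A" "periodic A" "smooth B" "periodic B"
    "\<And>z. h z = dd 1 B z - dd \<i> A z" using assms(1) unfolding exact_density_def by blast
  obtain C E where CE: "smooth C" "periodic C" "smooth E" "periodic E"
    "\<And>z. k z = dd 1 E z - dd \<i> C z" using assms(2) unfolding exact_density_def by blast
  have "h z + k z = dd 1 (\<lambda>z. B z + E z) z - dd \<i> (\<lambda>z. A z + C z) z" for z
  proof -
    have "A differentiable at z" "B differentiable at z" "C differentiable at z" "E differentiable at z"
      by (rule smooth_differentiable, rule AB CE)+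
    then show ?thesis by (simp add: dd_add AB(5) CE(5))
  qed
  moreover have "smooth (\<lambda>z. B z + E z)" "smooth (\<lambda>z. A z + C z)"
    by (intro smooth_on_add AB CE open_UNIV)+
  moreover have "periodic (\<lambda>z. B z + E z)" "periodic (\<lambda>z. A z + C z)"
    using AB CE by (simp_all add: periodic_def)
  ultimately show ?thesis unfolding exact_density_def by blast
qed

lemma periodic_compose: "periodic g \<Longrightarrow> equivariant \<Phi> \<Longrightarrow> periodic (\<lambda>z. g (\<Phi> z))"
  unfolding periodic_def[of "\<lambda>z. g (\<Phi> z)"] equivariant_def by (blast intro: periodicD)

text \<open>Pullback commutes with the exterior derivative: the primitive is the pullback of \<open>A dx + B dy\<close>, and the
second derivatives of \<open>\<Phi>\<close> cancel by symmetry.\<close>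

lemma exact_density_pullback:
  assumes h: "exact_density h" and \<Phi>: "smooth \<Phi>" "equivariant \<Phi>"
  shows "exact_density (\<lambda>z. h (\<Phi> z) * jac \<Phi> z)"
proof -
  obtain A B where AB: "smooth A" "periodic A" "smooth B" "periodic B"
    "\<And>z. h z = dd 1 B z - dd \<i> A z" using h unfolding exact_density_def by blast
  define P where "P v z = A (\<Phi> z) * Re (dd v \<Phi> z) + B (\<Phi> z) * Im (dd v \<Phi> z)" for v z
  have AB\<Phi>: "smooth (\<lambda>z. A (\<Phi> z))" "smooth (\<lambda>z. B (\<Phi> z))"
    by (rule smooth_on_compose[OF open_UNIV subset_UNIV \<Phi>(1)], rule AB)+
  have smP: "smooth (P v)" for v
    unfolding P_def[abs_def]
    by (intro smooth_intros \<Phi> AB\<Phi>)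
  have perP: "periodic (P v)" for v
    using periodic_compose[OF AB(2) \<Phi>(2)] periodic_compose[OF AB(4) \<Phi>(2)] dd_lift_periodic[OF \<Phi>, of v]
    by (simp add: P_def periodic_def)
  have "h (\<Phi> z) * jac \<Phi> z = dd 1 (P \<i>) z - dd \<i> (P 1) z" for z
  proof -
    have diff: "A differentiable at (\<Phi> z)" "B differentiable at (\<Phi> z)" "\<Phi> differentiable at z"
      "\<And>v. dd v \<Phi> differentiable at z"
      by (rule smooth_differentiable, intro AB \<Phi> smooth_on_dd)+
    note dA = has_derivative_compose[OF dd_has_derivative[OF diff(3)] dd_has_derivative[OF diff(1)]]
      and dB = has_derivative_compose[OF dd_has_derivative[OF diff(3)] dd_has_derivative[OF diff(2)]]
      and Re = bounded_linear.has_derivative[OF bounded_linear_Re dd_has_derivative[OF diff(4)]]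
      and Im = bounded_linear.has_derivative[OF bounded_linear_Im dd_has_derivative[OF diff(4)]]
    have dP: "dd u (P v) z = A (\<Phi> z) * Re (dd u (dd v \<Phi>) z) + dd (dd u \<Phi> z) A (\<Phi> z) * Re (dd v \<Phi> z)
       + (B (\<Phi> z) * Im (dd u (dd v \<Phi>) z) + dd (dd u \<Phi> z) B (\<Phi> z) * Im (dd v \<Phi> z))" for u v
      unfolding P_def[abs_def]
      by (rule dd_eq[OF has_derivative_add[OF has_derivative_mult[OF dA Re] has_derivative_mult[OF dB Im]]])
    show ?thesis
      unfolding dP dd_commute[OF open_UNIV \<Phi>(1) UNIV_I, of \<i> 1] AB(5) jac_def
        dd_expand[OF diff(1), of "dd _ \<Phi> z"] dd_expand[OF diff(2), of "dd _ \<Phi> z"]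
      by (simp add: wedge_eq algebra_simps)
  qed
  then show ?thesis unfolding exact_density_def using smP perP by blast
qed

text \<open>On \<open>\<complex>\<close> the pullback \<open>F\<^sup>*\<sigma>\<close> has the primitive \<open>wedge F (dF) / 2\<close>, which is not periodic.  For the
difference of \<open>F + w\<close> and \<open>F\<close> there is a primitive in which \<open>F\<close> enters through \<open>dF\<close> only, namely
\<open>wedge w (dF) + wedge w (dw) / 2\<close>.\<close>

lemma exact_density_jac_perturb:
  assumes F: "smooth F" "equivariant F" and w: "smooth w" "periodic w"
  shows "exact_density (\<lambda>z. jac (\<lambda>z. F z + w z) z - jac F z)"
proof -
  define P where "P v z = wedge (w z) (dd v F z) + wedge (w z) (dd v w z) * (1/2)" for v z
  have smP: "smooth (P v)" for v
    unfolding P_def[abs_def]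
    by (intro smooth_intros F w)
  have perP: "periodic (P v)" for v
    using dd_lift_periodic[OF F, of v] w(2) dd_periodic[OF w, of v]
    by (simp add: P_def periodic_def)
  have "jac (\<lambda>z. F z + w z) z - jac F z = dd 1 (P \<i>) z - dd \<i> (P 1) z" for z
  proof -
    have diff: "F differentiable at z" "w differentiable at z"
      "\<And>v. dd v F differentiable at z" "\<And>v. dd v w differentiable at z"
      by (rule smooth_differentiable, intro w F smooth_on_dd)+
    note W = bounded_bilinear.FDERIV[OF bounded_bilinear_wedge dd_has_derivative[OF diff(2)] dd_has_derivative]
    have dP: "dd u (P v) z = wedge (w z) (dd u (dd v F) z) + wedge (dd u w z) (dd v F z)
       + (wedge (w z) (dd u (dd v w) z) + wedge (dd u w z) (dd v w z)) * (1/2)" for u v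
      unfolding P_def[abs_def]
      by (rule dd_eq[OF has_derivative_add[OF W[OF diff(3)] has_derivative_mult_left[OF W[OF diff(4)]]]])
    show ?thesis
      unfolding dP dd_commute[OF open_UNIV F(1) UNIV_I, of \<i> 1] dd_commute[OF open_UNIV w(1) UNIV_I, of \<i> 1]
        jac_def dd_add[OF diff(1,2)]
      by (simp add: wedge_eq algebra_simps)
  qed
  then show ?thesis unfolding exact_density_def using smP perP by blast
qed

end

section \<open>Integration over a cell\<close>

text \<open>Uniform continuity on the product of \<open>K\<close> with a compact interval around \<open>t0\<close>.\<close>

lemma uniform_in_parameter:
  fixes g :: "real \<times> complex \<Rightarrow> 'b::metric_space"
  assumes "continuous_on (S \<times> UNIV) g" "open S" "t0 \<in> S" "compact K" "e > 0"
  obtains d where "d > 0" "\<And>t. \<bar>t - t0\<bar> < d \<Longrightarrow> t \<in> S"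
    "\<And>t z. \<bar>t - t0\<bar> < d \<Longrightarrow> z \<in> K \<Longrightarrow> dist (g (t, z)) (g (t0, z)) < e"
proof -
  obtain r where r: "r > 0" "cball t0 r \<subseteq> S"
    using assms(2,3) open_contains_cball by blast
  have "uniformly_continuous_on (cball t0 r \<times> K) g"
  proof (rule compact_uniformly_continuous)
    show "continuous_on (cball t0 r \<times> K) g"
      by (rule continuous_on_subset[OF assms(1)]) (use r in auto)
    show "compact (cball t0 r \<times> K)" by (intro compact_Times compact_cball assms)
  qed
  then obtain d where d: "d > 0" "\<And>x x'. x \<in> cball t0 r \<times> K \<Longrightarrow> x' \<in> cball t0 r \<times> K \<Longrightarrow> dist x' x < d \<Longrightarrow> dist (g x') (g x) < e"
    by (rule uniformly_continuous_onE[OF _ assms(5)]) blast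
  show ?thesis
  proof
    show "min d r > 0" using d r by simp
    show "t \<in> S" if "\<bar>t - t0\<bar> < min d r" for t
      using that r(2) by (auto simp: subset_iff dist_real_def abs_minus_commute)
    show "dist (g (t, z)) (g (t0, z)) < e" if "\<bar>t - t0\<bar> < min d r" "z \<in> K" for t z
    proof (rule d(2))
      show "(t0, z) \<in> cball t0 r \<times> K" using that r by simp
      show "(t, z) \<in> cball t0 r \<times> K" using that by (simp add: dist_real_def abs_minus_commute)
      show "dist (t, z) (t0, z) < d" using that by (simp add: dist_Pair_Pair dist_real_def)
    qed
  qed
qed

lemma continuous_on_slice:
  "continuous_on (S \<times> UNIV) g \<Longrightarrow> t \<in> S \<Longrightarrow> continuous_on UNIV (\<lambda>z::complex. g (t, z))"
  by (rule continuous_on_compose2[where f="\<lambda>z. (t, z)"]) (auto intro!: continuous_intros)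

lemma dd_slice:
  fixes g :: "real \<times> complex \<Rightarrow> 'b::real_normed_vector"
  assumes "g differentiable at (t, z)"
  shows "((\<lambda>s. g (s, z)) has_vector_derivative dd (1, 0) g (t, z)) (at t)"
    and "((\<lambda>w. g (t, w)) has_derivative (\<lambda>v. dd (0, v) g (t, z))) (at z)"
proof -
  have der: "((\<lambda>s. g (s, z)) has_derivative (\<lambda>h. dd (h, 0) g (t, z))) (at t)"
    by (rule has_derivative_compose[where f="\<lambda>s. (s, z)" and g=g, OF _ dd_has_derivative[OF assms]])
      (auto intro!: derivative_eq_intros)
  have eq: "(\<lambda>h. dd (h, 0) g (t, z)) = (\<lambda>h. h *\<^sub>R dd (1, 0) g (t, z))"
  proof
    show "dd (h, 0) g (t, z) = h *\<^sub>R dd (1, 0) g (t, z)" for h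
      using linear_scale[OF linear_dd[OF assms], of h "(1, 0)"] by simp
  qed
  show "((\<lambda>s. g (s, z)) has_vector_derivative dd (1, 0) g (t, z)) (at t)"
    unfolding has_vector_derivative_def using der[unfolded eq] .
  show "((\<lambda>w. g (t, w)) has_derivative (\<lambda>v. dd (0, v) g (t, z))) (at z)"
    by (rule has_derivative_compose[where f="\<lambda>w. (t, w)" and g=g, OF _ dd_has_derivative[OF assms]])
      (auto intro!: derivative_eq_intros)
qed

context lattice
begin

definition cell :: "complex set" where "cell = {z. 0 \<le> coord1 z \<and> coord1 z < 1 \<and> 0 \<le> coord2 z \<and> coord2 z < 1}"

definition closed_cell :: "complex set" where
  "closed_cell = (\<lambda>(s, t). s *\<^sub>R a + t *\<^sub>R b) ` ({0..1} \<times> {0..1})"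

definition cell_integral :: "(complex \<Rightarrow> real) \<Rightarrow> real" where
  "cell_integral g = (LINT z:cell|lborel. g z)"

lemma fund_domain_eq: "fund_domain \<Lambda> = cell"
proof -
  have "fund_domain \<Lambda> = {s *\<^sub>R a + t *\<^sub>R b | s t. 0 \<le> s \<and> s < 1 \<and> 0 \<le> t \<and> t < 1}"
    by (simp add: fund_domain_def chosen)
  also have "\<dots> = cell"
  proof (intro set_eqI iffI)
    fix z assume "z \<in> cell"
    then show "z \<in> {s *\<^sub>R a + t *\<^sub>R b | s t. 0 \<le> s \<and> s < 1 \<and> 0 \<le> t \<and> t < 1}"
      using coords[of z] unfolding cell_def by (intro CollectI exI[of _ "coord1 z"] exI[of _ "coord2 z"]) auto
  qed (auto simp: cell_def coords_unique)
  finally show ?thesis .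
qed

lemma torus_integral_eq: "torus_integral \<Lambda> h = cell_integral (\<lambda>z. h (\<pi> z))"
  by (simp add: torus_integral_def cell_integral_def fund_domain_eq)

lemma borel_coords [measurable]: "coord1 \<in> borel_measurable borel" "coord2 \<in> borel_measurable borel"
  by (intro borel_measurable_continuous_onI continuous_coords)+

lemma cell_borel [measurable, simp]: "cell \<in> sets borel"
  unfolding cell_def by measurable

lemma compact_closed_cell: "compact closed_cell"
  unfolding closed_cell_def
  by (intro compact_continuous_image compact_Times compact_Icc)
    (auto simp: case_prod_unfold intro!: continuous_intros)

lemma cell_subset: "cell \<subseteq> closed_cell"
proof
  fix z assume "z \<in> cell"
  then show "z \<in> closed_cell" unfolding closed_cell_def cell_def
    by (intro image_eqI[where x="(coord1 z, coord2 z)"]) (auto simp: coords)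
qed

lemma cell_representative: "\<exists>!l. l \<in> \<Lambda> \<and> z + l \<in> cell"
proof (rule ex1I)
  define l where "l = (- of_int \<lfloor>coord1 z\<rfloor>) *\<^sub>R a + (- of_int \<lfloor>coord2 z\<rfloor>) *\<^sub>R b"
  have l: "coord1 l = - of_int \<lfloor>coord1 z\<rfloor>" "coord2 l = - of_int \<lfloor>coord2 z\<rfloor>" unfolding l_def coords_unique by auto
  have "l \<in> \<Lambda>" by (simp add: mem_lattice_iff l)
  moreover have "z + l \<in> cell"
    unfolding cell_def mem_Collect_eq coords_add l by linarith
  ultimately show "l \<in> \<Lambda> \<and> z + l \<in> cell" ..
  fix k assume k: "k \<in> \<Lambda> \<and> z + k \<in> cell"
  then obtain m n where mn: "coord1 k = of_int m" "coord2 k = of_int n"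
    using mem_lattice_iff by (auto elim!: Ints_cases)
  have "m = - \<lfloor>coord1 z\<rfloor>" "n = - \<lfloor>coord2 z\<rfloor>"
    using k unfolding cell_def mem_Collect_eq coords_add mn by linarith+
  then have "coord1 k = coord1 l" "coord2 k = coord2 l" using l mn by simp_all
  then show "k = l" by (metis coords)
qed

lemma closed_cell_representative: obtains l where "l \<in> \<Lambda>" "z + l \<in> closed_cell"
  using cell_representative cell_subset by blast

lemma emeasure_cell: "emeasure lborel cell \<noteq> \<infinity>"
proof -
  have "bounded cell" using compact_imp_bounded[OF compact_closed_cell] cell_subset bounded_subset by blast
  then show ?thesis using emeasure_bounded_finite by (metis infinity_ennreal_def less_irrefl)
qed

lemma cell_integrable: "continuous_on UNIV g \<Longrightarrow> set_integrable lborel cell (g :: complex \<Rightarrow> real)"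
proof (rule set_integrable_subset[OF _ _ cell_subset])
  assume "continuous_on UNIV g"
  then show "set_integrable lborel closed_cell g"
    unfolding set_integrable_def
    by (intro borel_integrable_compact compact_closed_cell) (rule continuous_on_subset[OF _ subset_UNIV])
qed simp

lemma cell_integral_add:
  "continuous_on UNIV g \<Longrightarrow> continuous_on UNIV h \<Longrightarrow>
    cell_integral (\<lambda>z. g z + h z) = cell_integral g + cell_integral h"
  unfolding cell_integral_def by (intro set_integral_add cell_integrable)

lemma cell_integral_diff:
  "continuous_on UNIV g \<Longrightarrow> continuous_on UNIV h \<Longrightarrow>
    cell_integral (\<lambda>z. g z - h z) = cell_integral g - cell_integral h"
  unfolding cell_integral_def by (intro set_integral_diff cell_integrable)

lemma cell_integral_cmult: "cell_integral (\<lambda>z. c * g z) = c * cell_integral g"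
  unfolding cell_integral_def by simp

lemma cell_integral_bound:
  assumes "continuous_on UNIV g" "\<And>z. z \<in> closed_cell \<Longrightarrow> \<bar>g z\<bar> \<le> c"
  shows "\<bar>cell_integral g\<bar> \<le> measure lborel cell * c"
proof -
  have const: "(LINT z:cell|lborel. k) = measure lborel cell * k" for k :: real
    using set_integral_const[of cell lborel k] emeasure_cell by simp
  have ab: "g z \<le> c" "- c \<le> g z" if "z \<in> cell" for z
    using assms(2)[of z] that cell_subset by auto
  have "(LINT z:cell|lborel. g z) \<le> (LINT z:cell|lborel. c)" "(LINT z:cell|lborel. - c) \<le> (LINT z:cell|lborel. g z)"
    by (intro set_integral_mono cell_integrable assms(1) continuous_on_const ab; assumption)+
  then show ?thesis unfolding cell_integral_def const by auto
qed

lemma countable_lattice: "countable \<Lambda>"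
proof -
  have "\<Lambda> = (\<lambda>(m, n). of_int m * a + of_int n * b) ` (UNIV :: (int \<times> int) set)"
    unfolding lattice_eq by auto
  then show ?thesis by simp
qed

lemma nn_integral_translate:
  fixes f :: "complex \<Rightarrow> ennreal"
  assumes [measurable]: "f \<in> borel_measurable borel"
  shows "(\<integral>\<^sup>+z. f (z + c) \<partial>lborel) = (\<integral>\<^sup>+z. f z \<partial>lborel)"
proof -
  have "(\<integral>\<^sup>+z. f z \<partial>lborel) = (\<integral>\<^sup>+z. f z \<partial>distr lborel borel ((+) c))"
    by (simp add: lborel_distr_plus)
  also have "\<dots> = (\<integral>\<^sup>+z. f (c + z) \<partial>lborel)"
    by (subst nn_integral_distr) simp_all
  finally show ?thesis by (simp add: add.commute)
qed

text \<open>\<open>E\<close> is cut into its intersections with the lattice translates of the cell; moved back by the lattice,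
these pieces fill the cell.\<close>

lemma nn_integral_fundamental_domain:
  fixes g :: "complex \<Rightarrow> ennreal"
  assumes [measurable]: "g \<in> borel_measurable borel" "E \<in> sets borel"
    and per: "periodic g" and E: "\<And>z. \<exists>!l. l \<in> \<Lambda> \<and> z + l \<in> E"
  shows "(\<integral>\<^sup>+z. indicator E z * g z \<partial>lborel) = (\<integral>\<^sup>+z. indicator cell z * g z \<partial>lborel)"
proof -
  have one: "(\<integral>\<^sup>+l. indicator D (z + l) \<partial>count_space \<Lambda>) = 1"
    if D: "\<And>z. \<exists>!l. l \<in> \<Lambda> \<and> z + l \<in> D" for D :: "complex set" and z
  proof -
    obtain l0 where l0: "l0 \<in> \<Lambda>" "z + l0 \<in> D" "\<And>l. l \<in> \<Lambda> \<Longrightarrow> z + l \<in> D \<Longrightarrow> l = l0"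
      by (rule ex1E[OF D[of z]]) blast
    have "(\<integral>\<^sup>+l. indicator D (z + l) \<partial>count_space \<Lambda>) = (\<integral>\<^sup>+l. indicator {l0} l \<partial>count_space \<Lambda>)"
    proof (rule nn_integral_cong)
      fix l assume "l \<in> space (count_space \<Lambda>)"
      then have l: "l \<in> \<Lambda>" by simp
      have "z + l \<in> D \<longleftrightarrow> l = l0"
      proof
        show "z + l \<in> D \<Longrightarrow> l = l0" by (rule l0(3)[OF l])
        show "l = l0 \<Longrightarrow> z + l \<in> D" using l0(2) by blast
      qed
      then show "indicator D (z + l) = (indicator {l0} l :: ennreal)" by (simp add: indicator_def)
    qed
    also have "\<dots> = 1" using l0(1) by simp
    finally show ?thesis .
  qed
  \<comment> \<open>The substitution \<open>l \<mapsto> - l\<close> permutes the lattice.\<close>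
  have one': "(\<integral>\<^sup>+l. indicator cell (z - l) \<partial>count_space \<Lambda>) = 1" for z
  proof -
    have bij: "bij_betw uminus \<Lambda> \<Lambda>"
      by (rule bij_betwI[where g=uminus]) (auto simp: lattice_minus)
    have "(\<integral>\<^sup>+l. indicator cell (z - l) \<partial>count_space \<Lambda>) = (\<integral>\<^sup>+l. indicator cell (z + l) \<partial>count_space \<Lambda>)"
      using nn_integral_bij_count_space[OF bij, of "\<lambda>l. indicator cell (z + l)"] by simp
    then show ?thesis using one[OF cell_representative] by simp
  qed
  have "(\<integral>\<^sup>+z. indicator E z * g z \<partial>lborel)
      = (\<integral>\<^sup>+z. (\<integral>\<^sup>+l. indicator E z * g z * indicator cell (z - l) \<partial>count_space \<Lambda>) \<partial>lborel)"
    by (simp add: nn_integral_cmult one')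
  also have "\<dots> = (\<integral>\<^sup>+l. (\<integral>\<^sup>+z. indicator E z * g z * indicator cell (z - l) \<partial>lborel) \<partial>count_space \<Lambda>)"
    by (rule nn_integral_count_space_nn_integral[OF countable_lattice]) measurable
  also have "\<dots> = (\<integral>\<^sup>+l. (\<integral>\<^sup>+z. indicator cell z * g z * indicator E (z + l) \<partial>lborel) \<partial>count_space \<Lambda>)"
  proof (rule nn_integral_cong)
    fix l assume "l \<in> space (count_space \<Lambda>)"
    then have l: "l \<in> \<Lambda>" by simp
    have "(\<integral>\<^sup>+z. indicator E z * g z * indicator cell (z - l) \<partial>lborel)
        = (\<integral>\<^sup>+z. indicator E (z + l) * g (z + l) * indicator cell (z + l - l) \<partial>lborel)"
      by (rule nn_integral_translate[symmetric, where f="\<lambda>z. indicator E z * g z * indicator cell (z - l)"]) measurable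
    also have "\<dots> = (\<integral>\<^sup>+z. indicator cell z * g z * indicator E (z + l) \<partial>lborel)"
      using per l by (simp add: periodic_def mult_ac)
    finally show "(\<integral>\<^sup>+z. indicator E z * g z * indicator cell (z - l) \<partial>lborel)
        = (\<integral>\<^sup>+z. indicator cell z * g z * indicator E (z + l) \<partial>lborel)" .
  qed
  also have "\<dots> = (\<integral>\<^sup>+z. (\<integral>\<^sup>+l. indicator cell z * g z * indicator E (z + l) \<partial>count_space \<Lambda>) \<partial>lborel)"
    by (rule nn_integral_count_space_nn_integral[OF countable_lattice, symmetric]) measurable
  also have "\<dots> = (\<integral>\<^sup>+z. indicator cell z * g z \<partial>lborel)"
    by (simp add: nn_integral_cmult one[OF E])
  finally show ?thesis .
qed

lemma nn_integral_cell_translate: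
  fixes g :: "complex \<Rightarrow> ennreal"
  assumes [measurable]: "g \<in> borel_measurable borel" and per: "periodic g"
  shows "(\<integral>\<^sup>+z. indicator cell z * g (z + c) \<partial>lborel) = (\<integral>\<^sup>+z. indicator cell z * g z \<partial>lborel)"
proof -
  define E where "E = {z. z - c \<in> cell}"
  have [measurable]: "E \<in> sets borel" unfolding E_def by measurable
  have "(\<integral>\<^sup>+z. indicator cell z * g (z + c) \<partial>lborel) = (\<integral>\<^sup>+z. indicator E (z + c) * g (z + c) \<partial>lborel)"
    by (simp add: E_def indicator_def)
  also have "\<dots> = (\<integral>\<^sup>+z. indicator E z * g z \<partial>lborel)"
    by (rule nn_integral_translate[where f="\<lambda>z. indicator E z * g z"]) measurable
  also have "\<dots> = (\<integral>\<^sup>+z. indicator cell z * g z \<partial>lborel)"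
  proof (rule nn_integral_fundamental_domain)
    show "\<exists>!l. l \<in> \<Lambda> \<and> z + l \<in> E" for z
      using cell_representative[of "z - c"] by (simp add: E_def algebra_simps)
  qed (use per in measurable)
  finally show ?thesis .
qed

lemma cell_integral_translate:
  assumes "continuous_on UNIV g" "periodic g"
  shows "cell_integral (\<lambda>z. g (z + c)) = cell_integral g"
proof -
  have cont: "continuous_on UNIV (\<lambda>z. g (z + c))"
    by (rule continuous_on_compose2[OF assms(1)]) (auto intro!: continuous_intros)
  have eq: "cell_integral h = enn2real (\<integral>\<^sup>+z. indicator cell z * ennreal (h z) \<partial>lborel)
     - enn2real (\<integral>\<^sup>+z. indicator cell z * ennreal (- h z) \<partial>lborel)" if "continuous_on UNIV h" for h
  proof -
    have "ennreal (indicator cell z *\<^sub>R h z) = indicator cell z * ennreal (h z)"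
      "ennreal (- (indicator cell z *\<^sub>R h z)) = indicator cell z * ennreal (- h z)" for z
      by (simp_all add: indicator_def)
    then show ?thesis
      using cell_integrable[OF that] unfolding cell_integral_def set_lebesgue_integral_def set_integrable_def
      by (subst real_lebesgue_integral_def) simp_all
  qed
  have [measurable]: "g \<in> borel_measurable borel"
    using assms(1) by (rule borel_measurable_continuous_onI)
  have "(\<integral>\<^sup>+z. indicator cell z * ennreal (g (z + c)) \<partial>lborel) = (\<integral>\<^sup>+z. indicator cell z * ennreal (g z) \<partial>lborel)"
    using assms(2) by (intro nn_integral_cell_translate[where g="\<lambda>z. ennreal (g z)"]) (simp_all add: periodic_def)
  moreover have "(\<integral>\<^sup>+z. indicator cell z * ennreal (- g (z + c)) \<partial>lborel) = (\<integral>\<^sup>+z. indicator cell z * ennreal (- g z) \<partial>lborel)"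
    using assms(2) by (intro nn_integral_cell_translate[where g="\<lambda>z. ennreal (- g z)"]) (simp_all add: periodic_def)
  ultimately show ?thesis by (simp add: eq[OF cont] eq[OF assms(1)])
qed

text \<open>A point \<open>z\<close> where \<open>g\<close> is positive is translated to the centre \<open>m\<close> of the cell, around which a whole open
set lies in the cell.\<close>

lemma cell_integral_eq_0:
  assumes g: "continuous_on UNIV g" "periodic g" "\<And>z. g z \<ge> 0" and 0: "cell_integral g = 0"
  shows "g z = 0"
proof (rule ccontr)
  assume "g z \<noteq> 0"
  define m where "m = (1/2) *\<^sub>R a + (1/2) *\<^sub>R b"
  define h where "h w = g (w + (z - m))" for w
  have cont: "continuous_on UNIV h" unfolding h_def
    by (rule continuous_on_compose2[OF g(1)]) (auto intro!: continuous_intros)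
  have "cell_integral h = 0"
    unfolding h_def using cell_integral_translate[OF g(1,2)] 0 by simp
  then have "AE w in lborel. indicator cell w *\<^sub>R h w = 0"
    using cell_integrable[OF cont] g(3) unfolding cell_integral_def set_lebesgue_integral_def set_integrable_def
    by (subst (asm) integral_nonneg_eq_0_iff_AE) (simp_all add: h_def)
  then have ae: "AE w in lborel. w \<notin> U" if "\<And>w. w \<in> U \<Longrightarrow> w \<in> cell \<and> h w \<noteq> 0" for U
    by eventually_elim (use that in auto)
  define U where "U = {w. 0 < coord1 w} \<inter> {w. coord1 w < 1} \<inter> {w. 0 < coord2 w} \<inter> {w. coord2 w < 1} \<inter> {w. 0 < h w}"
  have "open U" unfolding U_def
    by (intro open_Int open_Collect_less continuous_coords continuous_on_const cont)
  have "AE w in lborel. w \<notin> U" by (rule ae) (auto simp: U_def cell_def)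
  then have "U \<in> null_sets lborel" using \<open>open U\<close> by (simp add: AE_iff_null_sets)
  then have "negligible U"
    unfolding negligible_iff_null_sets by (rule null_sets_completionI)
  moreover have "m \<in> U"
    using g(3)[of z] \<open>g z \<noteq> 0\<close> unfolding U_def m_def[symmetric]
    by (simp add: h_def m_def coords_unique)
  ultimately show False using open_not_negligible[OF \<open>open U\<close>] by blast
qed

text \<open>The difference quotients converge uniformly on the compact closed cell, by the mean value theorem and the
uniform continuity of the time derivative.\<close>

lemma cell_integral_derivative:
  fixes g :: "real \<times> complex \<Rightarrow> real"
  assumes "open S" "smooth_on (S \<times> UNIV) g" "t0 \<in> S"
  shows "((\<lambda>t. cell_integral (\<lambda>z. g (t, z))) has_real_derivative cell_integral (\<lambda>z. dd (1, 0) g (t0, z))) (at t0)"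
  unfolding has_field_derivative_def has_derivative_at_alt
proof (intro conjI allI impI)
  show "bounded_linear ((*) (cell_integral (\<lambda>z. dd (1, 0) g (t0, z))))"
    by (rule bounded_linear_mult_right)
  fix e :: real assume e: "e > 0"
  define m where "m = measure lborel cell"
  have m: "m \<ge> 0" by (simp add: m_def)
  \<comment> \<open>The summand \<open>1\<close> only excludes a division by zero.\<close>
  define e' where "e' = e / (m + 1)"
  have e': "e' > 0" "m * e' \<le> e" using e m by (simp_all add: e'_def field_simps)
  let ?g' = "dd (1, 0) g"
  have cont: "continuous_on (S \<times> UNIV) g" "continuous_on (S \<times> UNIV) ?g'"
    using assms(2) by (auto intro: smooth_on_continuous_on smooth_on_dd)
  obtain d where d: "d > 0" "\<And>t. \<bar>t - t0\<bar> < d \<Longrightarrow> t \<in> S"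
    "\<And>t z. \<bar>t - t0\<bar> < d \<Longrightarrow> z \<in> closed_cell \<Longrightarrow> dist (?g' (t, z)) (?g' (t0, z)) < e'"
    by (rule uniform_in_parameter[OF cont(2) assms(1,3) compact_closed_cell e'(1)]) blast
  have "\<bar>cell_integral (\<lambda>z. g (t, z)) - cell_integral (\<lambda>z. g (t0, z)) - cell_integral (\<lambda>z. ?g' (t0, z)) * (t - t0)\<bar>
      \<le> e * \<bar>t - t0\<bar>" if t: "\<bar>t - t0\<bar> < d" for t
  proof -
    have c: "continuous_on UNIV (\<lambda>z. g (t, z))" "continuous_on UNIV (\<lambda>z. g (t0, z))" "continuous_on UNIV (\<lambda>z. ?g' (t0, z))"
      using continuous_on_slice[OF cont(1)] continuous_on_slice[OF cont(2)] d(2)[OF t] assms(3) by blast+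
    have cc: "continuous_on UNIV (\<lambda>z. g (t, z) - g (t0, z))" "continuous_on UNIV (\<lambda>z. (t - t0) * ?g' (t0, z))"
      by (intro continuous_intros c)+
    have "\<bar>g (t, z) - g (t0, z) - (t - t0) * ?g' (t0, z)\<bar> \<le> e' * \<bar>t - t0\<bar>" if z: "z \<in> closed_cell" for z
    proof -
      define \<phi> where "\<phi> s = g (s, z) - s * ?g' (t0, z)" for s
      have "norm (\<phi> t - \<phi> t0) \<le> e' * norm (t - t0)"
      proof (rule field_differentiable_bound)
        show "convex (ball t0 d)" by simp
        fix s assume "s \<in> ball t0 d"
        then have s: "\<bar>s - t0\<bar> < d" by (simp add: dist_real_def abs_minus_commute)
        then have "g differentiable at (s, z)"
          using smooth_on_differentiable[OF assms(2)] d(2) by auto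
        then have "((\<lambda>s. g (s, z)) has_real_derivative ?g' (s, z)) (at s)"
          using dd_slice(1) by (simp add: has_real_derivative_iff_has_vector_derivative)
        then have "(\<phi> has_real_derivative ?g' (s, z) - ?g' (t0, z)) (at s)"
          unfolding \<phi>_def by (auto intro!: derivative_eq_intros)
        then show "(\<phi> has_real_derivative ?g' (s, z) - ?g' (t0, z)) (at s within ball t0 d)"
          by (rule has_field_derivative_at_within)
        show "norm (?g' (s, z) - ?g' (t0, z)) \<le> e'"
          using d(3)[OF s z] by (simp add: dist_norm)
      qed (use t d(1) in \<open>auto simp: dist_real_def abs_minus_commute\<close>)
      then show ?thesis by (simp add: \<phi>_def algebra_simps)
    qed
    then have "\<bar>cell_integral (\<lambda>z. g (t, z) - g (t0, z) - (t - t0) * ?g' (t0, z))\<bar> \<le> m * (e' * \<bar>t - t0\<bar>)"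
      unfolding m_def by (intro cell_integral_bound continuous_on_diff cc)
    also have "\<dots> \<le> e * \<bar>t - t0\<bar>"
      using mult_right_mono[OF e'(2), of "\<bar>t - t0\<bar>"] by (simp add: mult_ac)
    finally show ?thesis
      unfolding cell_integral_diff[OF cc] cell_integral_diff[OF c(1,2)] cell_integral_cmult by (simp add: mult.commute)
  qed
  then show "\<exists>d>0. \<forall>t. norm (t - t0) < d \<longrightarrow> norm (cell_integral (\<lambda>z. g (t, z)) - cell_integral (\<lambda>z. g (t0, z))
      - cell_integral (\<lambda>z. ?g' (t0, z)) * (t - t0)) \<le> e * norm (t - t0)"
    using d(1) by (intro exI[of _ d]) simp
qed

lemma smooth_on_cell_integral:
  fixes g :: "real \<times> complex \<Rightarrow> real"
  assumes "open S" "smooth_on (S \<times> UNIV) g"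
  shows "smooth_on S (\<lambda>t. cell_integral (\<lambda>z. g (t, z)))"
proof -
  have "smooth_upto k S (\<lambda>t. cell_integral (\<lambda>z. g (t, z)))" for k
    using assms(2)
  proof (induction k arbitrary: g)
    case (Suc k)
    note der = cell_integral_derivative[OF assms(1) Suc.prems, unfolded has_field_derivative_def]
    have "smooth_upto k S (dd v (\<lambda>t. cell_integral (\<lambda>z. g (t, z))))" for v
    proof (subst smooth_upto_cong[OF assms(1)])
      show "dd v (\<lambda>t. cell_integral (\<lambda>z. g (t, z))) t = cell_integral (\<lambda>z. dd (1, 0) g (t, z)) * v" if "t \<in> S" for t
        by (rule dd_eq[OF der[OF that]])
      show "smooth_upto k S (\<lambda>t. cell_integral (\<lambda>z. dd (1, 0) g (t, z)) * v)"
        by (intro smooth_upto_bilinear[OF _ bounded_bilinear_mult] assms(1) smooth_upto_const Suc.IH smooth_on_dd Suc.prems)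
    qed
    moreover have "(\<lambda>t. cell_integral (\<lambda>z. g (t, z))) differentiable at t" if "t \<in> S" for t
      by (rule differentiableI[OF der[OF that]])
    ultimately show ?case by simp
  qed simp
  then show ?thesis by (simp add: smooth_on_eq_smooth_upto)
qed

text \<open>The translates of \<open>g\<close> along \<open>v\<close> all have the same integral; differentiating in the parameter gives zero.\<close>

lemma cell_integral_dd:
  assumes "smooth g" "periodic g"
  shows "cell_integral (dd v g) = 0"
proof -
  define L :: "real \<times> complex \<Rightarrow> complex" where "L p = snd p + fst p *\<^sub>R v" for p
  have L: "bounded_linear L" unfolding L_def[abs_def]
    by (intro bounded_linear_add bounded_linear_snd bounded_linear_scaleR_const bounded_linear_fst)
  have sm: "smooth_on (UNIV \<times> UNIV) (\<lambda>p. g (L p))"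
    by (rule smooth_on_compose[OF _ subset_UNIV smooth_on_bounded_linear[OF L] assms(1)]) simp
  have "dd (1, 0) (\<lambda>p. g (L p)) (0, z) = dd v g z" for z
    using dd_compose[of L "(0, z)" g "(1, 0)"] bounded_linear_imp_differentiable[OF L]
      smooth_on_differentiable[OF assms(1)] dd_bounded_linear[OF L] by (simp add: L_def)
  then have "((\<lambda>t. cell_integral (\<lambda>z. g (L (t, z)))) has_real_derivative cell_integral (dd v g)) (at 0)"
    using cell_integral_derivative[OF open_UNIV sm, of 0] by simp
  moreover have "cell_integral (\<lambda>z. g (L (t, z))) = cell_integral g" for t
    using cell_integral_translate[OF smooth_on_continuous_on[OF assms(1)] assms(2)] by (simp add: L_def)
  ultimately have "((\<lambda>t::real. cell_integral g) has_real_derivative cell_integral (dd v g)) (at 0)" by simp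
  then show ?thesis using DERIV_const DERIV_unique by blast
qed

lemma cell_integral_exact: "exact_density h \<Longrightarrow> cell_integral h = 0"
proof -
  assume "exact_density h"
  then obtain A B where AB: "smooth A" "periodic A" "smooth B" "periodic B"
    "\<And>z. h z = dd 1 B z - dd \<i> A z" unfolding exact_density_def by blast
  have "cell_integral (\<lambda>z. dd 1 B z - dd \<i> A z) = 0"
    using cell_integral_dd[OF AB(1,2)] cell_integral_dd[OF AB(3,4)]
    by (subst cell_integral_diff) (auto intro!: smooth_on_continuous_on smooth_on_dd AB)
  then show ?thesis using AB(5) by presburger
qed

end

section \<open>Variation of the Jacobian\<close>

lemma smooth_on_slice:
  fixes g :: "real \<times> complex \<Rightarrow> 'b::real_normed_vector"
  assumes "smooth_on (S \<times> UNIV) g" "t \<in> S"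
  shows "smooth (\<lambda>z. g (t, z))"
  by (rule smooth_on_compose[where F="\<lambda>z. (t, z)", OF open_UNIV _ smooth_on_Pair[OF open_UNIV smooth_on_const smooth_on_ident] assms(1)])
    (use assms(2) in auto)

lemma dd_space_slice:
  fixes g :: "real \<times> complex \<Rightarrow> 'b::real_normed_vector"
  assumes "smooth_on (S \<times> UNIV) g" "t \<in> S"
  shows "dd v (\<lambda>z. g (t, z)) = (\<lambda>z. dd (0, v) g (t, z))"
proof
  fix z
  have "g differentiable at (t, z)" using smooth_on_differentiable[OF assms(1)] assms(2) by simp
  then show "dd v (\<lambda>z. g (t, z)) z = dd (0, v) g (t, z)" by (rule dd_eq[OF dd_slice(2)])
qed

text \<open>The derivative at \<open>F\<close> in direction \<open>W\<close> of the quadratic map \<open>jac\<close>.\<close>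

definition jac_variation :: "(complex \<Rightarrow> complex) \<Rightarrow> (complex \<Rightarrow> complex) \<Rightarrow> complex \<Rightarrow> real" where
  "jac_variation F W z = wedge (dd 1 W z) (dd \<i> F z) + wedge (dd 1 F z) (dd \<i> W z)"

text \<open>The Hamiltonian vector field \<open>\<i> \<cdot> grad h\<close>, with the sign of \<open>\<iota>\<^sub>X \<sigma> = - dh\<close>.\<close>

definition ham_vector :: "(complex \<Rightarrow> real) \<Rightarrow> complex \<Rightarrow> complex" where
  "ham_vector h z = Complex (- dd \<i> h z) (dd 1 h z)"

lemma ham_vector_eq: "ham_vector h z = - complex_of_real (dd \<i> h z) + \<i> * complex_of_real (dd 1 h z)"
  by (simp add: ham_vector_def complex_eq_iff)

lemma smooth_on_ham_vector: "smooth h \<Longrightarrow> smooth (ham_vector h)"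
  unfolding ham_vector_eq[abs_def]
  by (intro smooth_intros)

lemma smooth_on_jac_variation:
  "smooth F \<Longrightarrow> smooth W \<Longrightarrow> smooth (jac_variation F W)"
  unfolding jac_variation_def[abs_def] by (intro smooth_intros)

lemma jac_slice:
  fixes C :: "real \<times> complex \<Rightarrow> complex"
  assumes "smooth_on (S \<times> UNIV) C" "t \<in> S"
  shows "jac (\<lambda>z. C (t, z)) z = wedge (dd (0, 1) C (t, z)) (dd (0, \<i>) C (t, z))"
  unfolding jac_def dd_space_slice[OF assms] ..

text \<open>The time derivative is interchanged with the two space derivatives in the Jacobian.\<close>

lemma jac_time_derivative:
  fixes C :: "real \<times> complex \<Rightarrow> complex"
  assumes S: "open S" "t \<in> S" and C: "smooth_on (S \<times> UNIV) C"
  shows "((\<lambda>s. jac (\<lambda>z. C (s, z)) z) has_real_derivative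
    jac_variation (\<lambda>z. C (t, z)) (\<lambda>z. dd (1, 0) C (t, z)) z) (at t)"
proof -
  have open': "open (S \<times> (UNIV :: complex set))" using S(1) by (intro open_Times open_UNIV)
  have sv: "smooth_on (S \<times> UNIV) (dd v C)" for v using C by (rule smooth_on_dd)
  let ?J = "\<lambda>p. wedge (dd (0, 1) C p) (dd (0, \<i>) C p)"
  have sJ: "smooth_on (S \<times> UNIV) ?J" by (intro smooth_on_wedge open' sv)
  have mem: "(t, z) \<in> S \<times> UNIV" using S(2) by simp
  have "dd (1, 0) ?J (t, z) = wedge (dd (0, 1) C (t, z)) (dd (1, 0) (dd (0, \<i>) C) (t, z))
      + wedge (dd (1, 0) (dd (0, 1) C) (t, z)) (dd (0, \<i>) C (t, z))"
    by (rule dd_bilinear[OF bounded_bilinear_wedge smooth_on_differentiable[OF sv mem] smooth_on_differentiable[OF sv mem]])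
  also have "\<dots> = jac_variation (\<lambda>z. C (t, z)) (\<lambda>z. dd (1, 0) C (t, z)) z"
    unfolding jac_variation_def dd_space_slice[OF C S(2)] dd_space_slice[OF sv S(2)]
      dd_commute[OF open' C mem, of "(1, 0)"] by simp
  finally have eq: "dd (1, 0) ?J (t, z) = jac_variation (\<lambda>z. C (t, z)) (\<lambda>z. dd (1, 0) C (t, z)) z" .
  have "((\<lambda>s. ?J (s, z)) has_real_derivative dd (1, 0) ?J (t, z)) (at t)"
    using dd_slice(1)[OF smooth_on_differentiable[OF sJ mem]]
    by (simp add: has_real_derivative_iff_has_vector_derivative)
  then show ?thesis unfolding eq
    by (rule has_field_derivative_transform_within_open[OF _ S]) (simp add: jac_slice[OF C])
qed

lemma dd_complex_of_real_parts:
  assumes "f differentiable at z" "g differentiable at z"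
  shows "dd v (\<lambda>z. - complex_of_real (f z) + \<i> * complex_of_real (g z)) z = Complex (- dd v f z) (dd v g z)"
proof -
  have "((\<lambda>z. - complex_of_real (f z) + \<i> * complex_of_real (g z)) has_derivative
      (\<lambda>v. - complex_of_real (dd v f z) + \<i> * complex_of_real (dd v g z))) (at z)"
    by (intro has_derivative_add has_derivative_minus has_derivative_mult_right
        bounded_linear.has_derivative[OF bounded_linear_of_real] dd_has_derivative assms)
  from dd_eq[OF this] show ?thesis by (simp add: complex_eq_iff)
qed

lemma dd_ham_vector:
  assumes "smooth h"
  shows "dd v (ham_vector h) z = Complex (- dd v (dd \<i> h) z) (dd v (dd 1 h) z)"
  unfolding ham_vector_eq[abs_def]
  by (rule dd_complex_of_real_parts; rule smooth_differentiable[OF smooth_on_dd[OF assms]])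

text \<open>The variation along \<open>X \<circ> F\<close> is the divergence of \<open>X\<close> at \<open>F z\<close> times \<open>jac F z\<close>, and a Hamiltonian field is
divergence free by the symmetry of the Hessian.\<close>

lemma jac_variation_ham_vector:
  assumes h: "smooth h" and F: "smooth F"
  shows "jac_variation F (\<lambda>z. ham_vector h (F z)) z = 0"
proof -
  have diffF: "F differentiable at z" by (rule smooth_differentiable[OF F])
  have diffX: "ham_vector h differentiable at (F z)"
    by (rule smooth_differentiable[OF smooth_on_ham_vector[OF h]])
  have d: "dd v (\<lambda>z. ham_vector h (F z)) z = Re (dd v F z) *\<^sub>R dd 1 (ham_vector h) (F z) + Im (dd v F z) *\<^sub>R dd \<i> (ham_vector h) (F z)" for v
    unfolding dd_compose[OF diffF diffX] by (rule dd_expand[OF diffX])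
  show ?thesis
    unfolding jac_variation_def d dd_ham_vector[OF h] dd_commute[OF open_UNIV h UNIV_I, of \<i> 1]
    by (simp add: wedge_eq algebra_simps)
qed

context lattice
begin

text \<open>The moment map identity before integration. \<open>jac_variation F W\<close> is the exterior derivative of the
one-form \<open>wedge W (dF)\<close>; multiplying this form by \<open>h\<close> adds \<open>dh \<and> wedge W (dF)\<close>, and this is
\<open>- \<sigma> (dF X, W)\<close> for the Hamiltonian field \<open>X\<close> of \<open>h\<close>.\<close>

lemma exact_density_jac_variation_weighted:
  assumes F: "smooth F" "equivariant F" and W: "smooth W" "periodic W"
    and h: "smooth h" "periodic h"
  shows "exact_density (\<lambda>z. h z * jac_variation F W z - wedge (dd (ham_vector h z) F z) (W z))"
proof -
  define P where "P v z = h z * wedge (W z) (dd v F z)" for v z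
  have smP: "smooth (P v)" for v
    unfolding P_def[abs_def] by (intro smooth_intros F W h)
  have perP: "periodic (P v)" for v
    using dd_lift_periodic[OF F, of v] W(2) h(2) by (simp add: P_def periodic_def)
  have "h z * jac_variation F W z - wedge (dd (ham_vector h z) F z) (W z) = dd 1 (P \<i>) z - dd \<i> (P 1) z" for z
  proof -
    have diff: "W differentiable at z" "h differentiable at z" "F differentiable at z"
      and diffF: "\<And>v. dd v F differentiable at z"
      by (rule smooth_differentiable, intro W F h smooth_on_dd)+
    note D = has_derivative_mult[OF dd_has_derivative[OF diff(2)]
        bounded_bilinear.FDERIV[OF bounded_bilinear_wedge dd_has_derivative[OF diff(1)] dd_has_derivative[OF diffF]]]
    have dP: "dd u (P v) z = h z * (wedge (W z) (dd u (dd v F) z) + wedge (dd u W z) (dd v F z))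
       + dd u h z * wedge (W z) (dd v F z)" for u v
      unfolding P_def[abs_def] by (rule dd_eq[OF D])
    show ?thesis
      unfolding dP dd_commute[OF open_UNIV F(1) UNIV_I, of \<i> 1] jac_variation_def
        dd_expand[OF diff(3), of "ham_vector h z"]
      by (simp add: wedge_eq ham_vector_def algebra_simps)
  qed
  then show ?thesis unfolding exact_density_def using smP perP by blast
qed

lemma cell_integral_jac_variation:
  assumes F: "smooth F" "equivariant F" and W: "smooth W" "periodic W"
    and h: "smooth h" "periodic h"
  shows "cell_integral (\<lambda>z. h z * jac_variation F W z) = cell_integral (\<lambda>z. wedge (dd (ham_vector h z) F z) (W z))"
proof -
  have eq: "(\<lambda>z. wedge (dd (ham_vector h z) F z) (W z))
      = (\<lambda>z. wedge (Re (ham_vector h z) *\<^sub>R dd 1 F z + Im (ham_vector h z) *\<^sub>R dd \<i> F z) (W z))"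
    by (rule ext) (simp only: dd_expand[OF smooth_differentiable[OF F(1)], of "ham_vector h _"])
  have sm: "smooth (\<lambda>z. wedge (dd (ham_vector h z) F z) (W z))"
    unfolding eq by (intro smooth_intros smooth_on_ham_vector F W h)
  have sm2: "smooth (\<lambda>z. h z * jac_variation F W z)"
    by (intro smooth_on_mult smooth_on_jac_variation F W h open_UNIV)
  show ?thesis
    using cell_integral_exact[OF exact_density_jac_variation_weighted[OF assms]]
      cell_integral_diff[OF smooth_on_continuous_on[OF sm2] smooth_on_continuous_on[OF sm]] by simp
qed

text \<open>The case \<open>h = 1\<close>, whose Hamiltonian field vanishes.\<close>

lemma cell_integral_jac_variation_0:
  assumes F: "smooth F" "equivariant F" and W: "smooth W" "periodic W"
  shows "cell_integral (jac_variation F W) = 0"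
proof -
  have "ham_vector (\<lambda>z. 1) z = 0" for z by (simp add: ham_vector_def complex_eq_iff)
  moreover have "dd 0 F z = 0" for z
    using linear_0[OF linear_dd[OF smooth_differentiable[OF F(1)]]] .
  ultimately show ?thesis
    using cell_integral_jac_variation[OF F W smooth_on_const, of 1] by (simp add: periodic_def wedge_eq cell_integral_def)
qed

lemma ham_field_proj:
  assumes "smooth (\<lambda>z. h (\<pi> z))"
  shows "ham_field \<Lambda> h (\<pi> z) = (\<pi> z, ham_vector (\<lambda>z. h (\<pi> z)) z)"
proof -
  let ?h = "\<lambda>z. h (\<pi> z)"
  have diff: "?h differentiable at z" by (rule smooth_differentiable[OF assms])
  have "(THE c. \<forall>b. sigma (\<pi> z, c) (\<pi> z, b) = - fun_diff \<Lambda> h (\<pi> z) b) = ham_vector ?h z"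
    unfolding sigma_eq_wedge fun_diff_proj[OF assms] snd_conv
  proof (rule the_equality)
    show "\<forall>b. wedge (ham_vector ?h z) b = - dd b ?h z"
    proof
      fix v show "wedge (ham_vector ?h z) v = - dd v ?h z"
        unfolding dd_expand[OF diff, of v] by (simp add: wedge_eq ham_vector_def algebra_simps)
    qed
    fix c assume c: "\<forall>b. wedge c b = - dd b ?h z"
    show "c = ham_vector ?h z"
      using c[rule_format, of 1] c[rule_format, of \<i>] by (simp add: wedge_eq ham_vector_def complex_eq_iff)
  qed
  then show ?thesis by (simp add: ham_field_def)
qed

lemma smooth_into_torus_subset:
  assumes "smooth_into_torus \<Lambda> S \<gamma>" "T \<subseteq> S"
  shows "smooth_into_torus \<Lambda> T \<gamma>"
  unfolding smooth_into_torus_def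
proof
  fix z assume "z \<in> T"
  then have "z \<in> S" using assms(2) by blast
  then obtain U F where "open U" "z \<in> U" "smooth_on U F" "\<And>y. y \<in> U \<inter> S \<Longrightarrow> \<gamma> y = \<pi> (F y)"
    by (rule smooth_into_torusE[OF assms(1)]) blast
  with assms(2) show "\<exists>U F. open U \<and> z \<in> U \<and> smooth_on U F \<and> (\<forall>y\<in>U \<inter> T. \<gamma> y = \<pi> (F y))"
    by (intro exI[of _ U] exI[of _ F]) (simp add: subset_iff)
qed

section \<open>Lifts of curves of diffeomorphisms\<close>

definition curve_lift :: "real set \<Rightarrow> (real \<Rightarrow> complex set \<Rightarrow> complex set) \<Rightarrow> (real \<times> complex \<Rightarrow> complex) \<Rightarrow> bool" where
  "curve_lift I c C \<longleftrightarrow> open I \<and> smooth_on (I \<times> UNIV) C \<and> (\<forall>t\<in>I. is_lift (c t) (\<lambda>z. C (t, z)))"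

lemma curve_lift_exists:
  assumes "smooth_curve_diffeos \<Lambda> S c" "I \<subseteq> S" "open I" "convex I"
  obtains C where "curve_lift I c C"
proof -
  have "smooth_into_torus \<Lambda> (I \<times> UNIV) (\<lambda>(t, z). c t (\<pi> z))"
    using assms(1,2) unfolding smooth_curve_diffeos_def by (elim conjE) (rule smooth_into_torus_subset, auto)
  then obtain C where C: "smooth_on (I \<times> UNIV) C" "\<And>y. y \<in> I \<times> UNIV \<Longrightarrow> (\<lambda>(t, z). c t (\<pi> z)) y = \<pi> (C y)"
    by (rule smooth_lift_exists[OF open_Times[OF assms(3) open_UNIV] convex_Times[OF assms(4) convex_UNIV]]) blast
  have "curve_lift I c C"
    unfolding curve_lift_def is_lift_def using C(1) C(2)[of "(_, _)"] assms(3) by simp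
  then show thesis by (rule that)
qed

lemma local_curve_lift_exists:
  assumes "smooth_curve_diffeos \<Lambda> S c" "open S" "t \<in> S"
  obtains d C where "d > 0" "ball t d \<subseteq> S" "curve_lift (ball t d) c C"
proof -
  obtain d where d: "d > 0" "ball t d \<subseteq> S" using assms(2,3) openE by blast
  obtain C where "curve_lift (ball t d) c C"
    by (rule curve_lift_exists[OF assms(1) d(2) open_ball convex_ball])
  then show thesis by (rule that[OF d])
qed

lemma curve_liftD:
  assumes "curve_lift I c C" "t \<in> I"
  shows "is_lift (c t) (\<lambda>z. C (t, z))" "smooth (\<lambda>z. C (t, z))" "equivariant (\<lambda>z. C (t, z))"
proof -
  show "is_lift (c t) (\<lambda>z. C (t, z))" using assms by (simp add: curve_lift_def)
  then show "equivariant (\<lambda>z. C (t, z))" by (rule is_lift_equivariant)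
  show "smooth (\<lambda>z. C (t, z))"
    using assms unfolding curve_lift_def by (blast intro: smooth_on_slice)
qed

lemma velocity_lift:
  assumes C: "curve_lift I c C" and t: "t \<in> I"
  shows "velocity \<Lambda> c t (\<pi> z) = (c t (\<pi> z), dd (1, 0) C (t, z))"
proof -
  have I: "open I" "smooth_on (I \<times> UNIV) C" "\<And>s. s \<in> I \<Longrightarrow> c s (\<pi> z) = \<pi> (C (s, z))"
    using C by (auto simp: curve_lift_def is_lift_def)
  have diff: "C differentiable at (t, z)" using smooth_on_differentiable[OF I(2)] t by simp
  have "torus_derivative \<Lambda> (\<lambda>s. c s (\<pi> z)) t = (\<lambda>h. h *\<^sub>R dd (1, 0) C (t, z))"
  proof (rule torus_derivative_eq)
    show "((\<lambda>s. C (s, z)) has_derivative (\<lambda>h. h *\<^sub>R dd (1, 0) C (t, z))) (at t)"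
      using dd_slice(1)[OF diff] by (simp only: has_vector_derivative_def)
    show "\<forall>\<^sub>F s in nhds t. c s (\<pi> z) = \<pi> (C (s, z))"
      unfolding eventually_nhds using I(1,3) t by blast
  qed
  then show ?thesis by (simp add: velocity_def)
qed

lemma mu_diff_lift:
  assumes "smooth F" "is_lift f F"
  shows "mu_diff \<Lambda> f (\<pi> z) = 1 - jac F z"
  by (simp add: mu_diff_def sigma_quotient_lift[OF assms])

lemma mu_diff_derivative:
  assumes C: "curve_lift I c C" and t: "t \<in> I"
  shows "((\<lambda>s. mu_diff \<Lambda> (c s) (\<pi> z)) has_real_derivative
    - jac_variation (\<lambda>z. C (t, z)) (\<lambda>z. dd (1, 0) C (t, z)) z) (at t)"
proof -
  have I: "open I" "smooth_on (I \<times> UNIV) C" using C by (auto simp: curve_lift_def)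
  have "((\<lambda>s. 1 - jac (\<lambda>z. C (s, z)) z) has_real_derivative
    - jac_variation (\<lambda>z. C (t, z)) (\<lambda>z. dd (1, 0) C (t, z)) z) (at t)"
    using jac_time_derivative[OF I(1) t I(2)] by (auto intro!: derivative_eq_intros)
  then show ?thesis
    by (rule has_field_derivative_transform_within_open[OF _ I(1) t]) (simp add: mu_diff_lift[OF curve_liftD(2,1)[OF C]])
qed

text \<open>A local lift of the curve expresses \<open>\<mu>\<close> by first derivatives of a smooth function of time and position.\<close>

lemma mu_diff_smooth_curve:
  assumes S: "open S" "smooth_curve_diffeos \<Lambda> S c"
  shows "smooth_curve_cinf \<Lambda> S (\<lambda>t. mu_diff \<Lambda> (c t))"
  unfolding smooth_curve_cinf_def
proof (intro conjI ballI)
  have loc: "\<exists>d>0. \<exists>C. ball t d \<subseteq> S \<and> curve_lift (ball t d) c C" if "t \<in> S" for t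
    using local_curve_lift_exists[OF S(2,1) that] by metis
  show "smooth_on (S \<times> UNIV) (\<lambda>(t, z). mu_diff \<Lambda> (c t) (\<pi> z))"
  proof (rule smooth_on_local)
    fix x :: "real \<times> complex" assume "x \<in> S \<times> UNIV"
    then obtain d C where dC: "d > 0" "curve_lift (ball (fst x) d) c C" using loc[of "fst x"] by auto
    let ?U = "ball (fst x) d \<times> (UNIV :: complex set)"
    have "smooth_on ?U C" using dC(2) by (simp add: curve_lift_def)
    then have "smooth_on ?U (\<lambda>p. 1 - wedge (dd (0, 1) C p) (dd (0, \<i>) C p))"
      by (intro smooth_intros open_Times open_ball)
    moreover have "(case p of (t, z) \<Rightarrow> mu_diff \<Lambda> (c t) (\<pi> z)) = 1 - wedge (dd (0, 1) C p) (dd (0, \<i>) C p)"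
      if "p \<in> ?U" for p
    proof -
      obtain t z where p: "p = (t, z)" by (cases p)
      then have "t \<in> ball (fst x) d" using that by simp
      then show ?thesis
        using mu_diff_lift[OF curve_liftD(2,1)[OF dC(2)]] jac_slice[OF \<open>smooth_on ?U C\<close>] p by simp
    qed
    moreover have "open ?U" "x \<in> ?U" using dC(1) by (auto intro: open_Times simp: mem_Times_iff)
    ultimately show "\<exists>U G. open U \<and> x \<in> U \<and> smooth_on U G \<and> (\<forall>y\<in>U. (case y of (t, z) \<Rightarrow> mu_diff \<Lambda> (c t) (\<pi> z)) = G y)"
      by blast
  qed
  fix t assume "t \<in> S"
  then obtain d C where dC: "d > 0" "curve_lift (ball t d) c C" using loc by blast
  then have t: "t \<in> ball t d" by simp
  note CD = curve_liftD[OF dC(2) t]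
  have "smooth (\<lambda>z. 1 - jac (\<lambda>z. C (t, z)) z)"
    by (intro smooth_intros smooth_on_jac CD(2))
  then show "mu_diff \<Lambda> (c t) \<in> cinf \<Lambda>"
    by (simp add: cinf_def mu_diff_lift[OF CD(2,1)]) (simp add: mu_diff_def)
qed

section \<open>Hamiltonian diffeomorphisms\<close>

text \<open>As the Hamiltonian field \<open>X\<close> is divergence free, \<open>dg(X)\<close> is the divergence of \<open>g X\<close>.\<close>

lemma exact_density_poisson:
  assumes h: "smooth h" "periodic h" and g: "smooth g" "periodic (g :: complex \<Rightarrow> real)"
  shows "exact_density (\<lambda>z. dd (ham_vector h z) g z)"
proof -
  define P where "P v z = - (g z * dd v h z)" for v z
  have smP: "smooth (P v)" for v
    unfolding P_def[abs_def] by (intro smooth_intros h g)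
  have perP: "periodic (P v)" for v
    using dd_periodic[OF h, of v] g(2) by (simp add: P_def periodic_def)
  have "dd (ham_vector h z) g z = dd 1 (P \<i>) z - dd \<i> (P 1) z" for z
  proof -
    have diff: "g differentiable at z" and diffh: "\<And>v. dd v h differentiable at z"
      by (rule smooth_differentiable, intro h g smooth_on_dd)+
    have dP: "dd u (P v) z = - (g z * dd u (dd v h) z + dd u g z * dd v h z)" for u v
      unfolding P_def[abs_def]
      by (rule dd_eq[OF has_derivative_minus[OF has_derivative_mult[OF dd_has_derivative[OF diff] dd_has_derivative[OF diffh]]]])
    show ?thesis
      unfolding dP dd_commute[OF open_UNIV h(1) UNIV_I, of \<i> 1] dd_expand[OF diff, of "ham_vector h z"]
      by (simp add: ham_vector_def algebra_simps)
  qed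
  then show ?thesis unfolding exact_density_def using smP perP by blast
qed

text \<open>Along the lifted flow \<open>C\<close> the Jacobian is constant, because its variation by a Hamiltonian velocity
vanishes. The integral of \<open>g\<close> along the flow is constant because its derivative is the integral of
\<open>dg(X)\<close> along the flow, which as the Jacobian is \<open>1\<close> is the pullback of an exact density.\<close>

lemma ham_lift:
  assumes "\<phi> \<in> ham \<Lambda>"
  obtains F where "\<phi> \<in> diffeos \<Lambda>" "smooth F" "is_lift \<phi> F" "\<And>z. jac F z = 1"
    "\<And>g :: complex \<Rightarrow> real. smooth g \<Longrightarrow> periodic g \<Longrightarrow> cell_integral (\<lambda>z. g (F z)) = cell_integral g"
proof -
  obtain \<Phi> H where \<Phi>: "smooth_curve_diffeos \<Lambda> UNIV \<Phi>" and H: "\<And>t. H t \<in> cinf0 \<Lambda>"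
    and ends: "\<Phi> 0 = (\<lambda>p\<in>torus \<Lambda>. p)" "\<Phi> 1 = \<phi>"
    and flow: "\<And>t. velocity \<Lambda> \<Phi> t = compose (torus \<Lambda>) (ham_field \<Lambda> (H t)) (\<Phi> t)"
    using assms unfolding ham_def by blast
  obtain C where C: "curve_lift UNIV \<Phi> C"
    by (rule curve_lift_exists[OF \<Phi> subset_UNIV open_UNIV convex_UNIV])
  define h where "h t z = H t (\<pi> z)" for t z
  have h: "smooth (h t)" "periodic (h t)" for t
    using H[of t] by (simp_all add: cinf0_def cinf_def h_def[abs_def] periodic_proj)
  note CD = curve_liftD[OF C UNIV_I]
  have smC: "smooth_on (UNIV \<times> UNIV) C" using C by (simp add: curve_lift_def)
  \<comment> \<open>The flow equation, read off in the trivialisation.\<close>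
  have ode: "dd (1, 0) C (t, z) = ham_vector (h t) (C (t, z))" for t z
  proof -
    have "velocity \<Lambda> \<Phi> t (\<pi> z) = ham_field \<Lambda> (H t) (\<pi> (C (t, z)))"
      unfolding flow using CD(1)[of t] by (simp add: compose_def is_lift_def)
    then show ?thesis
      using h(1)[of t] by (simp add: velocity_lift[OF C UNIV_I] ham_field_proj h_def[abs_def])
  qed
  have id: "is_lift (\<Phi> 0) (\<lambda>z. z)" by (simp add: is_lift_def ends)
  have jac1: "jac (\<lambda>z. C (t, z)) z = 1" for t z
  proof -
    have "((\<lambda>s. jac (\<lambda>z. C (s, z)) z) has_real_derivative 0) (at s)" for s
      using jac_time_derivative[OF open_UNIV UNIV_I smC, of z s]
      unfolding ode jac_variation_ham_vector[OF h(1) CD(2)] .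
    then have "jac (\<lambda>z. C (t, z)) z = jac (\<lambda>z. C (0, z)) z"
      using DERIV_isconst_all[of "\<lambda>s. jac (\<lambda>z. C (s, z)) z" t 0] by blast
    also have "\<dots> = jac (\<lambda>z. z) z"
      using sigma_quotient_lift[OF CD(2) CD(1), of 0 z] sigma_quotient_lift[OF smooth_on_ident id, of z] by simp
    also have "\<dots> = 1"
      unfolding jac_def dd_bounded_linear[OF bounded_linear_ident] by (simp add: wedge_eq)
    finally show ?thesis .
  qed
  have pres: "cell_integral (\<lambda>z. g (C (1, z))) = cell_integral g"
    if g: "smooth g" "periodic g" for g :: "complex \<Rightarrow> real"
  proof -
    have smgC: "smooth_on (UNIV \<times> UNIV) (\<lambda>p. g (C p))"
      by (rule smooth_on_compose[OF _ subset_UNIV smC g(1)]) simp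
    have "((\<lambda>t. cell_integral (\<lambda>z. g (C (t, z)))) has_real_derivative 0) (at t)" for t
    proof -
      have "dd (1, 0) (\<lambda>p. g (C p)) (t, z) = dd (ham_vector (h t) (C (t, z))) g (C (t, z)) * jac (\<lambda>z. C (t, z)) z" for z
        using dd_compose[of C "(t, z)" g "(1, 0)"] smooth_on_differentiable[OF smC] smooth_on_differentiable[OF g(1)]
        by (simp add: ode jac1)
      moreover have "cell_integral (\<lambda>z. dd (ham_vector (h t) (C (t, z))) g (C (t, z)) * jac (\<lambda>z. C (t, z)) z) = 0"
        by (rule cell_integral_exact[OF exact_density_pullback[OF exact_density_poisson[OF h g] CD(2,3)]])
      ultimately show ?thesis
        using cell_integral_derivative[OF open_UNIV smgC UNIV_I, of t] by simp
    qed
    then have "cell_integral (\<lambda>z. g (C (1, z))) = cell_integral (\<lambda>z. g (C (0, z)))"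
      using DERIV_isconst_all[of "\<lambda>t. cell_integral (\<lambda>z. g (C (t, z)))" 1 0] by blast
    also have "(\<lambda>z. g (C (0, z))) = g"
    proof
      fix z
      have "\<pi> (C (0, z)) = \<pi> z"
        using CD(1)[of 0] id by (simp add: is_lift_def)
      then show "g (C (0, z)) = g z" using periodicD[OF g(2)] proj_eq_iff by blast
    qed
    finally show ?thesis .
  qed
  have "\<phi> \<in> diffeos \<Lambda>" using \<Phi> ends(2) by (auto simp: smooth_curve_diffeos_def)
  moreover have "is_lift \<phi> (\<lambda>z. C (1, z))" using CD(1)[of 1] ends(2) by simp
  ultimately show thesis
    by (intro that[of "\<lambda>z. C (1, z)"] CD(2) jac1 pres)
qed

end

section \<open>Small perturbations of a diffeomorphism\<close>

text \<open>Cramer's rule gives \<open>dd v G = N v \<circ> G\<close> with \<open>N v\<close> smooth. So if \<open>G\<close> is \<open>k\<close> times differentiable, its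
derivatives are, and \<open>G\<close> gains one order.\<close>

lemma smooth_inverse:
  fixes F G :: "complex \<Rightarrow> complex"
  assumes F: "smooth F" and GF: "\<And>z. G (F z) = z" and FG: "\<And>z. F (G z) = z"
    and J: "\<And>z. jac F z \<noteq> 0"
  shows "smooth G"
proof -
  define N where "N v z = complex_of_real (wedge v (dd \<i> F z) * inverse (jac F z))
    + \<i> * complex_of_real (wedge (dd 1 F z) v * inverse (jac F z))" for v z
  have smN: "smooth (N v)" for v
    unfolding N_def[abs_def]
    by (intro smooth_intros smooth_on_inverse smooth_on_jac F J)
  have der: "(G has_derivative (\<lambda>v. N v (G y))) (at y)" for y
  proof -
    define x where "x = G y"
    have diff: "F differentiable at x" by (rule smooth_differentiable[OF F])
    have "dd (N v x) F x = v" for v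
    proof -
      have "(wedge v (dd \<i> F x) * inverse (jac F x)) *\<^sub>R dd 1 F x + (wedge (dd 1 F x) v * inverse (jac F x)) *\<^sub>R dd \<i> F x = v"
        using wedge_cramer[OF J[of x, unfolded jac_def], of v] unfolding jac_def divide_inverse .
      then show ?thesis
        unfolding dd_expand[OF diff, of "N v x"] by (simp add: N_def del: of_real_mult of_real_inverse)
    qed
    then have "(\<lambda>v. dd v F x) \<circ> (\<lambda>v. N v x) = id" by (simp add: fun_eq_iff)
    from has_derivative_inverse_strong[OF open_UNIV UNIV_I smooth_on_continuous_on[OF F] GF dd_has_derivative[OF diff] this]
    show ?thesis by (simp add: x_def FG)
  qed
  have "smooth_upto k UNIV G" for k
  proof (induction k)
    case (Suc k)
    have "dd v G = (\<lambda>y. N v (G y))" for v by (rule ext) (rule dd_eq[OF der])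
    moreover have "smooth_upto k UNIV (\<lambda>y. N v (G y))" for v
      by (rule smooth_upto_compose[OF open_UNIV subset_UNIV Suc.IH smooth_on_smooth_upto[OF smN]])
    ultimately show ?case using differentiableI[OF der] by simp
  qed simp
  then show ?thesis by (simp add: smooth_on_eq_smooth_upto)
qed

lemma norm_dd_le:
  fixes F :: "complex \<Rightarrow> 'b::real_normed_vector"
  assumes "F differentiable at z" "norm (dd 1 F z) \<le> d" "norm (dd \<i> F z) \<le> d"
  shows "norm (dd v F z) \<le> 2 * d * norm v"
proof -
  have "norm (dd v F z) \<le> \<bar>Re v\<bar> * norm (dd 1 F z) + \<bar>Im v\<bar> * norm (dd \<i> F z)"
    unfolding dd_expand[OF assms(1), of v] using norm_triangle_ineq by (metis norm_scaleR)
  also have "\<dots> \<le> norm v * d + norm v * d"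
    by (intro add_mono mult_mono abs_Re_le_cmod abs_Im_le_cmod assms) simp_all
  finally show ?thesis by simp
qed

lemma lipschitz_of_dd_bound:
  fixes F :: "complex \<Rightarrow> 'b::real_normed_vector"
  assumes "smooth F" "\<And>v z. norm (dd v F z) \<le> L * norm v"
  shows "norm (F x - F y) \<le> L * norm (x - y)"
proof (rule differentiable_bound[OF convex_UNIV _ _ UNIV_I UNIV_I])
  show "(F has_derivative (\<lambda>v. dd v F z)) (at z within UNIV)" for z
    by (rule dd_has_derivative[OF smooth_differentiable[OF assms(1)]])
  show "onorm (\<lambda>v. dd v F z) \<le> L" for z
    using assms(2)[of 1 z] by (intro onorm_le assms(2))
qed

context lattice
begin

lemma periodic_bounded:
  fixes g :: "complex \<Rightarrow> 'b::real_normed_vector"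
  assumes "continuous_on UNIV g" "periodic g"
  obtains M where "M > 0" "\<And>z. norm (g z) \<le> M"
proof -
  have "bounded (g ` closed_cell)"
    by (intro compact_imp_bounded compact_continuous_image compact_closed_cell continuous_on_subset[OF assms(1)]) simp
  then obtain M where M: "M > 0" "\<And>z. z \<in> closed_cell \<Longrightarrow> norm (g z) \<le> M"
    unfolding bounded_pos by blast
  have "norm (g z) \<le> M" for z
  proof -
    obtain l where l: "l \<in> \<Lambda>" "z + l \<in> closed_cell" by (rule closed_cell_representative)
    then have "g (z + l) = g z" using assms(2) by (simp add: periodic_def)
    then show ?thesis using M(2)[OF l(2)] by simp
  qed
  then show thesis using M(1) that by blast
qed

lemma equivariant_dd_bound:
  assumes "smooth G" "equivariant G"
  obtains L where "L > 0" "\<And>v z. norm (dd v G z) \<le> L * norm v"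
proof -
  obtain M1 where M1: "M1 > 0" "\<And>z. norm (dd 1 G z) \<le> M1"
    by (rule periodic_bounded[OF smooth_on_continuous_on[OF smooth_on_dd[OF assms(1)]] dd_lift_periodic[OF assms], of 1]) blast
  obtain M2 where M2: "M2 > 0" "\<And>z. norm (dd \<i> G z) \<le> M2"
    by (rule periodic_bounded[OF smooth_on_continuous_on[OF smooth_on_dd[OF assms(1)]] dd_lift_periodic[OF assms], of \<i>]) blast
  have "norm (dd v G z) \<le> 2 * max M1 M2 * norm v" for v z
    by (rule norm_dd_le[OF smooth_differentiable[OF assms(1)]])
      (use M1(2)[of z] M2(2)[of z] in linarith)+
  then show thesis using M1(1) by (intro that[of "2 * max M1 M2"]) auto
qed

text \<open>\<open>F + w = (id + w \<circ> G) \<circ> F\<close>, where \<open>w \<circ> G\<close> has Lipschitz constant at most \<open>1/2\<close> (twice the bound of the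
partial derivatives of \<open>w\<close> times the bound \<open>L\<close> for \<open>dG\<close>). Banach's fixed point theorem inverts the first
factor, and the same estimate bounds \<open>d(F + w)\<close> from below.\<close>

lemma lift_pair_perturb:
  assumes FG: "lift_pair F G" and L: "L > 0" "\<And>v z. norm (dd v G z) \<le> L * norm v"
    and w: "smooth w" "periodic w" "\<And>z. norm (dd 1 w z) \<le> d" "\<And>z. norm (dd \<i> w z) \<le> d"
    and small: "2 * d * L \<le> 1 / 2"
  obtains G' where "lift_pair (\<lambda>z. F z + w z) G'"
proof -
  have F: "smooth F" and G: "smooth G" and GF: "\<And>z. G (F z) = z" and FG': "\<And>z. F (G z) = z"
    and eqF: "equivariant F" and eqG: "equivariant G"
    using FG by (auto simp: lift_pair_def)
  have diffF: "F differentiable at z" and diffG: "G differentiable at z" and diffw: "w differentiable at z" for z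
    by (rule smooth_differentiable, rule F G w)+
  define F' where "F' z = F z + w z" for z
  have smF': "smooth F'" unfolding F'_def[abs_def] by (intro smooth_on_add F w open_UNIV)
  have d0: "d \<ge> 0" using w(3)[of 0] norm_ge_zero order_trans by blast
  have wb: "norm (dd v w z) \<le> 2 * d * norm v" for v z by (rule norm_dd_le[OF diffw w(3,4)])
  note lipw = lipschitz_of_dd_bound[OF w(1) wb] and lipG = lipschitz_of_dd_bound[OF G L(2)]
  \<comment> \<open>With \<open>x = F z\<close>, the equation \<open>F z + w z = y\<close> reads \<open>y - w (G x) = x\<close>.\<close>
  have fix1: "\<exists>!x. y - w (G x) = x" for y
  proof (rule banach_fix_type[of "1/2"])
    show "\<forall>x x'. dist (y - w (G x)) (y - w (G x')) \<le> 1 / 2 * dist x x'"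
    proof (intro allI)
      fix x x'
      have "dist (y - w (G x)) (y - w (G x')) = norm (w (G x) - w (G x'))"
        by (simp add: dist_norm norm_minus_commute)
      also have "\<dots> \<le> 2 * d * norm (G x - G x')" by (rule lipw)
      also have "\<dots> \<le> 2 * d * (L * norm (x - x'))" using d0 by (intro mult_left_mono lipG) simp
      also have "\<dots> \<le> 1 / 2 * norm (x - x')" using mult_right_mono[OF small, of "norm (x - x')"] by (simp add: mult_ac)
      finally show "dist (y - w (G x)) (y - w (G x')) \<le> 1 / 2 * dist x x'" by (simp add: dist_norm)
    qed
  qed simp_all
  define X where "X y = (THE x. y - w (G x) = x)" for y
  have X: "y - w (G (X y)) = X y" for y unfolding X_def by (rule theI'[OF fix1])
  have X_unique: "y - w (G x) = x \<Longrightarrow> X y = x" for x y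
    using fix1[of y] X[of y] by blast
  define G' where "G' y = G (X y)" for y
  have F'G': "F' (G' y) = y" for y
    using X[of y] by (simp add: F'_def G'_def FG' algebra_simps)
  have G'F': "G' (F' z) = z" for z
  proof -
    have "X (F' z) = F z" by (rule X_unique) (simp add: F'_def GF)
    then show ?thesis by (simp add: G'_def GF)
  qed
  \<comment> \<open>The chain rule for \<open>G \<circ> F = id\<close> bounds \<open>dF\<close> from below; \<open>dw\<close> costs at most half of it.\<close>
  have expand: "norm v \<le> 2 * L * norm (dd v F' z)" for v z
  proof -
    have "dd (dd v F z) G (F z) = dd v (\<lambda>z. G (F z)) z" by (rule dd_compose[OF diffF diffG, symmetric])
    also have "\<dots> = v" unfolding GF by (rule dd_bounded_linear[OF bounded_linear_ident])
    finally have "norm v \<le> L * norm (dd v F z)" using L(2)[of "dd v F z" "F z"] by simp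
    moreover have "norm (dd v F z) \<le> norm (dd v F' z) + norm (dd v w z)"
    proof -
      have "dd v F' z = dd v F z + dd v w z" unfolding F'_def[abs_def] by (rule dd_add[OF diffF diffw])
      then show ?thesis using norm_triangle_ineq4[of "dd v F' z" "dd v w z"] by simp
    qed
    ultimately have "norm v \<le> L * (norm (dd v F' z) + norm (dd v w z))"
      using L(1) by (smt (verit) mult_left_mono)
    also have "\<dots> \<le> L * (norm (dd v F' z) + 2 * d * norm v)" using L(1) wb by simp
    also have "\<dots> \<le> L * norm (dd v F' z) + 1 / 2 * norm v"
      using mult_right_mono[OF small, of "norm v"] by (simp add: algebra_simps)
    finally show ?thesis by simp
  qed
  have J: "jac F' z \<noteq> 0" for z
  proof
    assume 0: "jac F' z = 0"
    define p q where "p = dd 1 F' z" and "q = dd \<i> F' z"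
    have "p \<noteq> 0" using expand[of 1 z] by (auto simp: p_def)
    \<comment> \<open>The two partial derivatives are parallel, so \<open>v\<close> is in the kernel of the differential.\<close>
    define v where "v = Complex (- (q \<bullet> p)) (p \<bullet> p)"
    have "wedge p q = 0" using 0 by (simp add: jac_def p_def q_def)
    then have "(p \<bullet> p) *\<^sub>R q = (q \<bullet> p) *\<^sub>R p" using inner_wedge_decomposition[of p q] by simp
    then have "dd v F' z = 0"
      unfolding dd_expand[OF smooth_differentiable[OF smF'], of v] by (simp add: v_def p_def q_def)
    then have "v = 0" using expand[of v z] by simp
    then show False using \<open>p \<noteq> 0\<close> by (simp add: v_def complex_eq_iff)
  qed
  have eqF': "equivariant F'"
    using eqF w(2) by (simp add: equivariant_def periodic_def F'_def)
  have "equivariant G'"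
    unfolding equivariant_def
  proof (intro allI ballI)
    fix y l assume l: "l \<in> \<Lambda>"
    \<comment> \<open>The lattice vector by which \<open>G\<close> shifts under \<open>l\<close>: \<open>w\<close> is invariant under \<open>m\<close>, so \<open>G'\<close> shifts by the same vector.\<close>
    define m where "m = G (0 + l) - G 0"
    have m: "m \<in> \<Lambda>" unfolding m_def using eqG l unfolding equivariant_def by blast
    have Gl: "G (x + l) = G x + m" for x
      using equivariant_monodromy[OF smooth_on_continuous_on[OF G] eqG l, of x 0] by (simp add: m_def algebra_simps)
    have "F (z + m) = F z + l" for z
      using Gl[of "F z"] FG'[of "F z + l"] by (simp add: GF)
    then have "F' (G' y + m) = y + l"
      using w(2) m F'G'[of y] by (simp add: F'_def periodic_def)
    then have "G' (y + l) = G' y + m" using G'F' by metis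
    then show "G' (y + l) - G' y \<in> \<Lambda>" using m by simp
  qed
  then have "lift_pair F' G'"
    unfolding lift_pair_def using smF' smooth_inverse[OF smF' G'F' F'G' J] F'G' G'F' eqF' by blast
  then show thesis unfolding F'_def[abs_def] by (rule that)
qed

section \<open>The flat charts\<close>

text \<open>A ball for the \<open>C\<^sup>1\<close> norm. The single \<open>d < e\<close> for all \<open>z\<close> expresses that the supremum is less than \<open>e\<close>, which
makes the set open.\<close>

definition chart_nbhd :: "real \<Rightarrow> (complex set \<Rightarrow> complex) set" where
  "chart_nbhd e = {w \<in> cinf \<Lambda>. \<exists>d<e. \<forall>z. norm (w (\<pi> z)) \<le> d \<and>
     norm (dd 1 (\<lambda>z. w (\<pi> z)) z) \<le> d \<and> norm (dd \<i> (\<lambda>z. w (\<pi> z)) z) \<le> d}"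

lemma cinfD: "w \<in> cinf \<Lambda> \<Longrightarrow> smooth (\<lambda>z. w (\<pi> z))" "w \<in> cinf \<Lambda> \<Longrightarrow> w \<in> extensional (torus \<Lambda>)"
  by (simp_all add: cinf_def)

lemma chart_nbhd_cinf: "w \<in> chart_nbhd e \<Longrightarrow> w \<in> cinf \<Lambda>"
  by (simp add: chart_nbhd_def)

lemma chart_nbhd_norm: "w \<in> chart_nbhd e \<Longrightarrow> norm (w (\<pi> z)) < e"
  unfolding chart_nbhd_def by (auto intro: le_less_trans)

lemma frechet_open_chart_nbhd: "frechet_open \<Lambda> (chart_nbhd e)"
  unfolding frechet_open_def
proof (intro conjI ballI)
  show "chart_nbhd e \<subseteq> cinf \<Lambda>" using chart_nbhd_cinf by blast
  fix w assume w: "w \<in> chart_nbhd e"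
  then have wc: "w \<in> cinf \<Lambda>" by (rule chart_nbhd_cinf)
  obtain d where d: "d < e" "\<And>z. norm (w (\<pi> z)) \<le> d"
     "\<And>z. norm (dd 1 (\<lambda>z. w (\<pi> z)) z) \<le> d" "\<And>z. norm (dd \<i> (\<lambda>z. w (\<pi> z)) z) \<le> d"
    using w unfolding chart_nbhd_def by blast
  define r where "r = (e - d) / 2"
  have r: "r > 0" "d + r < e" using d(1) by (simp_all add: r_def field_simps)
  have "w' \<in> chart_nbhd e"
    if w': "w' \<in> cinf \<Lambda>" and close: "\<And>vs z. length vs \<le> 1 \<Longrightarrow> set vs \<subseteq> Basis \<Longrightarrow>
        norm (iter_deriv vs (\<lambda>y. w' (\<pi> y) - w (\<pi> y)) z) < r" for w'
  proof -
    have diff: "(\<lambda>z. w' (\<pi> z)) differentiable at z" "(\<lambda>z. w (\<pi> z)) differentiable at z" for z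
      using smooth_on_differentiable[OF cinfD(1)] wc w' by blast+
    have near: "norm x \<le> d + r" if "norm (x - y) < r" "norm y \<le> d" for x y :: complex
      using norm_triangle_sub[of x y] that by linarith
    have "norm (w' (\<pi> z)) \<le> d + r" for z
      by (rule near[OF _ d(2)]) (use close[of "[]"] in simp)
    moreover have b: "norm (dd b (\<lambda>z. w' (\<pi> z)) z - dd b (\<lambda>z. w (\<pi> z)) z) < r" if "b \<in> Basis" for b z
      using close[of "[b]" z] dd_diff[OF diff, of b z] that by (simp add: dd_def)
    have "norm (dd 1 (\<lambda>z. w' (\<pi> z)) z) \<le> d + r" "norm (dd \<i> (\<lambda>z. w' (\<pi> z)) z) \<le> d + r" for z
      by (rule near[OF b d(3)], simp add: Basis_complex_def) (rule near[OF b d(4)], simp add: Basis_complex_def)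
    ultimately show ?thesis unfolding chart_nbhd_def using w' r(2) by blast
  qed
  then show "\<exists>k. \<exists>r>0. \<forall>w'\<in>cinf \<Lambda>. (\<forall>vs. length vs \<le> k \<and> set vs \<subseteq> Basis \<longrightarrow>
      (\<forall>z. norm (iter_deriv vs (\<lambda>y. w' (\<pi> y) - w (\<pi> y)) z) < r)) \<longrightarrow> w' \<in> chart_nbhd e"
    using r(1) by (intro exI[of _ 1] exI[of _ r]) blast
qed

lemma add_image_proj: "(+) c ` \<pi> z = \<pi> (z + c)"
proof (intro set_eqI iffI)
  fix x assume "x \<in> \<pi> (z + c)"
  then show "x \<in> (+) c ` \<pi> z"
    by (intro image_eqI[where x="x - c"]) (simp_all add: mem_proj algebra_simps)
qed (auto simp: mem_proj algebra_simps)

lemma is_lift_flat_chart: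
  "is_lift f F \<Longrightarrow> is_lift (flat_chart \<Lambda> f w) (\<lambda>z. F z + w (\<pi> z))"
  by (simp add: is_lift_def flat_chart_def add_image_proj)

lemma flat_chart_extensional: "flat_chart \<Lambda> f w \<in> extensional (torus \<Lambda>)"
  by (simp add: flat_chart_def)

text \<open>The radii for which \<open>w\<close> can be recovered from \<open>F + w\<close> modulo the lattice and for which \<open>F + w\<close> is again
the lift of a diffeomorphism.\<close>

definition chart_radius :: "(complex \<Rightarrow> complex) \<Rightarrow> real \<Rightarrow> bool" where
  "chart_radius F e \<longleftrightarrow> e > 0 \<and> (\<forall>l\<in>\<Lambda>. norm l < 2 * e \<longrightarrow> l = 0) \<and>
     (\<forall>w d. d < e \<longrightarrow> smooth w \<longrightarrow> periodic w \<longrightarrow> (\<forall>z. norm (dd 1 w z) \<le> d \<and> norm (dd \<i> w z) \<le> d)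
        \<longrightarrow> (\<exists>G'. lift_pair (\<lambda>z. F z + w z) G'))"

lemma chart_radius_exists:
  assumes FG: "lift_pair F G"
  obtains e where "chart_radius F e"
proof -
  obtain \<rho> where \<rho>: "\<rho> > 0" "\<And>l. l \<in> \<Lambda> \<Longrightarrow> norm l < \<rho> \<Longrightarrow> l = 0" using lattice_separated by blast
  have "smooth G" "equivariant G" using FG by (auto simp: lift_pair_def)
  then obtain L where L: "L > 0" "\<And>v z. norm (dd v G z) \<le> L * norm v" by (rule equivariant_dd_bound) blast
  define e where "e = min (\<rho> / 2) (1 / (4 * L))"
  have "e > 0" "2 * e \<le> \<rho>" using \<rho> L by (auto simp: e_def)
  moreover have "2 * d * L \<le> 1 / 2" if "d < e" for d
  proof -
    have "d \<le> 1 / (4 * L)" using that by (simp add: e_def)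
    then show ?thesis using L(1) by (simp add: field_simps)
  qed
  then have "\<exists>G'. lift_pair (\<lambda>z. F z + w z) G'"
    if "d < e" "smooth w" "periodic w" "\<forall>z. norm (dd 1 w z) \<le> d \<and> norm (dd \<i> w z) \<le> d" for w d
    using lift_pair_perturb[OF FG L, of w d] that by metis
  ultimately have "chart_radius F e"
    unfolding chart_radius_def using \<rho>(2) by (auto dest: less_le_trans)
  then show thesis by (rule that)
qed

lemma flat_chart_in_diffeos_plus:
  assumes f: "f \<in> diffeos_plus \<Lambda>" and F: "smooth F" "is_lift f F" and e: "chart_radius F e"
    and w: "w \<in> chart_nbhd e"
  shows "flat_chart \<Lambda> f w \<in> diffeos_plus \<Lambda>"
proof -
  let ?w = "\<lambda>z. w (\<pi> z)"
  have sw: "smooth ?w" using w chart_nbhd_cinf cinfD by blast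
  obtain d where "d < e" "\<forall>z. norm (dd 1 ?w z) \<le> d \<and> norm (dd \<i> ?w z) \<le> d"
    using w unfolding chart_nbhd_def by blast
  then obtain G' where G': "lift_pair (\<lambda>z. F z + ?w z) G'"
    using e sw periodic_proj[of w] unfolding chart_radius_def by blast
  have lift: "is_lift (flat_chart \<Lambda> f w) (\<lambda>z. F z + ?w z)" by (rule is_lift_flat_chart[OF F(2)])
  have d: "flat_chart \<Lambda> f w \<in> diffeos \<Lambda>" by (rule diffeo_of_lift_pair[OF G' flat_chart_extensional lift])
  have fd: "f \<in> diffeos \<Lambda>" using f by (simp add: diffeos_plus_def)
  have "exact_density (\<lambda>z. (jac (\<lambda>z. F z + ?w z) z - jac F z) + (jac F z - 1))"
    by (rule exact_density_add[OF exact_density_jac_perturb[OF F(1) is_lift_equivariant[OF F(2)] sw periodic_proj]])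
      (use f diffeos_plus_iff[OF fd F] in blast)
  then have "exact_density (\<lambda>z. jac (\<lambda>z. F z + ?w z) z - 1)" by simp
  moreover have "smooth (\<lambda>z. F z + ?w z)" using G' by (simp add: lift_pair_def)
  ultimately show ?thesis using diffeos_plus_iff[OF d _ lift] by blast
qed

lemma chart_small_unique:
  assumes "chart_radius F e" "norm x < e" "norm y < e" "x - y \<in> \<Lambda>"
  shows "x = y"
proof -
  have "norm (x - y) < 2 * e" using norm_triangle_ineq4[of x y] assms(2,3) by linarith
  then have "x - y = 0" using assms(1,4) unfolding chart_radius_def by blast
  then show ?thesis by simp
qed

lemma inj_on_flat_chart:
  assumes F: "is_lift f F" and e: "chart_radius F e"
  shows "inj_on (flat_chart \<Lambda> f) (chart_nbhd e)"
proof (rule inj_onI)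
  fix w w' assume w: "w \<in> chart_nbhd e" "w' \<in> chart_nbhd e" and eq: "flat_chart \<Lambda> f w = flat_chart \<Lambda> f w'"
  show "w = w'"
  proof (rule torus_ext)
    show "w \<in> extensional (torus \<Lambda>)" "w' \<in> extensional (torus \<Lambda>)" using w chart_nbhd_cinf cinfD by blast+
    fix z
    have "(F z + w (\<pi> z)) - (F z + w' (\<pi> z)) \<in> \<Lambda>"
      using is_lift_flat_chart[OF F, of w] is_lift_flat_chart[OF F, of w'] eq proj_eq_iff
      unfolding is_lift_def by metis
    then show "w (\<pi> z) = w' (\<pi> z)"
      by (intro chart_small_unique[OF e] chart_nbhd_norm w) simp
  qed
qed

lemma flat_chart_smooth_curve:
  assumes f: "f \<in> diffeos_plus \<Lambda>" and F: "smooth F" "is_lift f F" and e: "chart_radius F e"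
    and S: "open S" and w: "\<And>t. t \<in> S \<Longrightarrow> w t \<in> chart_nbhd e" and sm: "smooth_curve_cinf \<Lambda> S w"
  shows "smooth_curve \<Lambda> S (\<lambda>t. flat_chart \<Lambda> f (w t))"
proof -
  have mem: "flat_chart \<Lambda> f (w t) \<in> diffeos_plus \<Lambda>" if "t \<in> S" for t
    by (rule flat_chart_in_diffeos_plus[OF f F e w[OF that]])
  have opn: "open (S \<times> (UNIV :: complex set))" by (intro open_Times S open_UNIV)
  have "smooth_on (S \<times> UNIV) (\<lambda>(t, z). w t (\<pi> z))" using sm by (simp add: smooth_curve_cinf_def)
  then have "smooth_on (S \<times> UNIV) (\<lambda>p. F (snd p) + (case p of (t, z) \<Rightarrow> w t (\<pi> z)))"
    by (intro smooth_on_add opn smooth_on_compose[OF opn subset_UNIV smooth_on_snd[OF opn smooth_on_ident] F(1)])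
  moreover have "(case p of (t, z) \<Rightarrow> flat_chart \<Lambda> f (w t) (\<pi> z)) = \<pi> (F (snd p) + (case p of (t, z) \<Rightarrow> w t (\<pi> z)))" for p
    using is_lift_flat_chart[OF F(2)] by (cases p) (simp add: is_lift_def)
  ultimately have "smooth_into_torus \<Lambda> (S \<times> UNIV) (\<lambda>(t, z). flat_chart \<Lambda> f (w t) (\<pi> z))"
    unfolding smooth_into_torus_def using opn by blast
  then show ?thesis
    using mem by (simp add: smooth_curve_def smooth_curve_diffeos_def diffeos_plus_def)
qed

text \<open>If \<open>H\<close> is a local lift of \<open>f + w\<close>, then \<open>H - F\<close> and \<open>w\<close> differ by lattice vectors. The vector \<open>l\<close> at the
base point is subtracted; near the base point both sides then have norm less than \<open>e\<close>, and this
determines them modulo the lattice.\<close>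

lemma smooth_curve_flat_chart_inverse:
  assumes F: "smooth F" "is_lift f F" and e: "chart_radius F e"
    and S: "open S" and w: "\<And>t. t \<in> S \<Longrightarrow> w t \<in> chart_nbhd e"
    and sm: "smooth_curve_diffeos \<Lambda> S (\<lambda>t. flat_chart \<Lambda> f (w t))"
  shows "smooth_curve_cinf \<Lambda> S w"
  unfolding smooth_curve_cinf_def
proof (intro conjI ballI)
  show "w t \<in> cinf \<Lambda>" if "t \<in> S" for t using w[OF that] by (rule chart_nbhd_cinf)
  have opn: "open (S \<times> (UNIV :: complex set))" by (intro open_Times S open_UNIV)
  define W where "W p = (case p of (t, z) \<Rightarrow> w t (\<pi> z))" for p
  have Wn: "norm (W p) < e" if "p \<in> S \<times> UNIV" for p
    using that chart_nbhd_norm[OF w] by (auto simp: W_def)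
  have "smooth_on (S \<times> UNIV) W"
  proof (rule smooth_on_local)
    fix x :: "real \<times> complex" assume x: "x \<in> S \<times> UNIV"
    have "smooth_into_torus \<Lambda> (S \<times> UNIV) (\<lambda>(t, z). flat_chart \<Lambda> f (w t) (\<pi> z))"
      using sm by (simp add: smooth_curve_diffeos_def)
    then obtain U H where U: "open U" "x \<in> U" "smooth_on U H" "\<And>y. y \<in> U \<inter> (S \<times> UNIV) \<Longrightarrow>
        (\<lambda>(t, z). flat_chart \<Lambda> f (w t) (\<pi> z)) y = \<pi> (H y)"
      by (rule smooth_into_torusE[OF _ x]) blast
    define Q where "Q p = H p - F (snd p)" for p
    have smQ: "smooth_on U Q"
      unfolding Q_def[abs_def]
      by (intro smooth_on_diff U smooth_on_compose[OF U(1) subset_UNIV smooth_on_snd[OF U(1) smooth_on_ident] F(1)])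
    have QW: "Q p - W p \<in> \<Lambda>" if p: "p \<in> U \<inter> (S \<times> UNIV)" for p
    proof -
      obtain t z where tz: "p = (t, z)" by (cases p)
      have "\<pi> (H p) = \<pi> (F z + w t (\<pi> z))"
        using U(4)[OF p] is_lift_flat_chart[OF F(2), of "w t"] by (simp add: tz is_lift_def)
      then show ?thesis unfolding proj_eq_iff by (simp add: Q_def W_def tz algebra_simps)
    qed
    define l where "l = Q x - W x"
    have l: "l \<in> \<Lambda>" unfolding l_def by (rule QW) (use U x in blast)
    define U' where "U' = {p \<in> U \<inter> (S \<times> UNIV). norm (Q p - l) < e}"
    have "open U'"
    proof -
      have "open (U \<inter> (S \<times> UNIV) \<inter> (\<lambda>p. norm (Q p - l)) -` {..<e})"
      proof (rule continuous_open_preimage)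
        show "continuous_on (U \<inter> (S \<times> UNIV)) (\<lambda>p. norm (Q p - l))"
          by (intro continuous_intros continuous_on_subset[OF smooth_on_continuous_on[OF smQ]]) auto
        show "open (U \<inter> S \<times> UNIV)" by (rule open_Int[OF U(1) opn])
      qed simp
      moreover have "U' = U \<inter> (S \<times> UNIV) \<inter> (\<lambda>p. norm (Q p - l)) -` {..<e}" unfolding U'_def by blast
      ultimately show ?thesis by simp
    qed
    moreover have "x \<in> U'" using U(2) x Wn[OF x] by (simp add: U'_def l_def)
    moreover have "smooth_on U' (\<lambda>p. Q p - l)"
      by (intro smooth_on_diff smooth_on_const smooth_on_subset[OF smQ] \<open>open U'\<close>) (auto simp: U'_def)
    moreover have "\<forall>p\<in>U'. W p = Q p - l"
    proof
      fix p assume p: "p \<in> U'"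
      have "Q p - l - W p \<in> \<Lambda>" using lattice_diff[OF QW l, of p] p by (simp add: U'_def algebra_simps)
      then have "Q p - l = W p"
        using p Wn by (intro chart_small_unique[OF e]) (auto simp: U'_def)
      then show "W p = Q p - l" ..
    qed
    ultimately show "\<exists>U G. open U \<and> x \<in> U \<and> smooth_on U G \<and> (\<forall>y\<in>U. W y = G y)" by blast
  qed
  then show "smooth_on (S \<times> UNIV) (\<lambda>(t, z). w t (\<pi> z))" by (simp add: W_def[abs_def])
qed

lemma uniform_in_parameter_periodic:
  fixes g :: "real \<times> complex \<Rightarrow> complex"
  assumes "continuous_on (S \<times> UNIV) g" "open S" "t0 \<in> S" "\<And>t. t \<in> S \<Longrightarrow> periodic (\<lambda>z. g (t, z))" "r > 0"
  obtains d where "d > 0" "\<And>t z. \<bar>t - t0\<bar> < d \<Longrightarrow> norm (g (t, z) - g (t0, z)) < r"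
proof -
  obtain d where d: "d > 0" "\<And>t. \<bar>t - t0\<bar> < d \<Longrightarrow> t \<in> S"
    "\<And>t z. \<bar>t - t0\<bar> < d \<Longrightarrow> z \<in> closed_cell \<Longrightarrow> dist (g (t, z)) (g (t0, z)) < r"
    by (rule uniform_in_parameter[OF assms(1-3) compact_closed_cell assms(5)]) blast
  have "norm (g (t, z) - g (t0, z)) < r" if t: "\<bar>t - t0\<bar> < d" for t z
  proof -
    obtain l where l: "l \<in> \<Lambda>" "z + l \<in> closed_cell" by (rule closed_cell_representative)
    have "g (t, z + l) = g (t, z)" "g (t0, z + l) = g (t0, z)"
      using assms(4)[OF d(2)[OF t]] assms(4)[OF assms(3)] l(1) by (simp_all add: periodic_def)
    then show ?thesis using d(3)[OF t l(2)] by (simp add: dist_norm)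
  qed
  then show thesis using d(1) that by blast
qed

text \<open>A lift \<open>C\<close> of the curve near \<open>t0\<close> gives \<open>W = C - F\<close>, after normalisation equal to the chart coordinate \<open>w0\<close>
at \<open>t0\<close>. It stays periodic in \<open>z\<close>, and by compactness of the cell it stays \<open>C\<^sup>1\<close>-close to \<open>w0\<close>
uniformly in \<open>z\<close>, hence inside the chart.\<close>

lemma flat_chart_image_open:
  assumes F: "smooth F" "is_lift f F"
    and S: "open S" and c: "smooth_curve_diffeos \<Lambda> S c"
  shows "open {t \<in> S. c t \<in> flat_chart \<Lambda> f ` chart_nbhd e}"
  unfolding open_contains_ball
proof
  fix t0 assume "t0 \<in> {t \<in> S. c t \<in> flat_chart \<Lambda> f ` chart_nbhd e}"
  then obtain w0 where t0: "t0 \<in> S" and w0: "w0 \<in> chart_nbhd e" "c t0 = flat_chart \<Lambda> f w0" by blast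
  obtain d0 C where d0: "d0 > 0" "ball t0 d0 \<subseteq> S" and C: "curve_lift (ball t0 d0) c C"
    by (rule local_curve_lift_exists[OF c S t0])
  let ?B = "ball t0 d0"
  have t0B: "t0 \<in> ?B" using d0 by simp
  have smC: "smooth_on (?B \<times> UNIV) C" using C by (simp add: curve_lift_def)
  have opn: "open (?B \<times> (UNIV :: complex set))" by (intro open_Times open_ball open_UNIV)
  let ?w0 = "\<lambda>z. w0 (\<pi> z)"
  have sw0: "smooth ?w0" using w0 chart_nbhd_cinf cinfD by blast
  define l where "l = C (t0, 0) - (F 0 + ?w0 0)"
  have mem: "C (t0, z) - (F z + ?w0 z) \<in> \<Lambda>" for z
    using curve_liftD(1)[OF C t0B] is_lift_flat_chart[OF F(2), of w0] w0(2)
    by (simp add: is_lift_def proj_eq_iff)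
  have lz: "C (t0, z) - (F z + ?w0 z) = l" for z
    unfolding l_def
  proof (rule lattice_valued_constant[where S=UNIV and g="\<lambda>z. C (t0, z) - (F z + ?w0 z)"])
    show "continuous_on UNIV (\<lambda>z. C (t0, z) - (F z + ?w0 z))"
      by (intro continuous_on_diff continuous_on_add smooth_on_continuous_on sw0 F curve_liftD(2)[OF C t0B])
  qed (simp_all add: mem convex_connected)
  have l: "l \<in> \<Lambda>" using mem[of 0] by (simp add: l_def)
  define W where "W p = C p - F (snd p) - l" for p
  have smW: "smooth_on (?B \<times> UNIV) W"
    unfolding W_def[abs_def]
    by (intro smooth_on_diff opn smC smooth_on_const smooth_on_compose[OF opn subset_UNIV smooth_on_snd[OF opn smooth_on_ident] F(1)])
  have W0: "W (t0, z) = ?w0 z" for z using lz[of z] by (simp add: W_def algebra_simps)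
  \<comment> \<open>The defect of periodicity is lattice valued, continuous in \<open>t\<close>, and zero at \<open>t0\<close>.\<close>
  have perW: "periodic (\<lambda>z. W (t, z))" if t: "t \<in> ?B" for t
    unfolding periodic_def
  proof (intro allI ballI)
    fix z k assume k: "k \<in> \<Lambda>"
    let ?D = "\<lambda>s. W (s, z + k) - W (s, z)"
    have "?D t = ?D t0"
    proof (rule lattice_valued_constant[where S="?B" and g="?D"])
      show "continuous_on ?B ?D"
        by (intro continuous_on_diff continuous_on_compose2[OF smooth_on_continuous_on[OF smW]])
          (auto intro!: continuous_intros)
      fix s assume "s \<in> ?B"
      then have "C (s, z + k) - C (s, z) \<in> \<Lambda>" "F (z + k) - F z \<in> \<Lambda>"
        using curve_liftD(3)[OF C] is_lift_equivariant[OF F(2)] k by (auto simp: equivariant_def)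
      from lattice_diff[OF this] show "?D s \<in> \<Lambda>" by (simp add: W_def algebra_simps)
    qed (use t t0B in auto)
    also have "\<dots> = 0" using k by (simp add: W0 proj_translate)
    finally show "W (t, z + k) = W (t, z)" by simp
  qed
  have smWt: "smooth (\<lambda>z. W (t, z))" if "t \<in> ?B" for t by (rule smooth_on_slice[OF smW that])
  have perdW: "periodic (\<lambda>z. dd (0, b) W (t, z))" if t: "t \<in> ?B" for t b
    using dd_periodic[OF smWt[OF t] perW[OF t], of b] dd_space_slice[OF smW t, of b] by simp
  obtain d where d: "d < e" "\<And>z. norm (?w0 z) \<le> d" "\<And>z. norm (dd 1 ?w0 z) \<le> d" "\<And>z. norm (dd \<i> ?w0 z) \<le> d"
    using w0(1) unfolding chart_nbhd_def by blast
  define r where "r = (e - d) / 2"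
  have r: "r > 0" "d + r < e" using d(1) by (simp_all add: r_def field_simps)
  have near: "norm x \<le> d + r" if "norm (x - y) < r" "norm y \<le> d" for x y :: complex
    using norm_triangle_sub[of x y] that by linarith
  obtain d1 where d1: "d1 > 0" "\<And>t z. \<bar>t - t0\<bar> < d1 \<Longrightarrow> norm (W (t, z) - W (t0, z)) < r"
    by (rule uniform_in_parameter_periodic[OF smooth_on_continuous_on[OF smW] open_ball t0B perW r(1)]) blast+
  have ex: "\<exists>d>0. \<forall>t z. \<bar>t - t0\<bar> < d \<longrightarrow> norm (dd (0, b) W (t, z) - dd (0, b) W (t0, z)) < r" for b
    by (rule uniform_in_parameter_periodic[OF smooth_on_continuous_on[OF smooth_on_dd[OF smW]] open_ball t0B perdW r(1), of "b"]) blast+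
  obtain d2 where d2: "d2 > 0" "\<And>t z. \<bar>t - t0\<bar> < d2 \<Longrightarrow> norm (dd (0, 1) W (t, z) - dd (0, 1) W (t0, z)) < r"
    using ex[of 1] by blast
  obtain d3 where d3: "d3 > 0" "\<And>t z. \<bar>t - t0\<bar> < d3 \<Longrightarrow> norm (dd (0, \<i>) W (t, z) - dd (0, \<i>) W (t0, z)) < r"
    using ex[of \<i>] by blast
  define m where "m = min d0 (min d1 (min d2 d3))"
  have "c t \<in> flat_chart \<Lambda> f ` chart_nbhd e" "t \<in> S" if "t \<in> ball t0 m" for t
  proof -
    have t: "\<bar>t - t0\<bar> < d0" "\<bar>t - t0\<bar> < d1" "\<bar>t - t0\<bar> < d2" "\<bar>t - t0\<bar> < d3"
      using that by (simp_all add: m_def dist_real_def abs_minus_commute)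
    then have tB: "t \<in> ?B" by (simp add: dist_real_def abs_minus_commute)
    then show tS: "t \<in> S" using d0 by blast
    define w where "w = descend (\<lambda>z. W (t, z))"
    have wp: "w (\<pi> z) = W (t, z)" for z unfolding w_def by (rule descend_proj[OF perW[OF tB]])
    have wc: "w \<in> cinf \<Lambda>" unfolding w_def by (rule descend_in_cinf[OF perW[OF tB] smWt[OF tB]])
    have W0b: "dd (0, b) W (t0, z) = dd b ?w0 z" for b z
      using dd_space_slice[OF smW t0B, of b] by (simp add: W0)
    have bounds: "norm (W (t, z)) \<le> d + r" "norm (dd (0, 1) W (t, z)) \<le> d + r" "norm (dd (0, \<i>) W (t, z)) \<le> d + r" for z
      using near[OF d1(2)[OF t(2)]] near[OF d2(2)[OF t(3)]] near[OF d3(2)[OF t(4)]] d(2-4) by (simp_all add: W0 W0b)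
    have "w \<in> chart_nbhd e"
      unfolding chart_nbhd_def
      by (intro CollectI conjI exI[of _ "d + r"] allI) (simp_all only: wp dd_space_slice[OF smW tB] bounds wc r(2))
    moreover have "c t = flat_chart \<Lambda> f w"
    proof (rule torus_ext)
      show "c t \<in> extensional (torus \<Lambda>)" using c tS by (simp add: smooth_curve_diffeos_def diffeos_def)
      show "flat_chart \<Lambda> f w \<in> extensional (torus \<Lambda>)" by (rule flat_chart_extensional)
      fix z
      have "c t (\<pi> z) = \<pi> (C (t, z))" "flat_chart \<Lambda> f w (\<pi> z) = \<pi> (F z + W (t, z))"
        using curve_liftD(1)[OF C tB] is_lift_flat_chart[OF F(2), of w] by (simp_all add: is_lift_def wp)
      then show "c t (\<pi> z) = flat_chart \<Lambda> f w (\<pi> z)"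
        using l by (simp add: W_def proj_eq_iff)
    qed
    ultimately show "c t \<in> flat_chart \<Lambda> f ` chart_nbhd e" by blast
  qed
  moreover have "m > 0" using d0 d1 d2 d3 by (simp add: m_def)
  ultimately show "\<exists>m>0. ball t0 m \<subseteq> {t \<in> S. c t \<in> flat_chart \<Lambda> f ` chart_nbhd e}" by blast
qed

lemma is_chart_flat_chart:
  assumes f: "f \<in> diffeos_plus \<Lambda>" and F: "smooth F" "is_lift f F" and e: "chart_radius F e"
  shows "is_chart \<Lambda> (chart_nbhd e) (flat_chart \<Lambda> f)"
  unfolding is_chart_def
proof (intro conjI allI impI)
  show "flat_chart \<Lambda> f ` chart_nbhd e \<subseteq> diffeos_plus \<Lambda>"
    using flat_chart_in_diffeos_plus[OF f F e] by blast
  fix S :: "real set" and w :: "real \<Rightarrow> complex set \<Rightarrow> complex"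
  assume "open S \<and> (\<forall>t\<in>S. w t \<in> chart_nbhd e)"
  then show "smooth_curve_cinf \<Lambda> S w \<longleftrightarrow> smooth_curve \<Lambda> S (\<lambda>t. flat_chart \<Lambda> f (w t))"
    using flat_chart_smooth_curve[OF f F e, of S w] smooth_curve_flat_chart_inverse[OF F e, of S w]
    unfolding smooth_curve_def by blast
next
  fix S :: "real set" and c :: "real \<Rightarrow> complex set \<Rightarrow> complex set"
  assume "open S \<and> smooth_curve \<Lambda> S c"
  then show "open {t \<in> S. c t \<in> flat_chart \<Lambda> f ` chart_nbhd e}"
    using flat_chart_image_open[OF F] unfolding smooth_curve_def by blast
qed (rule frechet_open_chart_nbhd inj_on_flat_chart[OF F(2) e])+

end

context lattice
begin

section \<open>The metric and the symplectic form\<close>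

lemma sectionsD:
  assumes "u \<in> sections \<Lambda> f"
  shows "u \<in> extensional (torus \<Lambda>)" "fst (u (\<pi> z)) = f (\<pi> z)"
    "smooth (\<lambda>z. snd (u (\<pi> z)))"
  using assms by (simp_all add: sections_def)

lemma sectionsI:
  assumes "u \<in> extensional (torus \<Lambda>)" "\<And>z. fst (u (\<pi> z)) = f (\<pi> z)"
    "smooth (\<lambda>z. snd (u (\<pi> z)))"
  shows "u \<in> sections \<Lambda> f"
  using assms by (auto simp: sections_def elim!: torus_cases)

lemma metric_diff_eq: "metric_diff \<Lambda> u v = cell_integral (\<lambda>z. snd (u (\<pi> z)) \<bullet> snd (v (\<pi> z)))"
  by (simp add: metric_diff_def torus_integral_eq flat_metric_def)

lemma metric_cstruct_eq:
  "metric_diff \<Lambda> (cstruct_diff \<Lambda> u) v = cell_integral (\<lambda>z. wedge (snd (u (\<pi> z))) (snd (v (\<pi> z))))"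
  by (simp add: metric_diff_eq cstruct_diff_def cstruct_def wedge_def)

lemma omega_diff_eq:
  "omega_diff \<Lambda> u v = cell_integral (\<lambda>z. wedge (snd (u (\<pi> z))) (snd (v (\<pi> z))))"
  by (simp add: omega_diff_def metric_cstruct_eq)

text \<open>The metric and the symplectic form are the cases of the inner product and of \<open>wedge\<close>.\<close>

lemma smooth_bilinear_form_cell_integral:
  assumes \<beta>: "bounded_bilinear \<beta>"
    and B: "\<And>u v. B u v = cell_integral (\<lambda>z. \<beta> (snd (u (\<pi> z))) (snd (v (\<pi> z))))"
  shows "smooth_bilinear_form \<Lambda> B"
  unfolding smooth_bilinear_form_def
proof (intro conjI ballI allI impI)
  interpret bounded_bilinear \<beta> by (rule \<beta>)
  fix f u v w r
  assume u: "u \<in> sections \<Lambda> f" and v: "v \<in> sections \<Lambda> f" and w: "w \<in> sections \<Lambda> f"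
  have cont: "continuous_on UNIV (\<lambda>z. \<beta> (snd (x (\<pi> z))) (snd (y (\<pi> z))))"
    if "x \<in> sections \<Lambda> f" "y \<in> sections \<Lambda> f" for x y
    by (intro smooth_on_continuous_on smooth_on_bilinear[OF open_UNIV \<beta>] sectionsD(3)[OF that(1)] sectionsD(3)[OF that(2)])
  show "B (sec_add \<Lambda> u v) w = B u w + B v w" "B w (sec_add \<Lambda> u v) = B w u + B w v"
    unfolding B by (simp_all add: sec_add_def add_left add_right cell_integral_add cont u v w)
  show "B (sec_scale \<Lambda> r u) w = r * B u w" "B w (sec_scale \<Lambda> r u) = r * B w u"
    unfolding B by (simp_all add: sec_scale_def scaleR_left scaleR_right cell_integral_cmult)
next
  fix S c U V
  assume a: "open S \<and> smooth_tangent_curve \<Lambda> S c U \<and> smooth_tangent_curve \<Lambda> S c V"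
  then have opn: "open (S \<times> (UNIV :: complex set))" by (intro open_Times) auto
  have "smooth_on (S \<times> UNIV) (\<lambda>p. \<beta> (case p of (t, z) \<Rightarrow> snd (U t (\<pi> z))) (case p of (t, z) \<Rightarrow> snd (V t (\<pi> z))))"
    using a by (intro smooth_on_bilinear[OF opn \<beta>]) (simp_all add: smooth_tangent_curve_def)
  from smooth_on_cell_integral[OF _ this] a show "smooth_on S (\<lambda>t. B (U t) (V t))"
    by (simp add: B)
qed

lemma section_zero:
  assumes u: "u \<in> sections \<Lambda> f" and 0: "cell_integral (\<lambda>z. snd (u (\<pi> z)) \<bullet> snd (u (\<pi> z))) = 0"
  shows "u = sec_zero \<Lambda> f"
proof (rule torus_ext)
  fix z
  have "snd (u (\<pi> z)) \<bullet> snd (u (\<pi> z)) = 0"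
    by (rule cell_integral_eq_0[OF _ _ _ 0])
      (auto intro!: smooth_on_continuous_on smooth_on_inner sectionsD(3)[OF u] simp: periodic_def proj_translate)
  then show "u (\<pi> z) = sec_zero \<Lambda> f (\<pi> z)"
    using sectionsD(2)[OF u, of z] by (simp add: sec_zero_def prod_eq_iff)
qed (use sectionsD(1)[OF u] in \<open>simp_all add: sec_zero_def\<close>)

lemma cstruct_diff_proj: "cstruct_diff \<Lambda> u (\<pi> z) = (fst (u (\<pi> z)), \<i> * snd (u (\<pi> z)))"
  by (simp add: cstruct_diff_def cstruct_def)

lemma cstruct_diff_section: "u \<in> sections \<Lambda> f \<Longrightarrow> cstruct_diff \<Lambda> u \<in> sections \<Lambda> f"
proof (rule sectionsI)
  assume u: "u \<in> sections \<Lambda> f"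
  show "cstruct_diff \<Lambda> u \<in> extensional (torus \<Lambda>)" by (simp add: cstruct_diff_def)
  show "fst (cstruct_diff \<Lambda> u (\<pi> z)) = f (\<pi> z)" for z
    by (simp add: cstruct_diff_proj sectionsD(2)[OF u])
  show "smooth (\<lambda>z. snd (cstruct_diff \<Lambda> u (\<pi> z)))"
    unfolding cstruct_diff_proj snd_conv by (intro smooth_intros sectionsD(3)[OF u])
qed

lemma weak_riemannian_metric_diff: "weak_riemannian_metric \<Lambda> (metric_diff \<Lambda>)"
  unfolding weak_riemannian_metric_def
proof (intro conjI ballI impI)
  show "smooth_bilinear_form \<Lambda> (metric_diff \<Lambda>)"
    by (rule smooth_bilinear_form_cell_integral[OF bounded_bilinear_inner metric_diff_eq])
  show "weakly_nondegenerate \<Lambda> (metric_diff \<Lambda>)"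
    unfolding weakly_nondegenerate_def using section_zero metric_diff_eq by metis
  show "metric_diff \<Lambda> u v = metric_diff \<Lambda> v u" for u v
    by (simp add: metric_diff_eq inner_commute)
  fix f u assume u: "u \<in> sections \<Lambda> f" "u \<noteq> sec_zero \<Lambda> f"
  have "metric_diff \<Lambda> u u \<ge> 0"
    unfolding metric_diff_eq cell_integral_def set_lebesgue_integral_def
    by (rule Bochner_Integration.integral_nonneg) simp
  moreover have "metric_diff \<Lambda> u u \<noteq> 0"
    using section_zero[OF u(1)] u(2) unfolding metric_diff_eq by blast
  ultimately show "metric_diff \<Lambda> u u > 0" by simp
qed

lemma almost_complex_structure_cstruct_diff: "almost_complex_structure \<Lambda> (cstruct_diff \<Lambda>)"
  unfolding almost_complex_structure_def
proof (intro conjI ballI allI impI)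
  have ext: "cstruct_diff \<Lambda> u \<in> extensional (torus \<Lambda>)" "sec_scale \<Lambda> r u \<in> extensional (torus \<Lambda>)"
    "sec_add \<Lambda> u v \<in> extensional (torus \<Lambda>)" for u v :: torus_section and r
    by (simp_all add: cstruct_diff_def sec_scale_def sec_add_def)
  fix f and u v :: torus_section and r :: real assume u: "u \<in> sections \<Lambda> f"
  show "cstruct_diff \<Lambda> u \<in> sections \<Lambda> f" by (rule cstruct_diff_section[OF u])
  show "cstruct_diff \<Lambda> (cstruct_diff \<Lambda> u) = sec_scale \<Lambda> (-1) u"
    by (rule torus_ext[OF ext(1,2)]) (simp add: cstruct_diff_proj sec_scale_def)
  show "cstruct_diff \<Lambda> (sec_add \<Lambda> u v) = sec_add \<Lambda> (cstruct_diff \<Lambda> u) (cstruct_diff \<Lambda> v)"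
    by (rule torus_ext[OF ext(1,3)]) (simp add: cstruct_diff_proj sec_add_def algebra_simps)
  show "cstruct_diff \<Lambda> (sec_scale \<Lambda> r u) = sec_scale \<Lambda> r (cstruct_diff \<Lambda> u)"
    by (rule torus_ext[OF ext(1,2)]) (simp add: cstruct_diff_proj sec_scale_def)
next
  fix S c U assume a: "open S \<and> smooth_tangent_curve \<Lambda> S c U"
  then have opn: "open (S \<times> (UNIV :: complex set))" by (intro open_Times) auto
  have "smooth_on (S \<times> UNIV) (\<lambda>(t, z). snd (U t (\<pi> z)))" using a by (simp add: smooth_tangent_curve_def)
  then have "smooth_on (S \<times> UNIV) (\<lambda>p. \<i> * (case p of (t, z) \<Rightarrow> snd (U t (\<pi> z))))"
    by (intro smooth_on_mult smooth_on_const opn)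
  moreover have "(\<lambda>p. \<i> * (case p of (t, z) \<Rightarrow> snd (U t (\<pi> z)))) = (\<lambda>(t, z). snd (cstruct_diff \<Lambda> (U t) (\<pi> z)))"
    by (auto simp: fun_eq_iff cstruct_diff_proj)
  ultimately show "smooth_tangent_curve \<Lambda> S c (\<lambda>t. cstruct_diff \<Lambda> (U t))"
    using a cstruct_diff_section unfolding smooth_tangent_curve_def by auto
qed

text \<open>The form pairs \<open>u\<close> with \<open>\<i> u\<close> to the square norm of \<open>u\<close>, which gives nondegeneracy. It is closed since the value on
transported vectors does not depend on the base point.\<close>

lemma weak_symplectic_form_omega: "weak_symplectic_form \<Lambda> (\<lambda>u v. metric_diff \<Lambda> (cstruct_diff \<Lambda> u) v)"
  unfolding weak_symplectic_form_def
proof (intro conjI ballI)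
  show "smooth_bilinear_form \<Lambda> (\<lambda>u v. metric_diff \<Lambda> (cstruct_diff \<Lambda> u) v)"
    by (rule smooth_bilinear_form_cell_integral[OF bounded_bilinear_wedge metric_cstruct_eq])
  show "weakly_nondegenerate \<Lambda> (\<lambda>u v. metric_diff \<Lambda> (cstruct_diff \<Lambda> u) v)"
    unfolding weakly_nondegenerate_def
  proof (intro ballI impI)
    fix f u assume u: "u \<in> sections \<Lambda> f" and 0: "\<forall>v\<in>sections \<Lambda> f. metric_diff \<Lambda> (cstruct_diff \<Lambda> u) v = 0"
    have w: "wedge x (\<i> * x) = x \<bullet> x" for x by (simp add: wedge_eq inner_complex_def)
    have "metric_diff \<Lambda> (cstruct_diff \<Lambda> u) (cstruct_diff \<Lambda> u) = 0"
      using 0 cstruct_diff_section[OF u] by blast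
    then show "u = sec_zero \<Lambda> f"
      unfolding metric_cstruct_eq by (intro section_zero[OF u]) (simp add: cstruct_diff_proj w)
  qed
  fix f and u v w :: torus_section
  have "wedge x y = (- 1) * wedge y x" for x y by (simp add: wedge_eq)
  then have "cell_integral (\<lambda>z. wedge (snd (u (\<pi> z))) (snd (v (\<pi> z))))
      = cell_integral (\<lambda>z. (- 1) * wedge (snd (v (\<pi> z))) (snd (u (\<pi> z))))" by metis
  then show "metric_diff \<Lambda> (cstruct_diff \<Lambda> u) v = - metric_diff \<Lambda> (cstruct_diff \<Lambda> v) u"
    unfolding metric_cstruct_eq cell_integral_cmult by simp
  show "ext_deriv_two_form \<Lambda> (\<lambda>u v. metric_diff \<Lambda> (cstruct_diff \<Lambda> u) v) f u v w = 0"
    by (simp add: ext_deriv_two_form_def form_dir_deriv_def metric_cstruct_eq transport_def Let_def)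
qed

section \<open>The flat atlas and integrability\<close>

lemma diffeos_plus_lift:
  assumes "f \<in> diffeos_plus \<Lambda>"
  obtains F G where "lift_pair F G" "smooth F" "is_lift f F" "equivariant F"
proof -
  have "f \<in> diffeos \<Lambda>" using assms by (simp add: diffeos_plus_def)
  then obtain F G where "lift_pair F G" "is_lift f F" by (rule diffeo_lift)
  then show thesis using that by (auto simp: lift_pair_def)
qed

lemma flat_chart_zero:
  assumes f: "f \<in> diffeos_plus \<Lambda>"
  shows "flat_chart \<Lambda> f (\<lambda>p\<in>torus \<Lambda>. 0) = f"
proof (rule torus_ext)
  show "flat_chart \<Lambda> f (\<lambda>p\<in>torus \<Lambda>. 0) \<in> extensional (torus \<Lambda>)" by (rule flat_chart_extensional)
  show "f \<in> extensional (torus \<Lambda>)" using f by (simp add: diffeos_plus_def diffeos_def)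
qed (simp add: flat_chart_def)

lemma zero_in_chart_nbhd: "e > 0 \<Longrightarrow> (\<lambda>p\<in>torus \<Lambda>. 0) \<in> chart_nbhd e"
  unfolding chart_nbhd_def cinf_def by (intro CollectI conjI exI[of _ 0]) simp_all

lemma flat_atlas: "flat_atlas \<Lambda>"
  unfolding flat_atlas_def
proof
  fix f assume f: "f \<in> diffeos_plus \<Lambda>"
  then obtain F G where F: "lift_pair F G" "smooth F" "is_lift f F" by (rule diffeos_plus_lift)
  obtain e where e: "chart_radius F e" by (rule chart_radius_exists[OF F(1)])
  then have "e > 0" by (simp add: chart_radius_def)
  then show "\<exists>V. is_chart \<Lambda> V (flat_chart \<Lambda> f) \<and> (\<lambda>p\<in>torus \<Lambda>. 0) \<in> V \<and> flat_chart \<Lambda> f (\<lambda>p\<in>torus \<Lambda>. 0) = f"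
    using is_chart_flat_chart[OF f F(2,3) e] zero_in_chart_nbhd flat_chart_zero[OF f] by blast
qed

text \<open>The curve \<open>t \<mapsto> f + w + t v\<close> has the affine lift \<open>F + w + t v\<close>.\<close>

lemma chart_diff_flat_chart:
  assumes F: "is_lift f F"
  shows "chart_diff \<Lambda> (flat_chart \<Lambda> f) w v (\<pi> z) = (\<pi> (F z + w (\<pi> z)), v (\<pi> z))"
proof -
  have lift: "flat_chart \<Lambda> f (\<lambda>p\<in>torus \<Lambda>. w p + t *\<^sub>R v p) (\<pi> z) = \<pi> (F z + (w (\<pi> z) + t *\<^sub>R v (\<pi> z)))" for t
    using is_lift_flat_chart[OF F] by (simp add: is_lift_def)
  have "torus_derivative \<Lambda> (\<lambda>t. flat_chart \<Lambda> f (\<lambda>p\<in>torus \<Lambda>. w p + t *\<^sub>R v p) (\<pi> z)) 0 = (\<lambda>t. t *\<^sub>R v (\<pi> z))"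
  proof (rule torus_derivative_eq)
    show "((\<lambda>t. F z + (w (\<pi> z) + t *\<^sub>R v (\<pi> z))) has_derivative (\<lambda>t. t *\<^sub>R v (\<pi> z))) (at 0)"
      by (auto intro!: derivative_eq_intros)
  qed (simp add: lift)
  then show ?thesis using lift[of 0] by (simp add: chart_diff_def velocity_def)
qed

lemma chart_diff_extensional: "chart_diff \<Lambda> \<psi> w v \<in> extensional (torus \<Lambda>)"
  by (simp add: chart_diff_def velocity_def)

lemma integrable_structure_cstruct_diff: "integrable_structure \<Lambda> (cstruct_diff \<Lambda>)"
  unfolding integrable_structure_def
proof
  fix f assume f: "f \<in> diffeos_plus \<Lambda>"
  then obtain F G where F: "lift_pair F G" "smooth F" "is_lift f F" by (rule diffeos_plus_lift)
  obtain e where e: "chart_radius F e" by (rule chart_radius_exists[OF F(1)])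
  then have e0: "e > 0" by (simp add: chart_radius_def)
  have "f \<in> flat_chart \<Lambda> f ` chart_nbhd e"
    using flat_chart_zero[OF f] zero_in_chart_nbhd[OF e0] by (metis image_eqI)
  moreover have "chart_diff \<Lambda> (flat_chart \<Lambda> f) w (\<lambda>p\<in>torus \<Lambda>. \<i> * v p) = cstruct_diff \<Lambda> (chart_diff \<Lambda> (flat_chart \<Lambda> f) w v)" for w v
    by (rule torus_ext[OF chart_diff_extensional])
      (simp_all add: chart_diff_flat_chart[OF F(3)] cstruct_diff_proj, simp add: cstruct_diff_def)
  ultimately show "\<exists>V \<psi>. is_chart \<Lambda> V \<psi> \<and> f \<in> \<psi> ` V \<and> (\<forall>w\<in>V. \<forall>v\<in>cinf \<Lambda>.
      chart_diff \<Lambda> \<psi> w (\<lambda>p\<in>torus \<Lambda>. \<i> * v p) = cstruct_diff \<Lambda> (chart_diff \<Lambda> \<psi> w v))"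
    using is_chart_flat_chart[OF f F(2,3) e] by blast
qed

lemma weak_kaehler: "weak_kaehler_structure \<Lambda> (metric_diff \<Lambda>) (cstruct_diff \<Lambda>)"
  unfolding weak_kaehler_structure_def
proof (intro conjI ballI weak_riemannian_metric_diff almost_complex_structure_cstruct_diff
    integrable_structure_cstruct_diff weak_symplectic_form_omega)
  have i: "(\<i> * x) \<bullet> (\<i> * y) = x \<bullet> y" for x y by (simp add: inner_complex_def)
  show "metric_diff \<Lambda> (cstruct_diff \<Lambda> u) (cstruct_diff \<Lambda> v) = metric_diff \<Lambda> u v" for u v
    by (simp add: metric_diff_eq cstruct_diff_proj i)
qed

text \<open>The straight line \<open>t \<mapsto> f + t u\<close> in the flat chart, for the times at which \<open>t u\<close> lies in the chart.\<close>

lemma curve_through_exists: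
  assumes f: "f \<in> diffeos_plus \<Lambda>" and u: "u \<in> sections \<Lambda> f"
  shows "\<exists>S c. curve_through \<Lambda> f u S c"
proof -
  obtain F G where F: "lift_pair F G" "smooth F" "is_lift f F" by (rule diffeos_plus_lift[OF f])
  obtain e where e: "chart_radius F e" by (rule chart_radius_exists[OF F(1)])
  then have e0: "e > 0" by (simp add: chart_radius_def)
  define v where "v z = snd (u (\<pi> z))" for z
  have v: "smooth v" "periodic v"
    using sectionsD(3)[OF u] by (simp_all add: v_def[abs_def] periodic_proj[of "\<lambda>p. snd (u p)"])
  have diff: "v differentiable at z" for z by (rule smooth_differentiable[OF v(1)])
  obtain M0 where M0: "M0 > 0" "\<And>z. norm (v z) \<le> M0"
    by (rule periodic_bounded[OF smooth_on_continuous_on[OF v(1)] v(2)]) blast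
  obtain M1 where M1: "M1 > 0" "\<And>z. norm (dd 1 v z) \<le> M1"
    by (rule periodic_bounded[OF smooth_on_continuous_on[OF smooth_on_dd[OF v(1)]] dd_periodic[OF v], of 1]) blast
  obtain M2 where M2: "M2 > 0" "\<And>z. norm (dd \<i> v z) \<le> M2"
    by (rule periodic_bounded[OF smooth_on_continuous_on[OF smooth_on_dd[OF v(1)]] dd_periodic[OF v], of \<i>]) blast
  define M where "M = M0 + M1 + M2"
  have M: "M > 0" "\<And>z. norm (v z) \<le> M" "\<And>z. norm (dd 1 v z) \<le> M" "\<And>z. norm (dd \<i> v z) \<le> M"
    using M0 M1 M2 unfolding M_def by (smt (verit))+
  define S where "S = ball (0::real) (e / (2 * M))"
  define w where "w t = (\<lambda>p\<in>torus \<Lambda>. (\<lambda>p\<in>torus \<Lambda>. 0) p + t *\<^sub>R snd (u p))" for t :: real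
  have wp: "w t (\<pi> z) = t *\<^sub>R v z" for t z by (simp add: w_def v_def)
  have sw: "smooth (\<lambda>z. t *\<^sub>R v z)" for t :: real by (intro smooth_intros v)
  have wc: "w t \<in> cinf \<Lambda>" for t unfolding cinf_def by (simp add: wp sw) (simp add: w_def)
  have wV: "w t \<in> chart_nbhd e" if "t \<in> S" for t
  proof -
    have ddw: "dd b (\<lambda>z. t *\<^sub>R v z) z = t *\<^sub>R dd b v z" for b z
      by (rule dd_linear_compose[OF bounded_linear_scaleR_right diff])
    have "\<bar>t\<bar> < e / (2 * M)" using that by (simp add: S_def dist_real_def)
    then have tM: "\<bar>t\<bar> * M \<le> e / 2" using M(1) by (simp add: field_simps)
    have "norm (t *\<^sub>R x) \<le> e / 2" if "norm x \<le> M" for x :: complex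
      using mult_left_mono[OF that, of "\<bar>t\<bar>"] tM by simp
    then show ?thesis
      unfolding chart_nbhd_def using wc[of t] e0 M(2-4)
      by (intro CollectI conjI exI[of _ "e / 2"] allI) (simp_all add: wp ddw)
  qed
  have S: "open S" "0 \<in> S" using e0 M(1) by (simp_all add: S_def)
  have opn: "open (S \<times> (UNIV :: complex set))" by (intro open_Times S open_UNIV)
  have "smooth_on (S \<times> UNIV) (\<lambda>p. fst p *\<^sub>R v (snd p))"
    by (intro smooth_on_scaleR opn smooth_on_fst smooth_on_ident
        smooth_on_compose[OF opn subset_UNIV smooth_on_snd[OF opn smooth_on_ident] v(1)])
  moreover have "(\<lambda>p. fst p *\<^sub>R v (snd p)) = (\<lambda>(t, z). w t (\<pi> z))"
    by (auto simp: fun_eq_iff wp)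
  ultimately have "smooth_curve_cinf \<Lambda> S w" by (simp add: smooth_curve_cinf_def wc)
  from wV this have sc: "smooth_curve \<Lambda> S (\<lambda>t. flat_chart \<Lambda> f (w t))"
    by (rule flat_chart_smooth_curve[OF f F(2,3) e S(1)])
  have "w 0 = (\<lambda>p\<in>torus \<Lambda>. 0)" by (auto simp: w_def fun_eq_iff)
  then have c0: "flat_chart \<Lambda> f (w 0) = f" using flat_chart_zero[OF f] by simp
  have "velocity \<Lambda> (\<lambda>t. flat_chart \<Lambda> f (w t)) 0 = u"
  proof (rule torus_ext)
    show "velocity \<Lambda> (\<lambda>t. flat_chart \<Lambda> f (w t)) 0 \<in> extensional (torus \<Lambda>)" by (simp add: velocity_def)
    show "u \<in> extensional (torus \<Lambda>)" by (rule sectionsD(1)[OF u])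
    show "velocity \<Lambda> (\<lambda>t. flat_chart \<Lambda> f (w t)) 0 (\<pi> z) = u (\<pi> z)" for z
      using chart_diff_flat_chart[OF F(3), of "\<lambda>p\<in>torus \<Lambda>. 0" "\<lambda>p. snd (u p)" z] sectionsD(2)[OF u, of z] F(3)
      unfolding chart_diff_def w_def[symmetric] by (simp add: is_lift_def prod_eq_iff)
  qed
  then show ?thesis unfolding curve_through_def using S sc c0 by blast
qed

section \<open>The action of the Hamiltonian group\<close>

lemma lift_pair_compose:
  assumes "lift_pair F G" "lift_pair P Q"
  shows "lift_pair (\<lambda>z. F (P z)) (\<lambda>z. Q (G z))"
proof -
  have "F (P (z + l)) - F (P z) \<in> \<Lambda>" "Q (G (z + l)) - Q (G z) \<in> \<Lambda>" if "l \<in> \<Lambda>" for z l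
  proof -
    have eq: "equivariant F" "equivariant P" "equivariant G" "equivariant Q"
      using assms by (auto simp: lift_pair_def)
    have "P (z + l) - P z \<in> \<Lambda>" "G (z + l) - G z \<in> \<Lambda>" using eq that by (auto simp: equivariant_def)
    then have "F (P z + (P (z + l) - P z)) - F (P z) \<in> \<Lambda>" "Q (G z + (G (z + l) - G z)) - Q (G z) \<in> \<Lambda>"
      using eq unfolding equivariant_def by blast+
    then show "F (P (z + l)) - F (P z) \<in> \<Lambda>" "Q (G (z + l)) - Q (G z) \<in> \<Lambda>" by simp_all
  qed
  moreover have "smooth (\<lambda>z. F (P z))" "smooth (\<lambda>z. Q (G z))"
    using assms by (auto simp: lift_pair_def intro: smooth_on_compose[OF open_UNIV subset_UNIV])
  ultimately show ?thesis using assms by (simp add: lift_pair_def equivariant_def)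
qed

lemma is_lift_compose:
  "is_lift f F \<Longrightarrow> is_lift \<phi> P \<Longrightarrow> is_lift (compose (torus \<Lambda>) f \<phi>) (\<lambda>z. F (P z))"
  by (simp add: is_lift_def compose_def)

lemma compose_proj: "is_lift \<phi> P \<Longrightarrow> compose (torus \<Lambda>) u \<phi> (\<pi> z) = u (\<pi> (P z))"
  by (simp add: is_lift_def compose_def)

lemma compose_in_extensional: "compose (torus \<Lambda>) u \<phi> \<in> extensional (torus \<Lambda>)"
  by (simp add: compose_def)

text \<open>If \<open>jac P = 1\<close> then \<open>jac (F \<circ> P) - 1\<close> is the pullback of the exact density \<open>jac F - 1\<close>.\<close>

lemma compose_symp_diffeos_plus:
  assumes f: "f \<in> diffeos_plus \<Lambda>" and \<phi>: "\<phi> \<in> diffeos \<Lambda>" "smooth P" "is_lift \<phi> P" "\<And>z. jac P z = 1"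
  shows "compose (torus \<Lambda>) f \<phi> \<in> diffeos_plus \<Lambda>"
proof -
  obtain F G where F: "lift_pair F G" "smooth F" "is_lift f F" by (rule diffeos_plus_lift[OF f])
  obtain Q where Q: "lift_pair P Q" by (rule lift_pair_of_diffeo[OF \<phi>(1-3)])
  have lift: "is_lift (compose (torus \<Lambda>) f \<phi>) (\<lambda>z. F (P z))" by (rule is_lift_compose[OF F(3) \<phi>(3)])
  have d: "compose (torus \<Lambda>) f \<phi> \<in> diffeos \<Lambda>"
    by (rule diffeo_of_lift_pair[OF lift_pair_compose[OF F(1) Q] compose_in_extensional lift])
  have sm: "smooth (\<lambda>z. F (P z))" by (rule smooth_on_compose[OF open_UNIV subset_UNIV \<phi>(2) F(2)])
  have fd: "f \<in> diffeos \<Lambda>" using f by (simp add: diffeos_plus_def)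
  have "exact_density (\<lambda>z. (jac F (P z) - 1) * jac P z)"
    using f diffeos_plus_iff[OF fd F(2,3)] by (intro exact_density_pullback[OF _ \<phi>(2) is_lift_equivariant[OF \<phi>(3)]]) blast
  moreover have "jac (\<lambda>z. F (P z)) z = jac F (P z)" for z
    using jac_compose[OF smooth_differentiable[OF F(2)] smooth_differentiable[OF \<phi>(2)]] by (simp add: \<phi>(4))
  ultimately show ?thesis unfolding diffeos_plus_iff[OF d sm lift] by (simp add: \<phi>(4))
qed

lemma compose_section:
  assumes u: "u \<in> sections \<Lambda> f" and P: "smooth P" "is_lift \<phi> P"
  shows "compose (torus \<Lambda>) u \<phi> \<in> sections \<Lambda> (compose (torus \<Lambda>) f \<phi>)"
proof (rule sectionsI[OF compose_in_extensional])
  show "fst (compose (torus \<Lambda>) u \<phi> (\<pi> z)) = compose (torus \<Lambda>) f \<phi> (\<pi> z)" for z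
    by (simp add: compose_proj[OF P(2)] sectionsD(2)[OF u])
  show "smooth (\<lambda>z. snd (compose (torus \<Lambda>) u \<phi> (\<pi> z)))"
    unfolding compose_proj[OF P(2)] by (rule smooth_on_compose[OF open_UNIV subset_UNIV P(1) sectionsD(3)[OF u]])
qed

lemma compose_curve_through:
  assumes c: "curve_through \<Lambda> f u S c"
    and \<phi>: "\<phi> \<in> diffeos \<Lambda>" "smooth P" "is_lift \<phi> P" "\<And>z. jac P z = 1"
  shows "curve_through \<Lambda> (compose (torus \<Lambda>) f \<phi>) (compose (torus \<Lambda>) u \<phi>) S (\<lambda>t. compose (torus \<Lambda>) (c t) \<phi>)"
proof -
  have S: "open S" "0 \<in> S" and sc: "smooth_curve_diffeos \<Lambda> S c" and cp: "\<And>t. t \<in> S \<Longrightarrow> c t \<in> diffeos_plus \<Lambda>"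
    and c0: "c 0 = f" "velocity \<Lambda> c 0 = u"
    using c by (auto simp: curve_through_def smooth_curve_def)
  have mem: "compose (torus \<Lambda>) (c t) \<phi> \<in> diffeos_plus \<Lambda>" if "t \<in> S" for t
    by (rule compose_symp_diffeos_plus[OF cp[OF that] \<phi>])
  define T where "T p = (fst p, P (snd p))" for p :: "real \<times> complex"
  have smT: "smooth T"
    unfolding T_def[abs_def]
    by (intro smooth_on_Pair smooth_on_fst smooth_on_ident open_UNIV
        smooth_on_compose[OF open_UNIV subset_UNIV smooth_on_snd[OF open_UNIV smooth_on_ident] \<phi>(2)])
  have "smooth_into_torus \<Lambda> (S \<times> UNIV) (\<lambda>(t, z). compose (torus \<Lambda>) (c t) \<phi> (\<pi> z))"
    unfolding smooth_into_torus_def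
  proof
    fix x :: "real \<times> complex" assume x: "x \<in> S \<times> UNIV"
    have Tx: "T x \<in> S \<times> UNIV" using x by (auto simp: T_def)
    have smc: "smooth_into_torus \<Lambda> (S \<times> UNIV) (\<lambda>(t, z). c t (\<pi> z))" using sc by (simp add: smooth_curve_diffeos_def)
    obtain U H where U: "open U" "T x \<in> U" "smooth_on U H"
      "\<And>y. y \<in> U \<inter> (S \<times> UNIV) \<Longrightarrow> (\<lambda>(t, z). c t (\<pi> z)) y = \<pi> (H y)"
      by (rule smooth_into_torusE[OF smc Tx]) blast
    have "open (T -` U)" by (rule open_vimage[OF U(1) smooth_on_continuous_on[OF smT]])
    moreover have "smooth_on (T -` U) (\<lambda>p. H (T p))"
      by (rule smooth_on_compose[OF \<open>open (T -` U)\<close> _ smooth_on_subset[OF smT subset_UNIV] U(3)]) auto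
    moreover have "(case y of (t, z) \<Rightarrow> compose (torus \<Lambda>) (c t) \<phi> (\<pi> z)) = \<pi> (H (T y))"
      if "y \<in> T -` U \<inter> (S \<times> UNIV)" for y
    proof -
      obtain t z where y: "y = (t, z)" by (cases y)
      have "T y \<in> U \<inter> (S \<times> UNIV)" using that by (auto simp: T_def)
      from U(4)[OF this] show ?thesis by (simp add: y T_def compose_proj[OF \<phi>(3)])
    qed
    ultimately show "\<exists>U F. open U \<and> x \<in> U \<and> smooth_on U F \<and>
        (\<forall>y\<in>U \<inter> S \<times> UNIV. (case y of (t, z) \<Rightarrow> compose (torus \<Lambda>) (c t) \<phi> (\<pi> z)) = \<pi> (F y))"
      using U(2) by (intro exI[of _ "T -` U"] exI[of _ "\<lambda>p. H (T p)"]) blast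
  qed
  then have "smooth_curve \<Lambda> S (\<lambda>t. compose (torus \<Lambda>) (c t) \<phi>)"
    using mem by (simp add: smooth_curve_def smooth_curve_diffeos_def diffeos_plus_def)
  moreover have "velocity \<Lambda> (\<lambda>t. compose (torus \<Lambda>) (c t) \<phi>) 0 = compose (torus \<Lambda>) u \<phi>"
  proof (rule torus_ext[OF _ compose_in_extensional])
    show "velocity \<Lambda> (\<lambda>t. compose (torus \<Lambda>) (c t) \<phi>) 0 \<in> extensional (torus \<Lambda>)" by (simp add: velocity_def)
    show "velocity \<Lambda> (\<lambda>t. compose (torus \<Lambda>) (c t) \<phi>) 0 (\<pi> z) = compose (torus \<Lambda>) u \<phi> (\<pi> z)" for z
      unfolding c0(2)[symmetric] compose_proj[OF \<phi>(3)] by (simp add: velocity_def compose_proj[OF \<phi>(3)])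
  qed
  ultimately show ?thesis using S c0 by (simp add: curve_through_def)
qed

lemma acts_by_precomposition: "acts_by_precomposition \<Lambda>"
  unfolding acts_by_precomposition_def
proof (intro ballI)
  fix \<phi> f assume "\<phi> \<in> ham \<Lambda>" and f: "f \<in> diffeos_plus \<Lambda>"
  then obtain P where \<phi>: "\<phi> \<in> diffeos \<Lambda>" "smooth P" "is_lift \<phi> P" "\<And>z. jac P z = 1"
    using ham_lift by metis
  show "compose (torus \<Lambda>) f \<phi> \<in> diffeos_plus \<Lambda> \<and>
     (\<forall>u\<in>sections \<Lambda> f. compose (torus \<Lambda>) u \<phi> \<in> sections \<Lambda> (compose (torus \<Lambda>) f \<phi>) \<and>
        (\<forall>S c. curve_through \<Lambda> f u S c \<longrightarrow>
           curve_through \<Lambda> (compose (torus \<Lambda>) f \<phi>) (compose (torus \<Lambda>) u \<phi>) S (\<lambda>t. compose (torus \<Lambda>) (c t) \<phi>)))"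
    using compose_symp_diffeos_plus[OF f \<phi>] compose_section[OF _ \<phi>(2,3)] compose_curve_through[OF _ \<phi>] by blast
qed

lemma ham_invariant_omega_diff: "ham_invariant \<Lambda> (omega_diff \<Lambda>)"
  unfolding ham_invariant_def
proof (intro ballI)
  fix \<phi> f u v assume "\<phi> \<in> ham \<Lambda>" and u: "u \<in> sections \<Lambda> f" and v: "v \<in> sections \<Lambda> f"
  then obtain P where P: "is_lift \<phi> P"
    "\<And>g :: complex \<Rightarrow> real. smooth g \<Longrightarrow> periodic g \<Longrightarrow> cell_integral (\<lambda>z. g (P z)) = cell_integral g"
    using ham_lift by metis
  show "omega_diff \<Lambda> (compose (torus \<Lambda>) u \<phi>) (compose (torus \<Lambda>) v \<phi>) = omega_diff \<Lambda> u v"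
    unfolding omega_diff_eq compose_proj[OF P(1)]
    by (rule P(2)) (intro smooth_on_wedge sectionsD(3)[OF u] sectionsD(3)[OF v] open_UNIV,
      simp add: periodic_def proj_translate)
qed

section \<open>The moment map\<close>

lemma pushforward_proj:
  assumes F: "smooth F" "is_lift f F" and X: "fst (X (\<pi> z)) = \<pi> z"
  shows "pushforward \<Lambda> f X (\<pi> z) = (f (\<pi> z), dd (snd (X (\<pi> z))) F z)"
proof -
  have "X (\<pi> z) = (\<pi> z, snd (X (\<pi> z)))" using X by (simp add: prod_eq_iff)
  then have "pushforward \<Lambda> f X (\<pi> z) = tangent_map \<Lambda> f (\<pi> z, snd (X (\<pi> z)))"
    by (simp add: pushforward_def)
  then show ?thesis using F(2) by (simp add: tangent_map_lift[OF F] is_lift_def)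
qed

lemma pushforward_section:
  assumes F: "smooth F" "is_lift f F" and Y: "Y \<in> vector_fields \<Lambda>"
  shows "pushforward \<Lambda> f Y \<in> sections \<Lambda> f"
proof (rule sectionsI)
  have Y': "fst (Y (\<pi> z)) = \<pi> z" for z
    using Y sectionsD(2) unfolding vector_fields_def by fastforce
  have smY: "smooth (\<lambda>z. snd (Y (\<pi> z)))" using Y sectionsD(3) unfolding vector_fields_def by blast
  show "pushforward \<Lambda> f Y \<in> extensional (torus \<Lambda>)" by (simp add: pushforward_def)
  show "fst (pushforward \<Lambda> f Y (\<pi> z)) = f (\<pi> z)" for z by (simp add: pushforward_proj[where X=Y, OF F Y'])
  have "smooth (\<lambda>z. Re (snd (Y (\<pi> z))) *\<^sub>R dd 1 F z + Im (snd (Y (\<pi> z))) *\<^sub>R dd \<i> F z)"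
    by (intro smooth_intros smY F)
  moreover have "(\<lambda>z. snd (pushforward \<Lambda> f Y (\<pi> z)))
     = (\<lambda>z. Re (snd (Y (\<pi> z))) *\<^sub>R dd 1 F z + Im (snd (Y (\<pi> z))) *\<^sub>R dd \<i> F z)"
    unfolding pushforward_proj[where X=Y, OF F Y'] snd_conv
    by (rule ext) (rule dd_expand[OF smooth_differentiable[OF F(1)]])
  ultimately show "smooth (\<lambda>z. snd (pushforward \<Lambda> f Y (\<pi> z)))" by simp
qed

lemma mu_diff_cinf0:
  assumes f: "f \<in> diffeos_plus \<Lambda>"
  shows "mu_diff \<Lambda> f \<in> cinf0 \<Lambda>"
proof -
  obtain F G where F: "lift_pair F G" "smooth F" "is_lift f F" by (rule diffeos_plus_lift[OF f])
  have fd: "f \<in> diffeos \<Lambda>" using f by (simp add: diffeos_plus_def)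
  note mu = mu_diff_lift[OF F(2,3)]
  have "smooth (\<lambda>z. 1 - jac F z)" by (intro smooth_intros smooth_on_jac F)
  then have "mu_diff \<Lambda> f \<in> cinf \<Lambda>" by (simp add: cinf_def mu) (simp add: mu_diff_def)
  moreover have "cell_integral (\<lambda>z. (- 1) * (jac F z - 1)) = 0"
    unfolding cell_integral_cmult using f diffeos_plus_iff[OF fd F(2,3)] cell_integral_exact by simp
  ultimately show ?thesis by (simp add: cinf0_def torus_integral_eq mu)
qed

text \<open>A curve through \<open>f\<close> need not be given by a lift that starts at \<open>F\<close>, but all lifts of \<open>f\<close> have the same
derivatives, and these are all that enters the variation of the Jacobian.\<close>

lemma mu_diff_has_diff_derivative:
  assumes f: "f \<in> diffeos_plus \<Lambda>" and F: "smooth F" "is_lift f F" and u: "u \<in> sections \<Lambda> f"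
    and k: "\<And>z. k (\<pi> z) = - jac_variation F (\<lambda>z. snd (u (\<pi> z))) z"
  shows "has_diff_derivative \<Lambda> (mu_diff \<Lambda>) f u k"
  unfolding has_diff_derivative_def
proof (intro conjI allI impI ballI)
  show "\<exists>S c. curve_through \<Lambda> f u S c" by (rule curve_through_exists[OF f u])
  fix S c p assume c: "curve_through \<Lambda> f u S c" and "p \<in> torus \<Lambda>"
  then obtain z where p: "p = \<pi> z" using torus_cases by blast
  have S: "open S" "0 \<in> S" "smooth_curve_diffeos \<Lambda> S c" "c 0 = f" "velocity \<Lambda> c 0 = u"
    using c by (auto simp: curve_through_def smooth_curve_def)
  obtain d C where d: "d > 0" "ball 0 d \<subseteq> S" and C: "curve_lift (ball 0 d) c C"
    by (rule local_curve_lift_exists[OF S(3,1,2)])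
  then have t0: "(0::real) \<in> ball 0 d" by simp
  note CD = curve_liftD[OF C t0]
  have "dd (1, 0) C (0, z) = snd (u (\<pi> z))" for z
    using velocity_lift[OF C t0, of z] S(5) by simp
  moreover have "dd v (\<lambda>z. C (0, z)) z = dd v F z" for v z
    using tangent_map_lift[OF F, of z v] tangent_map_lift[OF CD(2,1), of z v] S(4) by simp
  ultimately have "jac_variation (\<lambda>z. C (0, z)) (\<lambda>z. dd (1, 0) C (0, z)) z = jac_variation F (\<lambda>z. snd (u (\<pi> z))) z"
    unfolding jac_variation_def by simp
  then show "((\<lambda>t. mu_diff \<Lambda> (c t) p) has_real_derivative k p) (at 0)"
    using mu_diff_derivative[OF C t0, of z] by (simp add: p k)
qed

lemma mu_diff_moment_equation:
  assumes f: "f \<in> diffeos_plus \<Lambda>" and Y: "Y \<in> vector_fields \<Lambda>"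
  shows "\<exists>k\<in>cinf0 \<Lambda>. has_diff_derivative \<Lambda> (mu_diff \<Lambda>) f (pushforward \<Lambda> f Y) k \<and>
        (\<forall>h\<in>cinf0 \<Lambda>. omega_diff \<Lambda> (pushforward \<Lambda> f (ham_field \<Lambda> h)) (pushforward \<Lambda> f Y)
           = - torus_integral \<Lambda> (\<lambda>p. k p * h p))"
proof -
  obtain F G where F: "lift_pair F G" "smooth F" "is_lift f F" "equivariant F" by (rule diffeos_plus_lift[OF f])
  have u: "pushforward \<Lambda> f Y \<in> sections \<Lambda> f" by (rule pushforward_section[OF F(2,3) Y])
  define W where "W z = snd (pushforward \<Lambda> f Y (\<pi> z))" for z
  have W: "smooth W" "periodic W"
    using sectionsD(3)[OF u] by (simp_all add: W_def[abs_def] periodic_proj[of "\<lambda>p. snd (pushforward \<Lambda> f Y p)"])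
  have per: "periodic (\<lambda>z. - jac_variation F W z)"
    using dd_lift_periodic[OF F(2,4)] dd_periodic[OF W] by (simp add: periodic_def jac_variation_def)
  have sm: "smooth (\<lambda>z. - jac_variation F W z)"
    by (intro smooth_on_minus smooth_on_jac_variation F W open_UNIV)
  define k where "k = descend (\<lambda>z. - jac_variation F W z)"
  have k: "k (\<pi> z) = - jac_variation F W z" for z unfolding k_def by (rule descend_proj[OF per])
  have "cell_integral (\<lambda>z. (- 1) * jac_variation F W z) = 0"
    unfolding cell_integral_cmult using cell_integral_jac_variation_0[OF F(2,4) W] by simp
  then have "k \<in> cinf0 \<Lambda>"
    using descend_in_cinf[OF per sm] by (simp add: cinf0_def torus_integral_eq k) (simp add: k_def)
  moreover have "has_diff_derivative \<Lambda> (mu_diff \<Lambda>) f (pushforward \<Lambda> f Y) k"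
    by (rule mu_diff_has_diff_derivative[OF f F(2,3) u]) (simp add: k W_def[abs_def])
  moreover have "omega_diff \<Lambda> (pushforward \<Lambda> f (ham_field \<Lambda> h)) (pushforward \<Lambda> f Y) = - torus_integral \<Lambda> (\<lambda>p. k p * h p)"
    if "h \<in> cinf0 \<Lambda>" for h
  proof -
    let ?h = "\<lambda>z. h (\<pi> z)"
    have h: "smooth ?h" using that by (simp add: cinf0_def cinf_def)
    have "omega_diff \<Lambda> (pushforward \<Lambda> f (ham_field \<Lambda> h)) (pushforward \<Lambda> f Y)
        = cell_integral (\<lambda>z. wedge (dd (ham_vector ?h z) F z) (W z))"
      unfolding omega_diff_eq W_def[symmetric]
      by (simp add: pushforward_proj[OF F(2,3), of "ham_field \<Lambda> h"] ham_field_proj[OF h])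
    also have "\<dots> = cell_integral (\<lambda>z. ?h z * jac_variation F W z)"
      by (rule cell_integral_jac_variation[OF F(2,4) W h periodic_proj, symmetric])
    also have "\<dots> = - cell_integral (\<lambda>z. (- 1) * (?h z * jac_variation F W z))"
      unfolding cell_integral_cmult by simp
    finally show ?thesis by (simp add: torus_integral_eq k mult.commute)
  qed
  ultimately show ?thesis by blast
qed

lemma mu_diff_equivariant:
  assumes f: "f \<in> diffeos_plus \<Lambda>" and \<phi>: "\<phi> \<in> ham \<Lambda>"
  shows "mu_diff \<Lambda> (compose (torus \<Lambda>) f \<phi>) = compose (torus \<Lambda>) (mu_diff \<Lambda> f) \<phi>"
proof (rule torus_ext[OF _ compose_in_extensional])
  show "mu_diff \<Lambda> (compose (torus \<Lambda>) f \<phi>) \<in> extensional (torus \<Lambda>)" by (simp add: mu_diff_def)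
  obtain F G where F: "lift_pair F G" "smooth F" "is_lift f F" by (rule diffeos_plus_lift[OF f])
  obtain P where P: "smooth P" "is_lift \<phi> P" "\<And>z. jac P z = 1"
    by (rule ham_lift[OF \<phi>]) blast
  fix z
  have "mu_diff \<Lambda> (compose (torus \<Lambda>) f \<phi>) (\<pi> z) = 1 - jac (\<lambda>z. F (P z)) z"
    by (rule mu_diff_lift[OF smooth_on_compose[OF open_UNIV subset_UNIV P(1) F(2)] is_lift_compose[OF F(3) P(2)]])
  also have "\<dots> = 1 - jac F (P z)"
    using jac_compose[OF smooth_differentiable[OF F(2)] smooth_differentiable[OF P(1)]] by (simp add: P(3))
  also have "\<dots> = compose (torus \<Lambda>) (mu_diff \<Lambda> f) \<phi> (\<pi> z)"
    by (simp add: compose_proj[OF P(2)] mu_diff_lift[OF F(2,3)])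
  finally show "mu_diff \<Lambda> (compose (torus \<Lambda>) f \<phi>) (\<pi> z) = compose (torus \<Lambda>) (mu_diff \<Lambda> f) \<phi> (\<pi> z)" .
qed

lemma is_moment_map_mu_diff: "is_moment_map \<Lambda> (omega_diff \<Lambda>) (mu_diff \<Lambda>)"
  unfolding is_moment_map_def
proof (intro conjI ballI allI impI)
  show "mu_diff \<Lambda> ` diffeos_plus \<Lambda> \<subseteq> cinf0 \<Lambda>" using mu_diff_cinf0 by blast
  show "smooth_curve_cinf \<Lambda> S (\<lambda>t. mu_diff \<Lambda> (c t))" if "open S \<and> smooth_curve \<Lambda> S c" for S c
    using that mu_diff_smooth_curve unfolding smooth_curve_def by blast
qed (rule mu_diff_moment_equation mu_diff_equivariant, assumption+)+

lemma mu_diff_zero_locus: "{f \<in> diffeos_plus \<Lambda>. mu_diff \<Lambda> f = (\<lambda>p\<in>torus \<Lambda>. 0)} = symp \<Lambda>"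
proof -
  have "mu_diff \<Lambda> f = (\<lambda>p\<in>torus \<Lambda>. 0) \<longleftrightarrow> f \<in> symp \<Lambda>" if f: "f \<in> diffeos_plus \<Lambda>" for f
  proof -
    obtain F G where F: "lift_pair F G" "smooth F" "is_lift f F" by (rule diffeos_plus_lift[OF f])
    have fd: "f \<in> diffeos \<Lambda>" using f by (simp add: diffeos_plus_def)
    have "mu_diff \<Lambda> f = (\<lambda>p\<in>torus \<Lambda>. 0) \<longleftrightarrow> (\<forall>z. jac F z = 1)"
    proof
      assume *: "mu_diff \<Lambda> f = (\<lambda>p\<in>torus \<Lambda>. 0)"
      show "\<forall>z. jac F z = 1" using mu_diff_lift[OF F(2,3)] unfolding * by simp
    next
      assume "\<forall>z. jac F z = 1"
      then show "mu_diff \<Lambda> f = (\<lambda>p\<in>torus \<Lambda>. 0)"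
        by (intro torus_ext) (simp_all add: mu_diff_lift[OF F(2,3)], simp add: mu_diff_def)
    qed
    then show ?thesis by (simp add: symp_iff[OF fd F(2,3)])
  qed
  then show ?thesis using symp_subset by blast
qed

end

lemma is_lattice_lattice:
  assumes "is_lattice \<Lambda>"
  obtains a b where "lattice \<Lambda> a b"
proof -
  define p where "p = (SOME (a, b). lattice_basis \<Lambda> a b)"
  have "\<exists>p. case p of (a, b) \<Rightarrow> lattice_basis \<Lambda> a b" using assms by (auto simp: is_lattice_def)
  then have "case p of (a, b) \<Rightarrow> lattice_basis \<Lambda> a b" unfolding p_def by (rule someI_ex)
  then have "lattice \<Lambda> (fst p) (snd p)" by (unfold_locales) (auto simp: p_def)
  then show thesis by (rule that)
qed

theorem theorem1p2:
  fixes \<Lambda> :: "complex set"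
  assumes "is_lattice \<Lambda>"
  shows "flat_atlas \<Lambda> \<and>
     weak_kaehler_structure \<Lambda> (metric_diff \<Lambda>) (cstruct_diff \<Lambda>) \<and>
     (\<forall>f\<in>diffeos_plus \<Lambda>. \<forall>u\<in>sections \<Lambda> f. \<forall>v\<in>sections \<Lambda> f.
        omega_diff \<Lambda> u v = torus_integral \<Lambda> (\<lambda>p. sigma (u p) (v p))) \<and>
     acts_by_precomposition \<Lambda> \<and>
     ham_invariant \<Lambda> (omega_diff \<Lambda>) \<and>
     is_moment_map \<Lambda> (omega_diff \<Lambda>) (mu_diff \<Lambda>) \<and>
     {f \<in> diffeos_plus \<Lambda>. mu_diff \<Lambda> f = (\<lambda>p\<in>torus \<Lambda>. 0)} = symp \<Lambda>"
proof -
  obtain a b where "lattice \<Lambda> a b" by (rule is_lattice_lattice[OF assms])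
  then interpret lattice \<Lambda> a b .
  show ?thesis
    using flat_atlas weak_kaehler acts_by_precomposition ham_invariant_omega_diff is_moment_map_mu_diff mu_diff_zero_locus
    by (simp add: omega_diff_eq torus_integral_eq sigma_eq_wedge)
qed

end
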